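(* (Algebraic form of $e^{s_t}$ for nondegenerate $G$.) Let $A=A^T\in\mathbb C^{n\times n}$, $B=B^*\in\mathbb C^{n\times n}$, $h\in\mathbb C^n$, let $$\widehat H=\tfrac{i}{2}\bigl((a^\dagger,Aa^\dagger)-(a,\overline A a)\bigr)+(a^\dagger,Ba)+i(a^\dagger,h)-i(a,\overline h),$$ and suppose that $G=\begin{pmatrix}-iB&A\\ \overline A&i\overline B\end{pmatrix}$ satisfies $\det G\neq0$. Let $z\in\mathbb C^n$ be given by $\begin{pmatrix}z\\ \overline z\end{pmatrix}=G^{-1}\begin{pmatrix}h\\ \overline h\end{pmatrix}$. Then for every $t\in\mathbb R$, with $\Phi_t,R_t,\rho_t$ and $e^{i\pi\mathrm{Ind}(0,t)}/\sqrt{\det\Phi_t}$ as in the context, $$\langle0|e^{i\widehat Ht}|0\rangle=\frac{e^{i\pi\mathrm{Ind}(0,t)}}{\sqrt{\det\Phi_t}}\exp\Bigl\{-\tfrac{it}{2}\operatorname{tr}B+\tfrac12(z,(\overline\rho_t-\overline At)z)-\tfrac12(\overline z,(R_t-At)\overline z)+(\overline z,(\Phi_t^{-1}-I-iBt)z)\Bigr\}.$$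
   Context: $a=(a_1,\dots,a_n)$, $a^\dagger=(a_1^\dagger,\dots,a_n^\dagger)$ are the annihilation and creation operators on $\mathcal H=\otimes_1^n\ell_2$ (the $n$-mode boson Fock space), $[a_i,a_j^\dagger]=\delta_{ij}$, with vacuum $|0\rangle$. $(u,v)=\sum_iu_iv_i$ is the bilinear (not sesquilinear) form, also used for tuples of operators, e.g. $(a^\dagger,Ma)=\sum_{ij}M_{ij}a_i^\dagger a_j$; $\langle\cdot|\cdot\rangle$ is the sesquilinear inner product of $\mathcal H$. A bar is entrywise complex conjugation, $T$ is transpose, $*$ is Hermitian conjugation. $\widehat H$ denotes the self-adjoint closure of the given expression from the finite-particle vectors. The $n\times n$ blocks $\Phi_t,\Psi_t$ are defined by $e^{Gt}=\begin{pmatrix}\Phi_t&\Psi_t\\ \overline\Psi_t&\overline\Phi_t\end{pmatrix}$; $\Phi_t$ is invertible for all $t\in\mathbb R$. Put $R_t=\Phi_t^{-1}\Psi_t$, $\overline\rho_t=\overline\Psi_t\Phi_t^{-1}$. $\mathrm{Ind}(0,t)$ is an integer counting (with sign) the $2\pi$-jumps of the principal argument of $\det\Phi$ between $0$ and $t$; its role is that $e^{i\pi\mathrm{Ind}(0,t)}/\sqrt{\det\Phi_t}$ is the continuous branch, i.e. the unique continuous function of $t\in\mathbb R$ that equals $1$ at $t=0$ and whose square is $1/\det\Phi_t$. *)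

theory Defs
  imports "HOL-Analysis.Analysis"
begin

section \<open>The complex Hilbert space of square-summable families\<close>

lemma ell2_add_aux:
  fixes f g :: "'a \<Rightarrow> complex"
  assumes "(\<lambda>k. (cmod (f k))\<^sup>2) summable_on UNIV" "(\<lambda>k. (cmod (g k))\<^sup>2) summable_on UNIV"
  shows "(\<lambda>k. (cmod (f k + g k))\<^sup>2) summable_on UNIV"
proof (rule summable_on_comparison_test)
  show "(\<lambda>k. 2 * (cmod (f k))\<^sup>2 + 2 * (cmod (g k))\<^sup>2) summable_on UNIV"
    by (intro summable_on_add summable_on_cmult_right assms)
  show "(cmod (f k + g k))\<^sup>2 \<le> 2 * (cmod (f k))\<^sup>2 + 2 * (cmod (g k))\<^sup>2" for k
  proof -
    have "(cmod (f k + g k))\<^sup>2 \<le> (cmod (f k) + cmod (g k))\<^sup>2"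
      by (intro power_mono norm_triangle_ineq norm_ge_zero)
    also have "\<dots> \<le> 2 * (cmod (f k))\<^sup>2 + 2 * (cmod (g k))\<^sup>2"
      using sum_squares_bound[of "cmod (f k)" "cmod (g k)"] by (simp add: power2_sum)
    finally show ?thesis .
  qed
qed auto

lemma ell2_scale_aux:
  fixes f :: "'a \<Rightarrow> complex"
  assumes "(\<lambda>k. (cmod (f k))\<^sup>2) summable_on UNIV"
  shows "(\<lambda>k. (cmod (c * f k))\<^sup>2) summable_on UNIV"
  using summable_on_cmult_right[OF assms, of "(cmod c)\<^sup>2"]
  by (simp add: norm_mult power_mult_distrib)

typedef 'a ell2 = "{f :: 'a \<Rightarrow> complex. (\<lambda>k. (cmod (f k))\<^sup>2) summable_on UNIV}"
  morphisms coeff Abs_ell2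
  by (rule exI[of _ "\<lambda>_. 0"]) simp

setup_lifting type_definition_ell2

lemma summable_coeff: "(\<lambda>k. (cmod (coeff x k))\<^sup>2) summable_on UNIV"
  using coeff[of x] by simp

lemma summable_coeff_inner: "(\<lambda>k. coeff x k \<bullet> coeff y k) summable_on UNIV"
proof -
  have "(\<lambda>k. (cmod (coeff x k))\<^sup>2 + (cmod (coeff y k))\<^sup>2) summable_on UNIV"
    by (intro summable_on_add summable_coeff)
  moreover have "norm (coeff x k \<bullet> coeff y k) \<le> (cmod (coeff x k))\<^sup>2 + (cmod (coeff y k))\<^sup>2" for k
  proof -
    have "norm (coeff x k \<bullet> coeff y k) \<le> cmod (coeff x k) * cmod (coeff y k)"
      using Cauchy_Schwarz_ineq2[of "coeff x k" "coeff y k"] by simp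
    also have "\<dots> \<le> (cmod (coeff x k))\<^sup>2 + (cmod (coeff y k))\<^sup>2"
      using sum_squares_bound[of "cmod (coeff x k)" "cmod (coeff y k)"]
        mult_nonneg_nonneg[OF norm_ge_zero[of "coeff x k"] norm_ge_zero[of "coeff y k"]]
      by linarith
    finally show ?thesis .
  qed
  ultimately have "(\<lambda>k. norm (coeff x k \<bullet> coeff y k)) summable_on UNIV"
    by (rule summable_on_comparison_test) auto
  then show ?thesis by (rule abs_summable_summable)
qed

instantiation ell2 :: (type) ab_group_add
begin

lift_definition zero_ell2 :: "'a ell2" is "\<lambda>_. 0" by simp

lift_definition plus_ell2 :: "'a ell2 \<Rightarrow> 'a ell2 \<Rightarrow> 'a ell2" is "\<lambda>f g k. f k + g k"
  by (rule ell2_add_aux)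

lift_definition uminus_ell2 :: "'a ell2 \<Rightarrow> 'a ell2" is "\<lambda>f k. - f k" by simp

definition minus_ell2 :: "'a ell2 \<Rightarrow> 'a ell2 \<Rightarrow> 'a ell2" where
  "minus_ell2 x y = x + - y"

instance
  by standard (unfold minus_ell2_def, (transfer, simp add: algebra_simps)+)

end

lift_definition scaleC :: "complex \<Rightarrow> 'a ell2 \<Rightarrow> 'a ell2" (infixr "*\<^sub>C" 75)
  is "\<lambda>c f k. c * f k"
  by (rule ell2_scale_aux)

lemmas coeff_simps = zero_ell2.rep_eq plus_ell2.rep_eq uminus_ell2.rep_eq scaleC.rep_eq

lemma ell2_eqI: "(\<And>k. coeff x k = coeff y k) \<Longrightarrow> x = y"
  by (metis coeff_inject ext)

instantiation ell2 :: (type) real_inner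
begin

definition scaleR_ell2 :: "real \<Rightarrow> 'a ell2 \<Rightarrow> 'a ell2" where
  "scaleR_ell2 r x = complex_of_real r *\<^sub>C x"

definition inner_ell2 :: "'a ell2 \<Rightarrow> 'a ell2 \<Rightarrow> real" where
  "inner_ell2 x y = (\<Sum>\<^sub>\<infinity>k. coeff x k \<bullet> coeff y k)"

definition norm_ell2 :: "'a ell2 \<Rightarrow> real" where
  "norm_ell2 x = sqrt (\<Sum>\<^sub>\<infinity>k. (cmod (coeff x k))\<^sup>2)"

definition sgn_ell2 :: "'a ell2 \<Rightarrow> 'a ell2" where
  "sgn_ell2 x = inverse (norm x) *\<^sub>R x"

definition dist_ell2 :: "'a ell2 \<Rightarrow> 'a ell2 \<Rightarrow> real" where
  "dist_ell2 x y = norm (x - y)"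

definition uniformity_ell2 :: "('a ell2 \<times> 'a ell2) filter" where
  "uniformity_ell2 = (INF e\<in>{0 <..}. principal {(x, y). dist x y < e})"

definition open_ell2 :: "'a ell2 set \<Rightarrow> bool" where
  "open_ell2 U = (\<forall>x\<in>U. eventually (\<lambda>(x', y). x' = x \<longrightarrow> y \<in> U) uniformity)"

instance
proof
  fix x y z :: "'a ell2" and r s :: real
  show "r *\<^sub>R (x + y) = r *\<^sub>R x + r *\<^sub>R y" "(r + s) *\<^sub>R x = r *\<^sub>R x + s *\<^sub>R x"
    "r *\<^sub>R s *\<^sub>R x = (r * s) *\<^sub>R x" "1 *\<^sub>R x = x"
    by (auto intro!: ell2_eqI simp: scaleR_ell2_def coeff_simps algebra_simps)
  show "sgn x = inverse (norm x) *\<^sub>R x" by (rule sgn_ell2_def)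
  show "dist x y = norm (x - y)" by (rule dist_ell2_def)
  show "uniformity = (INF e\<in>{0 <..}. principal {(x :: 'a ell2, y). dist x y < e})"
    by (rule uniformity_ell2_def)
  show "open U = (\<forall>x\<in>U. eventually (\<lambda>(x', y). x' = x \<longrightarrow> y \<in> U) uniformity)"
    for U :: "'a ell2 set"
    by (rule open_ell2_def)
  show "x \<bullet> y = y \<bullet> x"
    by (simp add: inner_ell2_def inner_commute)
  show "(x + y) \<bullet> z = x \<bullet> z + y \<bullet> z"
    by (simp add: inner_ell2_def coeff_simps inner_add_left infsum_add summable_coeff_inner)
  show "(r *\<^sub>R x) \<bullet> y = r * (x \<bullet> y)"
  proof -
    have *: "(complex_of_real r * a) \<bullet> b = r * (a \<bullet> b)" for a b
      by (simp add: inner_complex_def algebra_simps)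
    show ?thesis
      by (simp add: inner_ell2_def scaleR_ell2_def coeff_simps * infsum_cmult_right summable_coeff_inner)
  qed
  show "0 \<le> x \<bullet> x"
    unfolding inner_ell2_def by (intro infsum_nonneg) simp
  show "(x \<bullet> x = 0) = (x = 0)"
  proof
    assume "x \<bullet> x = 0"
    then have "(\<Sum>\<^sub>\<infinity>k. coeff x k \<bullet> coeff x k) = 0" by (simp add: inner_ell2_def)
    then have "coeff x k \<bullet> coeff x k = 0" for k
      using nonneg_infsum_le_0D[of "\<lambda>k. coeff x k \<bullet> coeff x k" UNIV k] summable_coeff_inner[of x x]
      by simp
    then show "x = 0" by (auto intro!: ell2_eqI simp: coeff_simps)
  qed (simp add: inner_ell2_def coeff_simps)
  show "norm x = sqrt (x \<bullet> x)"
    by (simp add: norm_ell2_def inner_ell2_def power2_norm_eq_inner)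
qed

end

definition cinner :: "'a ell2 \<Rightarrow> 'a ell2 \<Rightarrow> complex" where
  "cinner x y = (\<Sum>\<^sub>\<infinity>k. cnj (coeff x k) * coeff y k)"


section \<open>Unitary groups and their generators\<close>

text \<open>
  A (possibly unbounded) operator on \<open>'a ell2\<close> is represented by its graph.
\<close>

definition unitary :: "('a ell2 \<Rightarrow> 'a ell2) \<Rightarrow> bool" where
  "unitary V \<longleftrightarrow>
     (\<forall>x y. V (x + y) = V x + V y) \<and> (\<forall>c x. V (c *\<^sub>C x) = c *\<^sub>C V x) \<and>
     (\<forall>x y. cinner (V x) (V y) = cinner x y) \<and> surj V"

definition unitary_group :: "(real \<Rightarrow> 'a ell2 \<Rightarrow> 'a ell2) \<Rightarrow> bool" where
  "unitary_group U \<longleftrightarrow>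
     (\<forall>t. unitary (U t)) \<and> U 0 = id \<and> (\<forall>s t. U (s + t) = U s \<circ> U t) \<and>
     (\<forall>x. continuous_on UNIV (\<lambda>t. U t x))"

definition self_adjoint_generator ::
  "(real \<Rightarrow> 'a ell2 \<Rightarrow> 'a ell2) \<Rightarrow> ('a ell2 \<times> 'a ell2) set" where
  "self_adjoint_generator U =
     {(x, y). ((\<lambda>t. U t x) has_vector_derivative \<i> *\<^sub>C y) (at 0)}"

text \<open>
  By Stone's theorem, for self-adjoint \<open>H\<close> the operators \<open>e\<^sup>i\<^sup>H\<^sup>t\<close> form the unique strongly
  continuous unitary group with self-adjoint generator \<open>H\<close>, and for other \<open>H\<close> there is no such
  group. Self-adjointness of \<open>H\<close> is therefore not assumed separately.
\<close>

definition exp_iH :: "('a ell2 \<times> 'a ell2) set \<Rightarrow> real \<Rightarrow> 'a ell2 \<Rightarrow> 'a ell2" where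
  "exp_iH H = (THE U. unitary_group U \<and> self_adjoint_generator U = H)"


section \<open>Boson Fock space and quadratic Hamiltonians\<close>

text \<open>
  The modes are the elements of the finite type \<open>'n\<close>. The tensor product of \<open>CARD('n)\<close> copies of
  \<open>\<ell>\<^sub>2\<close> is identified with the square-summable families indexed by occupation numbers, the
  coefficient at \<open>k\<close> being taken with respect to the normalised number state
  \<open>|k\<rangle> = \<Prod>\<^sub>i (a\<^sub>i\<^sup>\<dagger>)\<^bsup>k\<^sub>i\<^esup> / \<surd>(k\<^sub>i!) |0\<rangle>\<close>.
\<close>

type_synonym 'n fock = "('n \<Rightarrow> nat) ell2"

lift_definition vac :: "'n::finite fock" is "\<lambda>k. if k = (\<lambda>_. 0) then 1 else 0"
proof -
  have "(\<lambda>k. (cmod (if k = (\<lambda>_. 0) then 1 else 0))\<^sup>2) summable_on {\<lambda>_::'n. 0::nat}"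
    by simp
  then show "(\<lambda>k::'n \<Rightarrow> nat. (cmod (if k = (\<lambda>_. 0) then 1 else 0))\<^sup>2) summable_on UNIV"
    by (rule summable_on_cong_neutral[THEN iffD1, rotated -1]) auto
qed

text \<open>
  Annihilation and creation operators act on arbitrary families of coefficients; the Hamiltonian
  is restricted to finite-particle vectors in \<open>H_finite\<close> below.
\<close>

definition annih :: "'n \<Rightarrow> (('n \<Rightarrow> nat) \<Rightarrow> complex) \<Rightarrow> ('n \<Rightarrow> nat) \<Rightarrow> complex" where
  "annih i f k = complex_of_real (sqrt (real (k i + 1))) * f (k(i := k i + 1))"

definition creat :: "'n \<Rightarrow> (('n \<Rightarrow> nat) \<Rightarrow> complex) \<Rightarrow> ('n \<Rightarrow> nat) \<Rightarrow> complex" where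
  "creat i f k = (if k i = 0 then 0 else complex_of_real (sqrt (real (k i))) * f (k(i := k i - 1)))"

text \<open>The bilinear forms \<open>(X, M Y)\<close> and \<open>(X, v)\<close> for tuples of operators \<open>X\<close>, \<open>Y\<close>.\<close>

definition op_quad ::
  "('n::finite \<Rightarrow> ('k \<Rightarrow> complex) \<Rightarrow> 'k \<Rightarrow> complex) \<Rightarrow> complex^'n^'n \<Rightarrow>
   ('n \<Rightarrow> ('k \<Rightarrow> complex) \<Rightarrow> 'k \<Rightarrow> complex) \<Rightarrow> ('k \<Rightarrow> complex) \<Rightarrow> 'k \<Rightarrow> complex" where
  "op_quad X M Y f k = (\<Sum>i\<in>UNIV. \<Sum>j\<in>UNIV. M $ i $ j * X i (Y j f) k)"

definition op_lin ::
  "('n::finite \<Rightarrow> ('k \<Rightarrow> complex) \<Rightarrow> 'k \<Rightarrow> complex) \<Rightarrow> complex^'n \<Rightarrow>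
   ('k \<Rightarrow> complex) \<Rightarrow> 'k \<Rightarrow> complex" where
  "op_lin X v f k = (\<Sum>i\<in>UNIV. v $ i * X i f k)"

definition cnj_vec :: "complex^'n \<Rightarrow> complex^'n" where
  "cnj_vec v = (\<chi> i. cnj (v $ i))"

abbreviation cnj_mat :: "complex^'n^'m \<Rightarrow> complex^'n^'m" where
  "cnj_mat \<equiv> map_matrix cnj"

definition H_expr ::
  "complex^'n^'n \<Rightarrow> complex^'n^'n \<Rightarrow> complex^'n \<Rightarrow>
   (('n::finite \<Rightarrow> nat) \<Rightarrow> complex) \<Rightarrow> ('n \<Rightarrow> nat) \<Rightarrow> complex" where
  "H_expr A B h f k =
     \<i> / 2 * (op_quad creat A creat f k - op_quad annih (cnj_mat A) annih f k)
     + op_quad creat B annih f k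
     + \<i> * op_lin creat h f k - \<i> * op_lin annih (cnj_vec h) f k"

text \<open>
  The finite-particle vectors are those of finite support, since there are finitely many modes.
\<close>

definition H_finite ::
  "complex^'n^'n \<Rightarrow> complex^'n^'n \<Rightarrow> complex^'n \<Rightarrow> ('n::finite fock \<times> 'n fock) set" where
  "H_finite A B h =
     {(x, y). finite {k. coeff x k \<noteq> 0} \<and> coeff y = H_expr A B h (coeff x)}"

definition H_hat ::
  "complex^'n^'n \<Rightarrow> complex^'n^'n \<Rightarrow> complex^'n \<Rightarrow> ('n::finite fock \<times> 'n fock) set" where
  "H_hat A B h = closure (H_finite A B h)"


section \<open>The symplectic matrices\<close>

definition bform :: "complex^'n \<Rightarrow> complex^'n \<Rightarrow> complex" where
  "bform u v = (\<Sum>i\<in>UNIV. u $ i * v $ i)"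

definition smult_mat :: "complex \<Rightarrow> complex^'n^'m \<Rightarrow> complex^'n^'m" where
  "smult_mat c M = (\<chi> i j. c * M $ i $ j)"

definition stack :: "'a^'n \<Rightarrow> 'a^'m \<Rightarrow> 'a^('n::finite + 'm::finite)" where
  "stack u v = (\<chi> r. case r of Inl i \<Rightarrow> u $ i | Inr i \<Rightarrow> v $ i)"

definition block_mat ::
  "'a^'n^'n \<Rightarrow> 'a^'n^'n \<Rightarrow> 'a^'n^'n \<Rightarrow> 'a^'n^'n \<Rightarrow> 'a^('n::finite + 'n)^('n + 'n)" where
  "block_mat P Q R S =
     (\<chi> r c. case r of
        Inl i \<Rightarrow> (case c of Inl j \<Rightarrow> P $ i $ j | Inr j \<Rightarrow> Q $ i $ j)
      | Inr i \<Rightarrow> (case c of Inl j \<Rightarrow> R $ i $ j | Inr j \<Rightarrow> S $ i $ j))"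

definition mat_exp :: "complex^'m^'m \<Rightarrow> complex^'m^'m" where
  "mat_exp M = (\<Sum>k. (1 / fact k) *\<^sub>R (((**) M ^^ k) (mat 1)))"

definition G_mat :: "complex^'n^'n \<Rightarrow> complex^'n^'n \<Rightarrow> complex^('n::finite + 'n)^('n + 'n)" where
  "G_mat A B = block_mat (smult_mat (- \<i>) B) A (cnj_mat A) (smult_mat \<i> (cnj_mat B))"

definition Phi :: "complex^'n^'n \<Rightarrow> complex^'n^'n \<Rightarrow> real \<Rightarrow> complex^'n::finite^'n" where
  "Phi A B t = (\<chi> i j. mat_exp (t *\<^sub>R G_mat A B) $ Inl i $ Inl j)"

definition Psi :: "complex^'n^'n \<Rightarrow> complex^'n^'n \<Rightarrow> real \<Rightarrow> complex^'n::finite^'n" where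
  "Psi A B t = (\<chi> i j. mat_exp (t *\<^sub>R G_mat A B) $ Inl i $ Inr j)"

definition R_mat :: "complex^'n^'n \<Rightarrow> complex^'n^'n \<Rightarrow> real \<Rightarrow> complex^'n::finite^'n" where
  "R_mat A B t = matrix_inv (Phi A B t) ** Psi A B t"

definition rho_bar :: "complex^'n^'n \<Rightarrow> complex^'n^'n \<Rightarrow> real \<Rightarrow> complex^'n::finite^'n" where
  "rho_bar A B t = cnj_mat (Psi A B t) ** matrix_inv (Phi A B t)"

text \<open>
  The function \<open>e\<^sup>i\<^sup>\<pi>\<^sup>I\<^sup>n\<^sup>d\<^sup>(\<^sup>0\<^sup>,\<^sup>t\<^sup>) / \<surd>det \<Phi>\<^sub>t\<close>, i.e. the continuous branch of \<open>(det \<Phi>\<^sub>t)\<^bsup>-1/2\<^esup>\<close>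
  with value \<open>1\<close> at \<open>t = 0\<close>.
\<close>

definition inv_sqrt_det_Phi :: "complex^'n^'n \<Rightarrow> complex^'n^'n \<Rightarrow> real \<Rightarrow> complex" where
  "inv_sqrt_det_Phi A (B :: complex^'n::finite^'n) =
     (THE b. continuous_on UNIV b \<and> b 0 = 1 \<and> (\<forall>t. (b t)\<^sup>2 = 1 / det (Phi A B t)))"

end

theory Submission
  imports Defs
begin

text \<open>
  Particle number grows by at most two per application of \<open>H\<close>, so
  \<open>\<parallel>H\<^sup>k x\<parallel>\<close> is bounded by \<open>k!\<close> times a geometric sequence whose ratio does not depend on the
  finite-particle vector \<open>x\<close>. Hence \<open>e\<^sup>i\<^sup>H\<^sup>t\<close> is given by its power series for all small \<open>t\<close> at once; the
  series is isometric, extends to a unitary group, and its generator is the closure of \<open>H\<close>.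

  Since \<open>[iH, \<xi>] = G \<xi>\<close> for the shifted field operators \<open>\<xi> = (a + z, a\<^sup>\<dagger> + \<bar>z)\<close>, one has
  \<open>e\<^sup>i\<^sup>H\<^sup>t \<xi> e\<^sup>-\<^sup>i\<^sup>H\<^sup>t = e\<^sup>G\<^sup>t \<xi>\<close>. This is needed only in matrix elements between finite-particle vectors, where it
  is an identity of power series near \<open>t = 0\<close> and extends to all \<open>t\<close> by analyticity. Applied to the
  vacuum it expresses the first and second moments of \<open>e\<^sup>i\<^sup>H\<^sup>t|0\<rangle>\<close> by the amplitude
  \<open>f(t) = \<langle>0|e\<^sup>i\<^sup>H\<^sup>t|0\<rangle>\<close>, which turns \<open>f' = \<langle>0|iH e\<^sup>i\<^sup>H\<^sup>t|0\<rangle>\<close> into a scalar linear differential equation.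
  Its solution is identified by differentiating \<open>f\<^sup>2 det \<Phi>\<close> times the inverse square of the claimed
  exponential.
\<close>


section \<open>The Hilbert space structure\<close>

text \<open>Field operators are never applied to evolved vectors, since evolution need not preserve
  finite-particle vectors. Every identity pairs an evolved vector with a finite-particle one, and
  field operators reach the finite side by adjunction. For \<open>exp_iH\<close> to denote anything,
  the graph closure of \<open>H_finite\<close> must be the whole generator, not just a part of it,
  and a unitary group must be determined by its generator. Both are proved for a general symmetric
  operator with a dense invariant domain of vectors analytic with one common radius. Nondegeneracy
  of \<open>G\<close> enters through \<open>z\<close>, the shift that removes the constant term
  \<open>h\<close> from the commutators. Annihilation operators kill the vacuum, so the top rows of
  the Heisenberg relation become linear systems for the moments with matrix \<open>Phi\<close>;
  hence the inverse of \<open>Phi\<close> in the answer. Squares appear because the branch in the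
  statement is characterised by its square, its continuity and its value at 0. The amplitude times
  the inverse exponential has these three properties, and no logarithm or winding number has to be
  followed.\<close>

lemma coeff_scaleR: "coeff (r *\<^sub>R x) k = of_real r * coeff x k"
  by (simp add: scaleR_ell2_def coeff_simps)

lemma coeff_minus: "coeff (x - y) k = coeff x k - coeff y k"
  unfolding minus_ell2_def coeff_simps by simp

lemma scaleC_1 [simp]: "1 *\<^sub>C x = x"
  and scaleC_0 [simp]: "0 *\<^sub>C x = 0" "c *\<^sub>C 0 = (0 :: 'a ell2)"
  and scaleC_scaleC [simp]: "c *\<^sub>C d *\<^sub>C x = (c * d) *\<^sub>C x"
  and scaleC_add_right: "c *\<^sub>C (x + y) = c *\<^sub>C x + c *\<^sub>C y"
  and scaleC_add_left: "(c + d) *\<^sub>C x = c *\<^sub>C x + d *\<^sub>C x"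
  and scaleC_diff_right: "c *\<^sub>C (x - y) = c *\<^sub>C x - c *\<^sub>C y"
  and scaleC_minus_left: "(- c) *\<^sub>C x = - (c *\<^sub>C x)"
  and scaleC_of_real: "complex_of_real r *\<^sub>C x = r *\<^sub>R x"
  and scaleC_scaleR: "c *\<^sub>C (r *\<^sub>R x) = r *\<^sub>R c *\<^sub>C x"
  by (rule ell2_eqI, simp add: coeff_simps coeff_scaleR coeff_minus algebra_simps)+

lemma norm_ell2_sq: "(norm x)\<^sup>2 = (\<Sum>\<^sub>\<infinity>k. (cmod (coeff x k))\<^sup>2)"
  by (simp add: norm_ell2_def infsum_nonneg)

lemma norm_scaleC [simp]: "norm (c *\<^sub>C x) = cmod c * norm x"
proof -
  have "(norm (c *\<^sub>C x))\<^sup>2 = (cmod c * norm x)\<^sup>2"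
    by (simp add: norm_ell2_sq coeff_simps norm_mult power_mult_distrib infsum_cmult_right summable_coeff)
  then show ?thesis
    by (rule power2_eq_imp_eq) auto
qed

lemma bounded_linear_scaleC: "bounded_linear (\<lambda>x. c *\<^sub>C x)"
  by (rule bounded_linear_intro[where K = "cmod c"])
    (auto simp: scaleC_add_right scaleC_scaleR mult.commute)

lemma bounded_bilinear_scaleC: "bounded_bilinear (\<lambda>c x. c *\<^sub>C x)"
proof (rule bounded_bilinear.intro)
  show "(r *\<^sub>R c) *\<^sub>C x = r *\<^sub>R c *\<^sub>C x" for r c and x :: "'a ell2"
    by (simp add: scaleR_conv_of_real scaleC_of_real[symmetric])
qed (auto simp: scaleC_add_right scaleC_add_left scaleC_scaleR intro!: exI[of _ 1])

lemma summable_cinner: "(\<lambda>k. cnj (coeff x k) * coeff y k) summable_on UNIV"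
proof -
  have "(\<lambda>k. (cmod (coeff x k))\<^sup>2 + (cmod (coeff y k))\<^sup>2) summable_on UNIV"
    by (intro summable_on_add summable_coeff)
  moreover have "cmod (cnj (coeff x k) * coeff y k) \<le> (cmod (coeff x k))\<^sup>2 + (cmod (coeff y k))\<^sup>2" for k
    using sum_squares_bound[of "cmod (coeff x k)" "cmod (coeff y k)"]
      mult_nonneg_nonneg[OF norm_ge_zero[of "coeff x k"] norm_ge_zero[of "coeff y k"]]
    unfolding norm_mult complex_mod_cnj by linarith
  ultimately have "(\<lambda>k. cmod (cnj (coeff x k) * coeff y k)) summable_on UNIV"
    by (rule summable_on_comparison_test) auto
  then show ?thesis by (rule abs_summable_summable)
qed

text \<open>Expressing the complex product through two real inner products lets additivity and the
  Cauchy-Schwarz bound be inherited from \<open>real_inner\<close>.\<close>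

lemma cinner_conv_inner: "cinner x y = Complex (x \<bullet> y) ((\<i> *\<^sub>C x) \<bullet> y)"
proof (rule complex_eqI)
  show "Re (cinner x y) = Re (Complex (x \<bullet> y) ((\<i> *\<^sub>C x) \<bullet> y))"
    unfolding cinner_def infsum_Re[OF summable_cinner, symmetric] inner_ell2_def complex.sel
    by (rule infsum_cong) (simp add: inner_complex_def)
  show "Im (cinner x y) = Im (Complex (x \<bullet> y) ((\<i> *\<^sub>C x) \<bullet> y))"
    unfolding cinner_def infsum_Im[OF summable_cinner, symmetric] inner_ell2_def complex.sel
    by (rule infsum_cong) (simp add: inner_complex_def coeff_simps)
qed

lemma cinner_commute: "cnj (cinner x y) = cinner y x"
  unfolding cinner_def infsum_cnj[symmetric] by (rule infsum_cong) simp

lemma cinner_scaleC_right [simp]: "cinner x (c *\<^sub>C y) = c * cinner x y"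
  unfolding cinner_def coeff_simps mult.left_commute[of _ c]
  by (rule infsum_cmult_right) (simp add: summable_cinner)

lemma cinner_scaleC_left [simp]: "cinner (c *\<^sub>C x) y = cnj c * cinner x y"
  by (metis cinner_commute cinner_scaleC_right complex_cnj_mult)

lemma cinner_add_right: "cinner x (y + z) = cinner x y + cinner x z"
  and cinner_add_left: "cinner (y + z) x = cinner y x + cinner z x"
  by (auto simp: cinner_conv_inner scaleC_add_right inner_add_left inner_add_right complex_eq_iff)

lemma cinner_self: "cinner x x = of_real ((norm x)\<^sup>2)"
proof -
  have "cinner x x = of_real (x \<bullet> x)"
    using cinner_commute[of x x] by (auto simp: cinner_conv_inner complex_eq_iff)
  then show ?thesis by (simp add: power2_norm_eq_inner)
qed

lemma bounded_bilinear_cinner: "bounded_bilinear (\<lambda>x y :: 'a ell2. cinner x y)"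
proof (rule bounded_bilinear.intro)
  show "\<exists>K. \<forall>x y :: 'a ell2. norm (cinner x y) \<le> norm x * norm y * K"
  proof (intro exI[of _ 2] allI)
    fix x y :: "'a ell2"
    have "norm (cinner x y) \<le> \<bar>x \<bullet> y\<bar> + \<bar>(\<i> *\<^sub>C x) \<bullet> y\<bar>"
      using cmod_le[of "cinner x y"] by (simp add: cinner_conv_inner)
    also have "\<dots> \<le> norm x * norm y + norm (\<i> *\<^sub>C x) * norm y"
      by (intro add_mono Cauchy_Schwarz_ineq2)
    finally show "norm (cinner x y) \<le> norm x * norm y * 2" by simp
  qed
qed (simp_all add: cinner_add_left cinner_add_right scaleC_of_real[symmetric] scaleR_conv_of_real)

lemmas cinner_diff_right = bounded_bilinear.diff_right[OF bounded_bilinear_cinner]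
  and cinner_minus_left [simp] = bounded_bilinear.minus_left[OF bounded_bilinear_cinner]
  and cinner_minus_right [simp] = bounded_bilinear.minus_right[OF bounded_bilinear_cinner]
  and cinner_zero_left [simp] = bounded_bilinear.zero_left[OF bounded_bilinear_cinner]
  and cinner_zero_right [simp] = bounded_bilinear.zero_right[OF bounded_bilinear_cinner]
  and bounded_linear_cinner_right = bounded_bilinear.bounded_linear_right[OF bounded_bilinear_cinner]
  and bounded_linear_cinner_left = bounded_bilinear.bounded_linear_left[OF bounded_bilinear_cinner]
  and has_vector_derivative_cinner = bounded_bilinear.has_vector_derivative[OF bounded_bilinear_cinner]

text \<open>Equality of vectors is later tested only against a dense set: the set of admissible test
  vectors is closed, so \<open>x - y\<close> itself may be used.\<close>

lemma cinner_eq_on_dense: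
  assumes "closure D = UNIV" "\<And>d. d \<in> D \<Longrightarrow> cinner d x = cinner d y"
  shows "x = y"
proof -
  have "closed {d. cinner d x = cinner d y}"
    by (intro closed_Collect_eq bounded_linear.continuous_on[OF bounded_linear_cinner_left] continuous_on_id)
  then have "closure D \<subseteq> {d. cinner d x = cinner d y}"
    using assms(2) by (intro closure_minimal) auto
  then have "cinner (x - y) x = cinner (x - y) y" using assms(1) by auto
  then have "cinner (x - y) (x - y) = 0" by (simp add: cinner_diff_right)
  then show ?thesis by (simp add: cinner_self)
qed

lemma norm_coeff_le: "cmod (coeff x k) \<le> norm x"
proof -
  have "(\<Sum>k\<in>{k}. (cmod (coeff x k))\<^sup>2) \<le> (norm x)\<^sup>2"
    unfolding norm_ell2_sq by (rule finite_sum_le_infsum) (auto simp: summable_coeff)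
  then have "(cmod (coeff x k))\<^sup>2 \<le> (norm x)\<^sup>2" by simp
  then show ?thesis by (rule power2_le_imp_le) simp
qed

section \<open>Completeness, and density of finitely supported families\<close>

instance ell2 :: (type) banach
proof
  fix X :: "nat \<Rightarrow> 'a ell2" assume X: "Cauchy X"
  have "Cauchy (\<lambda>n. coeff (X n) k)" for k
  proof (rule metric_CauchyI)
    fix e :: real assume "e > 0"
    then obtain N where "\<forall>m\<ge>N. \<forall>n\<ge>N. dist (X m) (X n) < e" using metric_CauchyD[OF X] by blast
    moreover have "dist (coeff (X m) k) (coeff (X n) k) \<le> dist (X m) (X n)" for m n
      using norm_coeff_le[of "X m - X n" k] by (simp add: dist_norm coeff_minus)
    ultimately show "\<exists>N. \<forall>m\<ge>N. \<forall>n\<ge>N. dist (coeff (X m) k) (coeff (X n) k) < e"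
      by (meson le_less_trans)
  qed
  then have "\<exists>l. (\<lambda>n. coeff (X n) k) \<longlonglongrightarrow> l" for k
    by (simp add: Cauchy_convergent flip: convergent_def)
  then obtain l where l: "(\<lambda>n. coeff (X n) k) \<longlonglongrightarrow> l k" for k
    by metis
  \<comment> \<open>Fatou-type step: the Cauchy estimate passes to the coordinatewise limit for each
    finite set of coordinates, with a bound independent of that set.\<close>
  have fin: "(\<Sum>k\<in>F. (cmod (coeff (X m) k - l k))\<^sup>2) \<le> e\<^sup>2"
    if "finite F" and N: "\<forall>n\<ge>N. norm (X m - X n) \<le> e" for F e m N
  proof -
    have "(\<lambda>n. \<Sum>k\<in>F. (cmod (coeff (X m) k - coeff (X n) k))\<^sup>2) \<longlonglongrightarrow> (\<Sum>k\<in>F. (cmod (coeff (X m) k - l k))\<^sup>2)"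
      by (intro tendsto_intros l)
    moreover have "\<forall>n\<ge>N. (\<Sum>k\<in>F. (cmod (coeff (X m) k - coeff (X n) k))\<^sup>2) \<le> e\<^sup>2"
    proof (intro allI impI)
      fix n assume "n \<ge> N"
      have "(\<Sum>k\<in>F. (cmod (coeff (X m - X n) k))\<^sup>2) \<le> (norm (X m - X n))\<^sup>2"
        unfolding norm_ell2_sq by (rule finite_sum_le_infsum) (use that in \<open>auto simp: summable_coeff\<close>)
      also have "\<dots> \<le> e\<^sup>2" using N \<open>n \<ge> N\<close> by (intro power_mono) auto
      finally show "(\<Sum>k\<in>F. (cmod (coeff (X m) k - coeff (X n) k))\<^sup>2) \<le> e\<^sup>2" by (simp add: coeff_minus)
    qed
    ultimately show ?thesis by (meson LIMSEQ_le_const2)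
  qed
  have ev: "\<exists>N. \<forall>m\<ge>N. \<forall>n\<ge>N. norm (X m - X n) \<le> e" if "e > 0" for e
    using metric_CauchyD[OF X that] unfolding dist_norm by (meson less_imp_le)
  have summ: "(\<lambda>k. (cmod (coeff (X m) k - l k))\<^sup>2) summable_on UNIV"
    if "\<forall>n\<ge>N. norm (X m - X n) \<le> e" for m N e
    using fin[OF _ that] by (intro nonneg_bdd_above_summable_on bdd_aboveI[of _ "e\<^sup>2"]) auto
  have l2: "(\<lambda>k. (cmod (l k))\<^sup>2) summable_on UNIV"
  proof -
    obtain N where "\<forall>m\<ge>N. \<forall>n\<ge>N. norm (X m - X n) \<le> 1" using ev[of 1] by auto
    \<comment> \<open>The limit is \<open>X N\<close> minus the difference \<open>X N - l\<close>, a
      sum of two square-summable families.\<close>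
    then have "(\<lambda>k. (cmod (-1 * (coeff (X N) k - l k)))\<^sup>2) summable_on UNIV"
      by (intro ell2_scale_aux summ[where N = N]) auto
    then have "(\<lambda>k. (cmod (coeff (X N) k + -1 * (coeff (X N) k - l k)))\<^sup>2) summable_on UNIV"
      by (intro ell2_add_aux summable_coeff)
    then show ?thesis by simp
  qed
  then have cl: "coeff (Abs_ell2 l) = l" by (simp add: Abs_ell2_inverse)
  have "X \<longlonglongrightarrow> Abs_ell2 l"
  proof (rule LIMSEQ_I)
    fix e :: real assume "e > 0"
    then obtain N where N: "\<forall>m\<ge>N. \<forall>n\<ge>N. norm (X m - X n) \<le> e / 2" using ev[of "e/2"] by auto
    have "norm (X m - Abs_ell2 l) < e" if "m \<ge> N" for m
    proof -
      have *: "\<forall>n\<ge>N. norm (X m - X n) \<le> e / 2" using N that by auto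
      have "(norm (X m - Abs_ell2 l))\<^sup>2 \<le> (e/2)\<^sup>2"
        unfolding norm_ell2_sq coeff_minus cl
        by (rule infsum_le_finite_sums[OF summ[OF *]]) (rule fin[OF _ *])
      then have "norm (X m - Abs_ell2 l) \<le> e / 2"
        by (rule power2_le_imp_le) (use \<open>e > 0\<close> in auto)
      then show ?thesis using \<open>e > 0\<close> by simp
    qed
    then show "\<exists>no. \<forall>n\<ge>no. norm (X n - Abs_ell2 l) < e" by blast
  qed
  then show "convergent X" by (auto simp: convergent_def)
qed

lemma coeff_Abs_finite:
  assumes "finite {k. f k \<noteq> 0}"
  shows "coeff (Abs_ell2 f) = f"
proof -
  have "(\<lambda>k. (cmod (f k))\<^sup>2) summable_on {k. f k \<noteq> 0}" using assms by simp
  then have "(\<lambda>k. (cmod (f k))\<^sup>2) summable_on UNIV"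
    by (rule summable_on_cong_neutral[THEN iffD1, rotated -1]) auto
  then show ?thesis by (simp add: Abs_ell2_inverse)
qed

lemma closure_finite_support: "closure {x :: 'a ell2. finite {k. coeff x k \<noteq> 0}} = UNIV"
proof (intro equalityI subset_UNIV subsetI)
  fix x :: "'a ell2"
  show "x \<in> closure {x. finite {k. coeff x k \<noteq> 0}}"
    unfolding closure_approachable
  proof (intro allI impI)
    fix e :: real assume e: "e > 0"
    \<comment> \<open>A finite set carrying all but (e/2)^2 of the squared norm, so that truncation
      to it costs at most e/2.\<close>
    obtain F where F: "finite F" "dist (\<Sum>k\<in>F. (cmod (coeff x k))\<^sup>2) ((norm x)\<^sup>2) \<le> (e/2)\<^sup>2"
      using infsum_finite_approximation[OF summable_coeff[of x], of "(e/2)\<^sup>2"] e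
      unfolding norm_ell2_sq by auto
    define f where "f k = (if k \<in> F then coeff x k else 0)" for k
    have "{k. f k \<noteq> 0} \<subseteq> F" by (auto simp: f_def)
    then have fin: "finite {k. f k \<noteq> 0}" using F(1) finite_subset by blast
    have "(norm (x - Abs_ell2 f))\<^sup>2 = (\<Sum>\<^sub>\<infinity>k\<in>UNIV - F. (cmod (coeff x k))\<^sup>2)"
      unfolding norm_ell2_sq coeff_minus coeff_Abs_finite[OF fin]
      by (rule infsum_cong_neutral) (auto simp: f_def)
    also have "\<dots> = (norm x)\<^sup>2 - (\<Sum>k\<in>F. (cmod (coeff x k))\<^sup>2)"
      unfolding norm_ell2_sq using F(1) by (subst infsum_Diff) (auto simp: summable_coeff)
    also have "\<dots> \<le> (e/2)\<^sup>2" using F(2) by (simp add: dist_real_def)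
    finally have "norm (x - Abs_ell2 f) \<le> e/2" by (rule power2_le_imp_le) (use e in auto)
    then have "dist (Abs_ell2 f) x < e" using e by (simp add: dist_norm norm_minus_commute)
    then show "\<exists>y\<in>{x. finite {k. coeff x k \<noteq> 0}}. dist y x < e"
      using fin by (intro bexI[of _ "Abs_ell2 f"]) (auto simp: coeff_Abs_finite)
  qed
qed

section \<open>Unitary groups\<close>

lemma unitaryD:
  assumes "unitary V"
  shows "V (x + y) = V x + V y" "V (c *\<^sub>C x) = c *\<^sub>C V x" "cinner (V x) (V y) = cinner x y" "surj V"
  using assms by (auto simp: unitary_def)

lemma unitary_norm: "unitary V \<Longrightarrow> norm (V x) = norm x"
  using unitaryD(3)[of V x x] by (simp add: cinner_self power2_eq_iff_nonneg flip: of_real_power)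

lemma unitary_bounded_linear:
  assumes "unitary V"
  shows "bounded_linear V"
proof (rule bounded_linear_intro[where K = 1])
  show "V (r *\<^sub>R x) = r *\<^sub>R V x" for r x
    using unitaryD(2)[OF assms, of "of_real r" x] by (simp add: scaleC_of_real)
qed (simp_all add: unitaryD(1)[OF assms] unitary_norm[OF assms])

lemma unitary_compose: "unitary V \<Longrightarrow> unitary W \<Longrightarrow> unitary (V \<circ> W)"
  using comp_surj[of W V] by (simp add: unitary_def o_def)

lemma unitary_funpow: "unitary V \<Longrightarrow> unitary (V ^^ n)"
proof (induction n)
  case 0
  then show ?case by (simp add: unitary_def)
qed (auto intro: unitary_compose)

context
  fixes U :: "real \<Rightarrow> 'a ell2 \<Rightarrow> 'a ell2"
  assumes U: "unitary_group U"
begin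

lemma ug_unitary: "unitary (U t)"
  and ug_0: "U 0 x = x"
  and ug_add: "U (s + t) x = U s (U t x)"
  and ug_cont: "continuous_on UNIV (\<lambda>t. U t x)"
  using U by (auto simp: unitary_group_def)

lemma ug_uminus: "U t (U (- t) x) = x"
  using ug_add[of t "- t" x] by (simp add: ug_0)

lemma ug_adjoint: "cinner (U t x) y = cinner x (U (- t) y)"
  by (metis ug_uminus unitaryD(3)[OF ug_unitary])

lemma ug_diff: "U t (x - y) = U t x - U t y"
  using unitary_bounded_linear[OF ug_unitary] by (simp add: linear_diff bounded_linear.linear)

text \<open>The derivative at 0 is transported to time t by writing \<open>U s\<close> as
  \<open>U t\<close> after \<open>U (s - t)\<close> and using that \<open>U t\<close> is bounded and
  linear.\<close>

lemma generator_derivative: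
  assumes "(x, y) \<in> self_adjoint_generator U"
  shows "((\<lambda>t. U t x) has_vector_derivative \<i> *\<^sub>C U t y) (at t)"
proof -
  have "((\<lambda>s. s - t) has_vector_derivative 1) (at t)"
    by (auto intro!: derivative_eq_intros)
  moreover have "((\<lambda>s. U s x) has_vector_derivative \<i> *\<^sub>C y) (at (t - t))"
    using assms by (simp add: self_adjoint_generator_def)
  ultimately have "((\<lambda>s. U s x) \<circ> (\<lambda>s. s - t) has_vector_derivative 1 *\<^sub>R \<i> *\<^sub>C y) (at t)"
    by (rule vector_diff_chain_at)
  then have "((\<lambda>s. U t (((\<lambda>s. U s x) \<circ> (\<lambda>s. s - t)) s)) has_vector_derivative U t (1 *\<^sub>R \<i> *\<^sub>C y)) (at t)"
    by (rule bounded_linear.has_vector_derivative[OF unitary_bounded_linear[OF ug_unitary]])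
  then show ?thesis
    by (simp add: o_def unitaryD(2)[OF ug_unitary] flip: ug_add)
qed

text \<open>This is unitarity, differentiated at time 0.\<close>

lemma generator_symmetric:
  assumes "(x, y) \<in> self_adjoint_generator U" "(x', y') \<in> self_adjoint_generator U"
  shows "cinner y x' = cinner x y'"
proof -
  have "((\<lambda>t. cinner (U t x) (U t x')) has_vector_derivative
      cinner (U 0 x) (\<i> *\<^sub>C U 0 y') + cinner (\<i> *\<^sub>C U 0 y) (U 0 x')) (at 0)"
    by (intro has_vector_derivative_cinner generator_derivative assms)
  moreover have "((\<lambda>t. cinner (U t x) (U t x')) has_vector_derivative 0) (at 0)"
    by (simp add: unitaryD(3)[OF ug_unitary])
  ultimately have "cinner (U 0 x) (\<i> *\<^sub>C U 0 y') + cinner (\<i> *\<^sub>C U 0 y) (U 0 x') = 0"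
    by (rule vector_derivative_unique_at)
  then show ?thesis by (simp add: ug_0)
qed

lemma generator_invariant:
  assumes "(x, y) \<in> self_adjoint_generator U"
  shows "(U t x, U t y) \<in> self_adjoint_generator U"
proof -
  have "((\<lambda>s. U t (U s x)) has_vector_derivative U t (\<i> *\<^sub>C y)) (at 0)"
    using assms by (intro bounded_linear.has_vector_derivative[OF unitary_bounded_linear[OF ug_unitary]])
      (simp add: self_adjoint_generator_def)
  then show ?thesis
    by (simp add: self_adjoint_generator_def unitaryD(2)[OF ug_unitary] add.commute flip: ug_add)
qed

text \<open>The difference quotients converge uniformly along the sequence: the error at time t is
  at most |t| times a quantity that is small for small t and large n. Hence the limit n to infinity
  may be taken before t tends to 0.\<close>

lemma closed_generator: "closed (self_adjoint_generator U)"
  unfolding closed_sequential_limits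
proof (intro allI impI; elim conjE)
  fix p :: "nat \<Rightarrow> 'a ell2 \<times> 'a ell2" and l
  assume p: "\<forall>n. p n \<in> self_adjoint_generator U" and lim: "p \<longlonglongrightarrow> l"
  obtain x y where l: "l = (x, y)" by force
  define X Y where "X n = fst (p n)" and "Y n = snd (p n)" for n
  have XY: "(X n, Y n) \<in> self_adjoint_generator U" for n using p by (simp add: X_def Y_def)
  have X: "X \<longlonglongrightarrow> x" and Y: "Y \<longlonglongrightarrow> y"
    using tendsto_fst[OF lim] tendsto_snd[OF lim] by (simp_all add: X_def[abs_def] Y_def[abs_def] l)
  have "((\<lambda>t. U t x) has_derivative (\<lambda>t. t *\<^sub>R \<i> *\<^sub>C y)) (at 0)"
    unfolding has_derivative_at_alt
  proof (intro conjI allI impI bounded_linear_scaleR_left)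
    fix e :: real assume "e > 0"
    have "((\<lambda>t. U t y) \<longlongrightarrow> U 0 y) (at 0)"
      using ug_cont[of y] by (simp add: continuous_on_def)
    then obtain d where d: "d > 0" "\<And>s. s \<noteq> 0 \<Longrightarrow> \<bar>s\<bar> < d \<Longrightarrow> norm (U s y - y) < e"
      using \<open>e > 0\<close> unfolding LIM_eq ug_0 by auto
    have d': "norm (U s y - y) \<le> e" if "\<bar>s\<bar> < d" for s
      using d(2)[of s] that \<open>e > 0\<close> by (cases "s = 0") (auto simp: ug_0)
    have "norm (U t x - x - t *\<^sub>R \<i> *\<^sub>C y) \<le> \<bar>t\<bar> * e" if "\<bar>t\<bar> < d" for t
    proof (rule LIMSEQ_le)
      show "(\<lambda>n. norm (U t (X n) - X n - t *\<^sub>R \<i> *\<^sub>C Y n)) \<longlonglongrightarrow> norm (U t x - x - t *\<^sub>R \<i> *\<^sub>C y)"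
        by (intro tendsto_intros X Y
            bounded_linear.tendsto[OF unitary_bounded_linear[OF ug_unitary]]
            bounded_linear.tendsto[OF bounded_linear_scaleC])
      have "(\<lambda>n. \<bar>t\<bar> * (e + 2 * norm (Y n - y))) \<longlonglongrightarrow> \<bar>t\<bar> * (e + 2 * norm (y - y))"
        by (intro tendsto_intros Y)
      then show "(\<lambda>n. \<bar>t\<bar> * (e + 2 * norm (Y n - y))) \<longlonglongrightarrow> \<bar>t\<bar> * e" by simp
      \<comment> \<open>Mean value inequality. The derivative at s differs from its value at 0 by at
        most e plus twice the distance of \<open>Y n\<close> to \<open>y\<close>: replace
        \<open>Y n\<close> by \<open>y\<close> at both times and use continuity of the orbit of
        \<open>y\<close>.\<close>
      have "norm (U t (X n) - X n - t *\<^sub>R \<i> *\<^sub>C Y n) \<le> \<bar>t\<bar> * (e + 2 * norm (Y n - y))" for n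
      proof -
        have "norm (\<i> *\<^sub>C U s (Y n) - \<i> *\<^sub>C U 0 (Y n)) \<le> e + 2 * norm (Y n - y)"
          if "s \<in> closed_segment 0 t" for s
        proof -
          have "\<bar>s\<bar> < d" using that \<open>\<bar>t\<bar> < d\<close> by (auto simp: closed_segment_eq_real_ivl split: if_splits)
          have "\<i> *\<^sub>C U s (Y n) - \<i> *\<^sub>C U 0 (Y n) = \<i> *\<^sub>C (U s (Y n - y) + (U s y - y) - (Y n - y))"
            by (simp add: ug_diff ug_0 scaleC_diff_right scaleC_add_right)
          then have "norm (\<i> *\<^sub>C U s (Y n) - \<i> *\<^sub>C U 0 (Y n)) = norm (U s (Y n - y) + (U s y - y) - (Y n - y))"
            by simp
          also have "\<dots> \<le> norm (U s (Y n - y)) + norm (U s y - y) + norm (Y n - y)"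
            by (meson add_right_mono norm_triangle_ineq norm_triangle_ineq4 order_trans)
          finally show ?thesis using d'[OF \<open>\<bar>s\<bar> < d\<close>] by (simp add: unitary_norm[OF ug_unitary])
        qed
        then have "norm (U t (X n) - U 0 (X n) - (t - 0) *\<^sub>R \<i> *\<^sub>C U 0 (Y n)) \<le> norm (t - 0) * (e + 2 * norm (Y n - y))"
          by (intro vector_differentiable_bound_linearization[where S = "closed_segment 0 t" and f' = "\<lambda>s. \<i> *\<^sub>C U s (Y n)"])
            (auto intro: has_vector_derivative_at_within generator_derivative XY)
        then show ?thesis by (simp add: ug_0)
      qed
      then show "\<exists>N. \<forall>n\<ge>N. norm (U t (X n) - X n - t *\<^sub>R \<i> *\<^sub>C Y n) \<le> \<bar>t\<bar> * (e + 2 * norm (Y n - y))"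
        by blast
    qed
    then show "\<exists>d>0. \<forall>t. norm (t - 0) < d \<longrightarrow> norm (U t x - U 0 x - (t - 0) *\<^sub>R \<i> *\<^sub>C y) \<le> e * norm (t - 0)"
      using d(1) by (intro exI[of _ d]) (auto simp: ug_0 mult.commute)
  qed
  then show "l \<in> self_adjoint_generator U"
    by (simp add: l self_adjoint_generator_def has_vector_derivative_def)
qed

end

text \<open>On the common domain the product of \<open>V s x\<close> with \<open>U s y\<close> has
  derivative 0 by symmetry of the generator, so \<open>V (- t)\<close> undoes \<open>U t\<close>
  there; density does the rest.\<close>

lemma unitary_group_unique:
  assumes U: "unitary_group U" and V: "unitary_group V"
    and eq: "self_adjoint_generator U = self_adjoint_generator V"
    and dense: "closure (fst ` self_adjoint_generator U) = UNIV"
  shows "U = V"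
proof (rule ext, rule ext)
  fix t x
  have base: "cinner (V t x) (U t y) = cinner x y"
    if x: "x \<in> fst ` self_adjoint_generator U" and y: "y \<in> fst ` self_adjoint_generator U" for x y
  proof -
    obtain x' y' where x': "(x, x') \<in> self_adjoint_generator U" and y': "(y, y') \<in> self_adjoint_generator U"
      using x y by auto
    have "((\<lambda>s. cinner (V s x) (U s y)) has_vector_derivative 0) (at s)" for s
    proof -
      have "((\<lambda>s. cinner (V s x) (U s y)) has_vector_derivative
          cinner (V s x) (\<i> *\<^sub>C U s y') + cinner (\<i> *\<^sub>C V s x') (U s y)) (at s)"
        using x' y' eq by (intro has_vector_derivative_cinner generator_derivative[OF U] generator_derivative[OF V]) auto
      moreover have "cinner (V s x') (U s y) = cinner (V s x) (U s y')"
        using generator_invariant[OF V, of x x' s] generator_invariant[OF U y', of s] x' eq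
        by (intro generator_symmetric[OF U]) auto
      ultimately show ?thesis by simp
    qed
    then obtain c where c: "\<And>s. cinner (V s x) (U s y) = c"
      using has_vector_derivative_zero_constant[of UNIV "\<lambda>s. cinner (V s x) (U s y)"] by auto
    show ?thesis using c[of t] c[of 0] by (simp add: ug_0[OF U] ug_0[OF V])
  qed
  have "U t y = V t y" if "y \<in> fst ` self_adjoint_generator U" for y
  proof -
    have "cinner d (V (- t) (U t y)) = cinner d y" if "d \<in> fst ` self_adjoint_generator U" for d
      using base[OF that \<open>y \<in> _\<close>] by (simp add: ug_adjoint[OF V])
    then have "V (- t) (U t y) = y" by (rule cinner_eq_on_dense[OF dense])
    then show ?thesis by (metis ug_uminus[OF V])
  qed
  moreover have "closed {x. U t x = V t x}"
    by (intro closed_Collect_eq linear_continuous_on unitary_bounded_linear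
        ug_unitary[OF U] ug_unitary[OF V])
  ultimately have "closure (fst ` self_adjoint_generator U) \<subseteq> {x. U t x = V t x}"
    by (intro closure_minimal) auto
  then show "U t x = V t x" using dense by auto
qed

section \<open>Symmetric operators with uniformly analytic vectors\<close>

text \<open>An isometry on a dense subspace is uniformly continuous and so extends. Additivity and
  isometry of the extension are closed conditions on pairs, which hold on the dense set
  \<open>D \<times> D\<close>.\<close>

lemma isometry_extension:
  fixes f :: "'a ell2 \<Rightarrow> 'a ell2"
  assumes dense: "closure D = UNIV"
    and D: "\<And>x y. x \<in> D \<Longrightarrow> y \<in> D \<Longrightarrow> x + y \<in> D" "\<And>c x. x \<in> D \<Longrightarrow> c *\<^sub>C x \<in> D"
    and add: "\<And>x y. x \<in> D \<Longrightarrow> y \<in> D \<Longrightarrow> f (x + y) = f x + f y"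
    and scale: "\<And>c x. x \<in> D \<Longrightarrow> f (c *\<^sub>C x) = c *\<^sub>C f x"
    and iso: "\<And>x y. x \<in> D \<Longrightarrow> y \<in> D \<Longrightarrow> cinner (f x) (f y) = cinner x y"
  obtains W where "continuous_on UNIV W" "\<And>x. x \<in> D \<Longrightarrow> W x = f x"
    "\<And>x y. W (x + y) = W x + W y" "\<And>c x. W (c *\<^sub>C x) = c *\<^sub>C W x"
    "\<And>x y. cinner (W x) (W y) = cinner x y"
proof -
  have diff: "f (x - y) = f x - f y" "x - y \<in> D" if "x \<in> D" "y \<in> D" for x y
  proof -
    have "x - y = x + (-1) *\<^sub>C y" by (simp add: scaleC_minus_left)
    then show "f (x - y) = f x - f y" "x - y \<in> D"
      using add[of x "(-1) *\<^sub>C y"] scale[of y "-1"] D(2)[of y "-1"] D(1)[of x "(-1) *\<^sub>C y"] that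
      by (auto simp: scaleC_minus_left)
  qed
  have norm: "norm (f x) = norm x" if "x \<in> D" for x
    using iso[OF that that] by (simp add: cinner_self power2_eq_iff_nonneg flip: of_real_power)
  have "uniformly_continuous_on D f"
    unfolding uniformly_continuous_on_def dist_norm
    by (metis diff norm)
  then obtain W where W: "uniformly_continuous_on (closure D) W" "\<And>x. x \<in> D \<Longrightarrow> f x = W x"
    using uniformly_continuous_on_extension_on_closure by metis
  then have cont: "continuous_on UNIV W" using dense uniformly_continuous_imp_continuous by metis
  have dense2: "p \<in> closure (D \<times> D)" for p using dense by (simp add: closure_Times)
  have c1: "continuous_on UNIV (\<lambda>p :: 'a ell2 \<times> 'a ell2. W (g p))" if "continuous_on UNIV g" for g
    using continuous_on_compose2[OF cont that] by simp
  have "closed {p :: 'a ell2 \<times> 'a ell2. W (fst p + snd p) = W (fst p) + W (snd p)}"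
    by (intro closed_Collect_eq c1 continuous_intros)
  then have "closure (D \<times> D) \<subseteq> {p. W (fst p + snd p) = W (fst p) + W (snd p)}"
    using D add W(2) by (intro closure_minimal) auto
  then have "W (x + y) = W x + W y" for x y using dense2[of "(x, y)"] by auto
  moreover have "closed {p :: 'a ell2 \<times> 'a ell2. cinner (W (fst p)) (W (snd p)) = cinner (fst p) (snd p)}"
    by (intro closed_Collect_eq bounded_bilinear.continuous_on[OF bounded_bilinear_cinner] c1 continuous_intros)
  then have "closure (D \<times> D) \<subseteq> {p. cinner (W (fst p)) (W (snd p)) = cinner (fst p) (snd p)}"
    using iso W(2) by (intro closure_minimal) auto
  then have "cinner (W x) (W y) = cinner x y" for x y using dense2[of "(x, y)"] by auto
  moreover have "W (c *\<^sub>C x) = c *\<^sub>C W x" for c x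
  proof -
    have "continuous_on UNIV (\<lambda>x. W (c *\<^sub>C x))"
      by (rule continuous_on_compose2[OF cont linear_continuous_on[OF bounded_linear_scaleC]]) auto
    then have "closed {x. W (c *\<^sub>C x) = c *\<^sub>C W x}"
      by (intro closed_Collect_eq bounded_linear.continuous_on[OF bounded_linear_scaleC cont])
    then have "closure D \<subseteq> {x. W (c *\<^sub>C x) = c *\<^sub>C W x}"
      using D scale W(2) by (intro closure_minimal) auto
    then show ?thesis using dense by auto
  qed
  ultimately show ?thesis using that[OF cont] W(2) by metis
qed

section \<open>Exponential series of a sequence of vectors\<close>

definition expc :: "nat \<Rightarrow> real \<Rightarrow> complex" where
  "expc k t = (\<i> * of_real t) ^ k / fact k"

text \<open>An arbitrary sequence stands in place of the powers of one operator, because the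
  sequence shifted by a leading zero is used as well: its series is the time integral of an orbit,
  up to the factor \<i>.\<close>

definition exp_series :: "(nat \<Rightarrow> 'a ell2) \<Rightarrow> real \<Rightarrow> 'a ell2" where
  "exp_series v t = (\<Sum>k. expc k t *\<^sub>C v k)"

lemma norm_expc: "cmod (expc k t) = \<bar>t\<bar> ^ k / fact k"
  by (simp add: expc_def norm_divide norm_power norm_mult)

lemma exp_series_sums:
  assumes "summable (\<lambda>k. \<bar>t\<bar> ^ k / fact k * norm (v k))"
  shows "(\<lambda>k. expc k t *\<^sub>C v k) sums exp_series v t"
  unfolding exp_series_def
  by (rule summable_sums, rule summable_norm_cancel) (use assms in \<open>simp add: norm_expc\<close>)

lemma exp_series_0: "exp_series v 0 = v 0"
proof -
  have "(\<lambda>k. expc k 0 *\<^sub>C v k) = (\<lambda>k. if k = 0 then v k else 0)"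
    by (auto simp: expc_def fun_eq_iff power_0_left)
  then have "(\<lambda>k. expc k 0 *\<^sub>C v k) sums v 0"
    using sums_single[of 0 v] by simp
  then show ?thesis unfolding exp_series_def by (simp add: sums_iff)
qed

lemma expc_deriv: "((\<lambda>t. expc (Suc k) t) has_vector_derivative \<i> * expc k t) (at t within S)"
proof -
  have "((\<lambda>z. (\<i> * z) ^ Suc k / fact (Suc k)) has_field_derivative
      (1 + of_nat k) * (\<i> * (\<i> * z) ^ k) / fact (Suc k)) (at z)" for z :: complex
    by (intro DERIV_cdivide DERIV_power_Suc) (auto intro!: derivative_eq_intros)
  moreover have "(1 + of_nat k) * (\<i> * w) / fact (Suc k) = \<i> * (w / fact k)" for w :: complex
    unfolding fact_Suc of_nat_Suc of_nat_mult
    by (simp add: divide_simps add_eq_0_iff flip: of_nat_Suc del: of_nat_Suc)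
  ultimately have "((\<lambda>z. (\<i> * z) ^ Suc k / fact (Suc k)) has_field_derivative
      \<i> * ((\<i> * of_real t) ^ k / fact k)) (at (of_real t))" by metis
  then show ?thesis
    unfolding expc_def by (rule has_vector_derivative_real_field)
qed

lemma exp_series_derivative:
  assumes v: "\<And>t. \<bar>t\<bar> < r \<Longrightarrow> summable (\<lambda>k. \<bar>t\<bar> ^ k / fact k * norm (v k))"
    and v': "\<And>t. \<bar>t\<bar> < r \<Longrightarrow> summable (\<lambda>k. \<bar>t\<bar> ^ k / fact k * norm (v (Suc k)))"
    and t: "\<bar>t\<bar> < r"
  shows "(exp_series v has_vector_derivative \<i> *\<^sub>C exp_series (\<lambda>k. v (Suc k)) t) (at t)"
proof -
  \<comment> \<open>Termwise differentiation needs uniform convergence of the derivative series,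
    which holds on an interval strictly inside the radius.\<close>
  obtain \<rho> where \<rho>: "\<bar>t\<bar> < \<rho>" "\<rho> < r" using dense[OF t] by blast
  then have \<rho>_pos: "0 \<le> \<rho>" by linarith
  define S where "S = {-\<rho><..<\<rho>}"
  have S: "convex S" "t \<in> S" "open S" and S_r: "\<And>s. s \<in> S \<Longrightarrow> \<bar>s\<bar> < r" "\<And>s. s \<in> S \<Longrightarrow> \<bar>s\<bar> \<le> \<rho>"
    using \<rho> by (auto simp: S_def)
  \<comment> \<open>Term 0 is constant and term \<open>Suc k\<close> differentiates to \<i> times
    term k of the shifted series. Hence \<open>Suc n\<close> derivative terms match n terms of that
    series.\<close>
  define f' where "f' n s h = (case n of 0 \<Rightarrow> 0 | Suc k \<Rightarrow> h *\<^sub>R \<i> *\<^sub>C expc k s *\<^sub>C v (Suc k))" for n s h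
  have "\<exists>g. \<forall>s\<in>S. (\<lambda>n. expc n s *\<^sub>C v n) sums g s \<and>
      (g has_derivative (\<lambda>h. h *\<^sub>R \<i> *\<^sub>C exp_series (\<lambda>k. v (Suc k)) s)) (at s within S)"
  proof (rule has_derivative_series[OF S(1) _ _ S(2)])
    fix n s assume "s \<in> S"
    show "((\<lambda>s. expc n s *\<^sub>C v n) has_derivative f' n s) (at s within S)"
    proof (cases n)
      case 0
      then show ?thesis by (simp add: f'_def[abs_def] expc_def)
    next
      case (Suc k)
      have "((\<lambda>s. expc (Suc k) s *\<^sub>C v (Suc k)) has_vector_derivative (\<i> * expc k s) *\<^sub>C v (Suc k)) (at s within S)"
        by (rule bounded_linear.has_vector_derivative[OF bounded_bilinear.bounded_linear_left[OF bounded_bilinear_scaleC]])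
          (rule expc_deriv)
      then show ?thesis
        by (simp add: f'_def[abs_def] Suc has_vector_derivative_def funpow_swap1)
    qed
  next
    fix e :: real assume e: "e > 0"
    have "uniform_limit S (\<lambda>n s. \<Sum>i<n. expc i s *\<^sub>C v (Suc i)) (\<lambda>s. exp_series (\<lambda>k. v (Suc k)) s) sequentially"
      unfolding exp_series_def
    proof (rule Weierstrass_m_test)
      show "summable (\<lambda>k. \<bar>\<rho>\<bar> ^ k / fact k * norm (v (Suc k)))"
        using \<rho> \<rho>_pos by (intro v') auto
      show "norm (expc n s *\<^sub>C v (Suc n)) \<le> \<bar>\<rho>\<bar> ^ n / fact n * norm (v (Suc n))" if "s \<in> S" for n s
        using S_r(2)[OF that] by (auto simp: norm_expc intro!: mult_right_mono divide_right_mono power_mono)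
    qed
    then have "\<forall>\<^sub>F n in sequentially. \<forall>s\<in>S. dist (\<Sum>i<n. expc i s *\<^sub>C v (Suc i)) (exp_series (\<lambda>k. v (Suc k)) s) < e"
      using e by (rule uniform_limitD)
    then have "\<forall>\<^sub>F n in sequentially. \<forall>s\<in>S. \<forall>h. norm ((\<Sum>i<Suc n. f' i s h) - h *\<^sub>R \<i> *\<^sub>C exp_series (\<lambda>k. v (Suc k)) s) \<le> e * norm h"
    proof eventually_elim
      case (elim n)
      show ?case
      proof (intro ballI allI)
        fix s h assume "s \<in> S"
        have "(\<Sum>i<Suc n. f' i s h) = (\<Sum>i<n. h *\<^sub>R \<i> *\<^sub>C expc i s *\<^sub>C v (Suc i))"
          unfolding sum.lessThan_Suc_shift f'_def by simp
        also have "\<dots> = h *\<^sub>R \<i> *\<^sub>C (\<Sum>i<n. expc i s *\<^sub>C v (Suc i))"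
          by (simp add: linear_sum[OF bounded_linear.linear[OF bounded_linear_scaleC]] scaleR_sum_right)
        finally have "norm ((\<Sum>i<Suc n. f' i s h) - h *\<^sub>R \<i> *\<^sub>C exp_series (\<lambda>k. v (Suc k)) s)
            = \<bar>h\<bar> * dist (\<Sum>i<n. expc i s *\<^sub>C v (Suc i)) (exp_series (\<lambda>k. v (Suc k)) s)"
          by (simp add: dist_norm flip: scaleR_diff_right scaleC_diff_right)
        also have "\<dots> \<le> \<bar>h\<bar> * e" using elim \<open>s \<in> S\<close> by (intro mult_left_mono) auto
        finally show "norm ((\<Sum>i<Suc n. f' i s h) - h *\<^sub>R \<i> *\<^sub>C exp_series (\<lambda>k. v (Suc k)) s) \<le> e * norm h"
          by (simp add: mult.commute)
      qed
    qed
    then show "\<forall>\<^sub>F n in sequentially. \<forall>s\<in>S. \<forall>h. norm ((\<Sum>i<n. f' i s h) - h *\<^sub>R \<i> *\<^sub>C exp_series (\<lambda>k. v (Suc k)) s) \<le> e * norm h"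
      by (rule eventually_sequentially_Suc[THEN iffD1])
  next
    show "(\<lambda>n. expc n t *\<^sub>C v n) sums exp_series v t" by (rule exp_series_sums[OF v[OF t]])
  qed
  then obtain g where g: "\<And>s. s \<in> S \<Longrightarrow> (\<lambda>n. expc n s *\<^sub>C v n) sums g s"
    "(g has_derivative (\<lambda>h. h *\<^sub>R \<i> *\<^sub>C exp_series (\<lambda>k. v (Suc k)) t)) (at t within S)" using S(2) by auto
  have "g s = exp_series v s" if "s \<in> S" for s
    using g(1)[OF that] exp_series_sums[OF v[OF S_r(1)[OF that]]] sums_unique2 by blast
  then have "(exp_series v has_derivative (\<lambda>h. h *\<^sub>R \<i> *\<^sub>C exp_series (\<lambda>k. v (Suc k)) t)) (at t within S)"
    using g(2) S(2) by (auto intro: has_derivative_transform_within[OF _ zero_less_one])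
  moreover have "at t within S = at t" by (rule at_within_open[OF S(2,3)])
  ultimately show ?thesis unfolding has_vector_derivative_def by simp
qed

text \<open>The decisive assumption is \<open>analytic\<close>: the radius \<open>r\<close> is the
  same for all vectors of \<open>D\<close>. Short-time exponentials are thus defined on all of
  \<open>D\<close> at once, extend by continuity, and can be iterated.\<close>

locale uniformly_analytic =
  fixes D :: "'a ell2 set" and T :: "'a ell2 \<Rightarrow> 'a ell2" and r :: real
  assumes r_pos: "r > 0"
    and dense: "closure D = UNIV"
    and D_add: "x \<in> D \<Longrightarrow> y \<in> D \<Longrightarrow> x + y \<in> D"
    and D_scale: "x \<in> D \<Longrightarrow> c *\<^sub>C x \<in> D"
    and T_D: "x \<in> D \<Longrightarrow> T x \<in> D"
    and T_add: "x \<in> D \<Longrightarrow> y \<in> D \<Longrightarrow> T (x + y) = T x + T y"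
    and T_scale: "x \<in> D \<Longrightarrow> T (c *\<^sub>C x) = c *\<^sub>C T x"
    and T_symmetric: "x \<in> D \<Longrightarrow> y \<in> D \<Longrightarrow> cinner (T x) y = cinner x (T y)"
    and analytic: "x \<in> D \<Longrightarrow> \<bar>t\<bar> < r \<Longrightarrow> summable (\<lambda>k. \<bar>t\<bar> ^ k / fact k * norm ((T ^^ k) x))"
begin

definition ser :: "real \<Rightarrow> 'a ell2 \<Rightarrow> 'a ell2" where
  "ser t x = exp_series (\<lambda>k. (T ^^ k) x) t"

lemma pow_D: "x \<in> D \<Longrightarrow> (T ^^ k) x \<in> D"
  by (induction k) (auto intro: T_D)

lemma pow_add: "x \<in> D \<Longrightarrow> y \<in> D \<Longrightarrow> (T ^^ k) (x + y) = (T ^^ k) x + (T ^^ k) y"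
  by (induction k) (auto simp: T_add pow_D)

lemma pow_scale: "x \<in> D \<Longrightarrow> (T ^^ k) (c *\<^sub>C x) = c *\<^sub>C (T ^^ k) x"
  by (induction k) (auto simp: T_scale pow_D)

lemma ser_sums: "x \<in> D \<Longrightarrow> \<bar>t\<bar> < r \<Longrightarrow> (\<lambda>k. expc k t *\<^sub>C (T ^^ k) x) sums ser t x"
  unfolding ser_def by (rule exp_series_sums) (rule analytic)

lemma ser_add:
  assumes "x \<in> D" "y \<in> D" "\<bar>t\<bar> < r"
  shows "ser t (x + y) = ser t x + ser t y"
proof -
  have "(\<lambda>k. expc k t *\<^sub>C (T ^^ k) (x + y)) sums (ser t x + ser t y)"
    using sums_add[OF ser_sums[OF assms(1,3)] ser_sums[OF assms(2,3)]] assms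
    by (simp add: pow_add scaleC_add_right)
  then show ?thesis using ser_sums[of "x + y" t] assms D_add sums_unique2 by blast
qed

lemma ser_scale:
  assumes "x \<in> D" "\<bar>t\<bar> < r"
  shows "ser t (c *\<^sub>C x) = c *\<^sub>C ser t x"
proof -
  have "(\<lambda>k. expc k t *\<^sub>C (T ^^ k) (c *\<^sub>C x)) sums (c *\<^sub>C ser t x)"
    using bounded_linear.sums[OF bounded_linear_scaleC ser_sums[OF assms], of c] assms
    by (simp add: pow_scale mult.commute)
  then show ?thesis using ser_sums[of "c *\<^sub>C x" t] assms D_scale sums_unique2 by blast
qed

lemma ser_0: "ser 0 x = x"
  by (simp add: ser_def exp_series_0)

lemma ser_derivative:
  assumes x: "x \<in> D" and t: "\<bar>t\<bar> < r"
  shows "((\<lambda>t. ser t x) has_vector_derivative \<i> *\<^sub>C ser t (T x)) (at t)"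
proof -
  have "(exp_series (\<lambda>k. (T ^^ k) x) has_vector_derivative \<i> *\<^sub>C exp_series (\<lambda>k. (T ^^ Suc k) x) t) (at t)"
    by (rule exp_series_derivative[OF _ _ t])
      (use analytic[OF x] analytic[OF T_D[OF x]] in \<open>simp_all add: funpow_swap1\<close>)
  then show ?thesis by (simp add: ser_def funpow_swap1)
qed

text \<open>The sums of the series may lie outside \<open>D\<close>, where
  \<open>T_symmetric\<close> says nothing. So the series are expanded one argument at a time, each
  time with partial terms inside \<open>D\<close>.\<close>

lemma cinner_ser_T:
  assumes "x \<in> D" "y \<in> D" "\<bar>a\<bar> < r" "\<bar>b\<bar> < r"
  shows "cinner (ser a (T y)) (ser b x) = cinner (ser a y) (ser b (T x))"
proof -
  have 1: "cinner (ser a (T y)) v = cinner (ser a y) (T v)" if "v \<in> D" for v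
  proof (rule sums_unique2)
    show "(\<lambda>k. cinner (expc k a *\<^sub>C (T ^^ k) (T y)) v) sums cinner (ser a (T y)) v"
      using assms by (intro bounded_linear.sums[OF bounded_linear_cinner_left] ser_sums T_D)
    have "(\<lambda>k. cinner (expc k a *\<^sub>C (T ^^ k) y) (T v)) sums cinner (ser a y) (T v)"
      using assms by (intro bounded_linear.sums[OF bounded_linear_cinner_left] ser_sums)
    then show "(\<lambda>k. cinner (expc k a *\<^sub>C (T ^^ k) (T y)) v) sums cinner (ser a y) (T v)"
      using assms that by (simp add: pow_D T_symmetric flip: funpow_swap1)
  qed
  show ?thesis
  proof (rule sums_unique2)
    show "(\<lambda>k. cinner (ser a (T y)) (expc k b *\<^sub>C (T ^^ k) x)) sums cinner (ser a (T y)) (ser b x)"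
      using assms by (intro bounded_linear.sums[OF bounded_linear_cinner_right] ser_sums)
    have "(\<lambda>k. cinner (ser a y) (expc k b *\<^sub>C (T ^^ k) (T x))) sums cinner (ser a y) (ser b (T x))"
      using assms by (intro bounded_linear.sums[OF bounded_linear_cinner_right] ser_sums T_D)
    then show "(\<lambda>k. cinner (ser a (T y)) (expc k b *\<^sub>C (T ^^ k) x)) sums cinner (ser a y) (ser b (T x))"
      using assms by (simp add: pow_D 1 flip: funpow_swap1)
  qed
qed

text \<open>The product of \<open>ser (- u) y\<close> with \<open>ser (s + t - u) x\<close> does not
  depend on u; compare u = 0 with u = s. The case s = -t is the isometry of \<open>ser t\<close>,
  and the general case becomes the local group law.\<close>

lemma cinner_ser:
  assumes x: "x \<in> D" and y: "y \<in> D" and st: "\<bar>s\<bar> < r" "\<bar>t\<bar> < r" "\<bar>s + t\<bar> < r"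
  shows "cinner (ser (- s) y) (ser t x) = cinner y (ser (s + t) x)"
proof -
  \<comment> \<open>The times u at which both series are inside their radius; an intersection of
    intervals, hence convex.\<close>
  define S where "S = {-r<..<r} \<inter> {s + t - r<..<s + t + r}"
  have S: "convex S" "0 \<in> S" "s \<in> S" using st by (auto simp: S_def intro: convex_Int)
  have "((\<lambda>u. cinner (ser (- u) y) (ser (s + t - u) x)) has_vector_derivative 0) (at u within S)" if "u \<in> S" for u
  proof -
    have u: "\<bar>- u\<bar> < r" "\<bar>s + t - u\<bar> < r" using that by (auto simp: S_def)
    have "((\<lambda>u. ser u y) \<circ> uminus has_vector_derivative (- 1) *\<^sub>R \<i> *\<^sub>C ser (- u) (T y)) (at u)"
      by (rule vector_diff_chain_at) (use u y ser_derivative[of y "- u"] in \<open>auto intro!: derivative_eq_intros\<close>)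
    moreover have "((\<lambda>u. ser u x) \<circ> (\<lambda>u. s + t - u) has_vector_derivative (- 1) *\<^sub>R \<i> *\<^sub>C ser (s + t - u) (T x)) (at u)"
      by (rule vector_diff_chain_at) (use u x ser_derivative[of x "s + t - u"] in \<open>auto intro!: derivative_eq_intros\<close>)
    ultimately have "((\<lambda>u. cinner (((\<lambda>u. ser u y) \<circ> uminus) u) (((\<lambda>u. ser u x) \<circ> (\<lambda>u. s + t - u)) u)) has_vector_derivative
        cinner (((\<lambda>u. ser u y) \<circ> uminus) u) ((- 1) *\<^sub>R \<i> *\<^sub>C ser (s + t - u) (T x))
        + cinner ((- 1) *\<^sub>R \<i> *\<^sub>C ser (- u) (T y)) (((\<lambda>u. ser u x) \<circ> (\<lambda>u. s + t - u)) u)) (at u within S)"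
      using has_vector_derivative_at_within has_vector_derivative_cinner by blast
    then show ?thesis
      using u x y by (simp add: cinner_ser_T)
  qed
  from has_vector_derivative_zero_constant[OF S(1) this]
  obtain c where c: "\<And>u. u \<in> S \<Longrightarrow> cinner (ser (- u) y) (ser (s + t - u) x) = c"
    by blast
  show ?thesis using c[OF S(2)] c[OF S(3)] y by (simp add: ser_0)
qed

section \<open>From short-time isometries to a unitary group\<close>

definition loc :: "real \<Rightarrow> 'a ell2 \<Rightarrow> 'a ell2" where
  "loc u = (SOME W. continuous_on UNIV W \<and> (\<forall>x\<in>D. W x = ser u x) \<and>
     (\<forall>x y. W (x + y) = W x + W y) \<and> (\<forall>c x. W (c *\<^sub>C x) = c *\<^sub>C W x) \<and>
     (\<forall>x y. cinner (W x) (W y) = cinner x y))"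

lemma loc:
  assumes "\<bar>u\<bar> < r"
  shows loc_continuous: "continuous_on UNIV (loc u)"
    and loc_ser: "x \<in> D \<Longrightarrow> loc u x = ser u x"
    and loc_add: "loc u (x + y) = loc u x + loc u y"
    and loc_scale: "loc u (c *\<^sub>C x) = c *\<^sub>C loc u x"
    and loc_cinner: "cinner (loc u x) (loc u y) = cinner x y"
proof -
  obtain W where "continuous_on UNIV W" "\<And>x. x \<in> D \<Longrightarrow> W x = ser u x"
    "\<And>x y. W (x + y) = W x + W y" "\<And>c x. W (c *\<^sub>C x) = c *\<^sub>C W x"
    "\<And>x y. cinner (W x) (W y) = cinner x y"
  proof (rule isometry_extension[OF dense, of "ser u"])
    show "cinner (ser u x) (ser u y) = cinner x y" if "x \<in> D" "y \<in> D" for x y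
      using cinner_ser[of y x "- u" u] that assms r_pos by (simp add: ser_0)
  qed (use assms in \<open>auto intro: D_add D_scale ser_add ser_scale\<close>)
  then have "\<exists>W. continuous_on UNIV W \<and> (\<forall>x\<in>D. W x = ser u x) \<and>
     (\<forall>x y. W (x + y) = W x + W y) \<and> (\<forall>c x. W (c *\<^sub>C x) = c *\<^sub>C W x) \<and>
     (\<forall>x y. cinner (W x) (W y) = cinner x y)" by blast
  from someI_ex[OF this, folded loc_def]
  show "continuous_on UNIV (loc u)" "x \<in> D \<Longrightarrow> loc u x = ser u x" "loc u (x + y) = loc u x + loc u y"
    "loc u (c *\<^sub>C x) = c *\<^sub>C loc u x" "cinner (loc u x) (loc u y) = cinner x y" by auto
qed

lemma cinner_loc:
  assumes st: "\<bar>s\<bar> < r" "\<bar>t\<bar> < r" "\<bar>s + t\<bar> < r"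
  shows "cinner (loc (- s) y) (loc t x) = cinner y (loc (s + t) x)"
proof -
  have c: "continuous_on UNIV (\<lambda>p :: 'a ell2 \<times> 'a ell2. loc u (g p))"
    if "\<bar>u\<bar> < r" "continuous_on UNIV g" for u g
    using continuous_on_compose2[OF loc_continuous[OF that(1)] that(2)] by simp
  have "closed {p :: 'a ell2 \<times> 'a ell2. cinner (loc (- s) (fst p)) (loc t (snd p)) = cinner (fst p) (loc (s + t) (snd p))}"
    using st by (intro closed_Collect_eq bounded_bilinear.continuous_on[OF bounded_bilinear_cinner] c continuous_intros) auto
  then have "closure (D \<times> D) \<subseteq> {p. cinner (loc (- s) (fst p)) (loc t (snd p)) = cinner (fst p) (loc (s + t) (snd p))}"
    using st by (intro closure_minimal) (auto simp: loc_ser cinner_ser)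
  moreover have "(y, x) \<in> closure (D \<times> D)" using dense by (simp add: closure_Times)
  ultimately show ?thesis by auto
qed

lemma loc_0: "loc 0 x = x"
proof (rule cinner_eq_on_dense[OF dense])
  fix d assume "d \<in> D"
  then show "cinner d (loc 0 x) = cinner d x"
    using loc_cinner[of 0 d x] r_pos by (simp add: loc_ser ser_0)
qed

lemma loc_loc:
  assumes st: "\<bar>s\<bar> < r" "\<bar>t\<bar> < r" "\<bar>s + t\<bar> < r"
  shows "loc s (loc t x) = loc (s + t) x"
proof (rule cinner_eq_on_dense[of UNIV])
  fix y
  \<comment> \<open>With second time 0 the identity says that \<open>loc (- s)\<close> is the
    adjoint of \<open>loc s\<close>. Applied to \<open>loc t x\<close> it turns
    \<open>cinner_loc\<close> into the composition law.\<close>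
  have "cinner (loc (- s) y) (loc 0 z) = cinner y (loc (s + 0) z)" for z
    using st r_pos by (intro cinner_loc) auto
  then show "cinner y (loc s (loc t x)) = cinner y (loc (s + t) x)"
    using cinner_loc[OF st, of y x] by (simp add: loc_0)
qed simp

lemma unitary_loc: "\<bar>u\<bar> < r \<Longrightarrow> unitary (loc u)"
proof -
  assume u: "\<bar>u\<bar> < r"
  have "loc u (loc (- u) x) = x" for x using loc_loc[of u "- u" x] u r_pos by (simp add: loc_0)
  then have "surj (loc u)" by (metis surjI)
  then show ?thesis using u by (simp add: unitary_def loc_add loc_scale loc_cinner)
qed

lemma loc_pow: "\<bar>u\<bar> < r \<Longrightarrow> \<bar>real k * u\<bar> < r \<Longrightarrow> loc u ^^ k = loc (real k * u)"
proof (induction k)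
  case 0
  then show ?case by (auto simp: loc_0)
next
  case (Suc k)
  have "\<bar>real k * u\<bar> \<le> \<bar>real (Suc k) * u\<bar>" by (simp add: abs_mult mult_right_mono)
  then have "\<bar>real k * u\<bar> < r" using Suc.prems(2) by linarith
  moreover have "u + real k * u = real (Suc k) * u" by (simp add: algebra_simps)
  ultimately show ?case using Suc loc_loc[of u "real k * u"] by (auto simp del: of_nat_Suc)
qed

text \<open>\<open>Suc\<close> of the rounded-up quotient makes each time step strictly shorter than
  \<open>r\<close> and the number of steps positive.\<close>

definition evol :: "real \<Rightarrow> 'a ell2 \<Rightarrow> 'a ell2" where
  "evol t = (let m = Suc (nat \<lceil>\<bar>t\<bar> / r\<rceil>) in loc (t / real m) ^^ m)"

text \<open>Independence of the number of steps: for step numbers m and n, both maps are the (m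
  n)-th power of \<open>loc u\<close> with u = t / (m n).\<close>

lemma evol_eq:
  assumes m: "m > 0" "\<bar>t\<bar> / real m < r"
  shows "evol t = loc (t / real m) ^^ m"
proof -
  define n where "n = Suc (nat \<lceil>\<bar>t\<bar> / r\<rceil>)"
  have "\<bar>t\<bar> / r < real n" unfolding n_def by linarith
  then have n: "n > 0" "\<bar>t\<bar> / real n < r" using r_pos by (auto simp: n_def divide_simps mult.commute simp del: of_nat_Suc)
  define u where "u = t / (real m * real n)"
  have mn: "real m * u = t / real n" "real n * u = t / real m" using m n by (auto simp: u_def)
  have "\<bar>u\<bar> \<le> \<bar>real m * u\<bar>" using m by (simp add: abs_mult mult_le_cancel_right1)
  moreover have "\<bar>real m * u\<bar> < r" using n unfolding mn by simp
  ultimately have u: "\<bar>u\<bar> < r" by simp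
  have "loc (t / real n) = loc u ^^ m" "loc (t / real m) = loc u ^^ n"
    using loc_pow[OF u, of m] loc_pow[OF u, of n] m n unfolding mn by auto
  then have "loc (t / real n) ^^ n = loc (t / real m) ^^ m"
    by (simp add: funpow_mult mult.commute)
  then show ?thesis by (simp add: evol_def n_def Let_def)
qed

lemma evol_small: "\<bar>t\<bar> < r \<Longrightarrow> evol t = loc t"
  using evol_eq[of 1 t] by simp

lemma funpow_comp_commute:
  assumes "f \<circ> g = g \<circ> f"
  shows "(f \<circ> g) ^^ n = f ^^ n \<circ> g ^^ n"
proof (induction n)
  case (Suc n)
  have comm: "g (f x) = f (g x)" for x using assms by (metis comp_apply)
  have "g ((f ^^ n) x) = (f ^^ n) (g x)" for x
    by (induction n) (simp_all add: comm)
  then show ?case using Suc by (simp add: fun_eq_iff)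
qed simp

lemma unitary_group_evol: "unitary_group evol"
proof -
  \<comment> \<open>One number of steps that is admissible for s, t and s + t simultaneously reduces
    the group law to that of \<open>loc\<close>.\<close>
  have big: "\<exists>m>0. \<bar>s\<bar> / real m < r \<and> \<bar>t\<bar> / real m < r \<and> \<bar>s + t\<bar> / real m < r" for s t
  proof -
    obtain m where m: "(\<bar>s\<bar> + \<bar>t\<bar>) / r < real m" using reals_Archimedean2 by blast
    then have "m > 0" using r_pos by (cases m) (auto simp: divide_simps split: if_splits)
    moreover have "\<bar>s\<bar> + \<bar>t\<bar> < r * real m" using m r_pos by (simp add: divide_simps mult.commute)
    ultimately show ?thesis by (intro exI[of _ m]) (auto simp: divide_simps mult.commute)
  qed
  have unit: "unitary (evol t)" for t
    using big[of t t] by (auto simp: evol_eq intro!: unitary_funpow unitary_loc)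
  have add: "evol (s + t) = evol s \<circ> evol t" for s t
  proof -
    obtain m where m: "m > 0" "\<bar>s\<bar> / real m < r" "\<bar>t\<bar> / real m < r" "\<bar>s + t\<bar> / real m < r"
      using big by blast
    define u v where "u = s / real m" and "v = t / real m"
    have uv: "\<bar>u\<bar> < r" "\<bar>v\<bar> < r" "\<bar>u + v\<bar> < r" "(s + t) / real m = u + v"
      using m by (auto simp: u_def v_def abs_divide simp flip: add_divide_distrib)
    then have "loc u \<circ> loc v = loc (u + v)" "loc v \<circ> loc u = loc (u + v)"
      using loc_loc[of u v] loc_loc[of v u] by (auto simp: fun_eq_iff add.commute)
    then have "loc (u + v) ^^ m = loc u ^^ m \<circ> loc v ^^ m"
      using funpow_comp_commute[of "loc u" "loc v" m] by simp
    then show ?thesis using m uv(4) by (simp add: evol_eq u_def v_def)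
  qed
  have zero: "evol 0 = id" using evol_small[of 0] r_pos by (auto simp: loc_0)
  \<comment> \<open>Strong continuity at 0 holds on \<open>D\<close> by differentiability of the
    series, and on all vectors by a three-epsilon argument with isometry.\<close>
  have at0: "((\<lambda>t. evol t x) \<longlongrightarrow> x) (at 0)" for x
  proof (rule tendstoI)
    fix e :: real assume e: "e > 0"
    obtain d where d: "d \<in> D" "dist d x < e / 3"
      using dense closure_approachable[of x D] e by (metis UNIV_I zero_less_divide_iff zero_less_numeral)
    have "((\<lambda>t. ser t d) \<longlongrightarrow> ser 0 d) (at 0)"
      using ser_derivative[OF d(1), of 0] r_pos has_vector_derivative_continuous[of "\<lambda>t. ser t d"]
      by (auto simp: isCont_def continuous_within)
    then have "eventually (\<lambda>t. dist (ser t d) d < e / 3) (at 0)"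
      using e by (intro tendstoD) (auto simp: ser_0)
    moreover have "eventually (\<lambda>t. \<bar>t\<bar> < r) (at 0)"
      using r_pos by (auto simp: eventually_at intro!: exI[of _ r])
    ultimately show "eventually (\<lambda>t. dist (evol t x) x < e) (at 0)"
    proof eventually_elim
      case (elim t)
      have "dist (evol t x) (evol t d) = dist x d"
        using unitary_norm[OF unit, of t "x - d"] unitary_bounded_linear[OF unit, of t]
        by (simp add: dist_norm linear_diff bounded_linear.linear)
      moreover have "evol t d = ser t d" using elim d(1) by (simp add: evol_small loc_ser)
      moreover have "dist (evol t x) x \<le> dist (evol t x) (evol t d) + dist (evol t d) d + dist d x"
        by (meson add_right_mono dist_triangle order_trans)
      ultimately show ?case using elim d(2) by (simp add: dist_commute)
    qed
  qed
  have "continuous_on UNIV (\<lambda>t. evol t x)" for x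
    unfolding continuous_on_def
  proof
    fix t :: real
    have "((\<lambda>h. evol t (evol h x)) \<longlongrightarrow> evol t x) (at 0)"
      by (rule bounded_linear.tendsto[OF unitary_bounded_linear[OF unit] at0])
    then have "((\<lambda>h. evol (t + h) x) \<longlongrightarrow> evol t x) (at 0)" by (simp add: add)
    then show "((\<lambda>t. evol t x) \<longlongrightarrow> evol t x) (at t)"
      by (simp add: LIM_offset_zero_iff)
  qed
  then show ?thesis using unit add zero by (simp add: unitary_group_def)
qed

lemma evol_ser: "x \<in> D \<Longrightarrow> \<bar>t\<bar> < r \<Longrightarrow> evol t x = ser t x"
  by (simp add: evol_small loc_ser)

lemma T_in_generator: "x \<in> D \<Longrightarrow> (x, T x) \<in> self_adjoint_generator evol"
proof -
  assume x: "x \<in> D"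
  have "((\<lambda>t. ser t x) has_vector_derivative \<i> *\<^sub>C T x) (at 0)"
    using ser_derivative[OF x, of 0] r_pos x by (simp add: ser_0 T_D)
  then have "((\<lambda>t. evol t x) has_vector_derivative \<i> *\<^sub>C T x) (at 0)"
    by (rule has_vector_derivative_transform_within_open[where S = "{-r<..<r}"])
      (use r_pos x in \<open>auto simp: evol_ser\<close>)
  then show ?thesis by (simp add: self_adjoint_generator_def)
qed

text \<open>
  The average \<open>(1/e) \<integral>\<^sub>0\<^sup>e U\<^sub>s d ds\<close> of the orbit of \<open>d \<in> D\<close> is given by an explicit power series,
  whose partial sums put it into the domain of the closure of \<open>T\<close>. Such averages approximate
  every point of the graph of the generator.
\<close>

lemma average_in_closure:
  assumes d: "d \<in> D" and e: "0 < e" "e < r"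
  shows "\<exists>w. (w, (- \<i> / e) *\<^sub>C (evol e d - d)) \<in> closure {(x, T x) |x. x \<in> D} \<and>
     (\<forall>b. (\<forall>s\<in>{0..e}. norm (evol s d - d) \<le> b) \<longrightarrow> norm (w - d) \<le> b)"
proof -
  \<comment> \<open>The leading zero makes the series of \<open>q\<close> an antiderivative: its
    derivative is \<i> times the orbit of \<open>d\<close>, and it vanishes at 0. Dividing by \<i> e
    gives the average \<open>w\<close>.\<close>
  define q where "q k = (case k of 0 \<Rightarrow> 0 | Suc k \<Rightarrow> (T ^^ k) d)" for k
  have summ: "summable (\<lambda>k. \<bar>s\<bar> ^ k / fact k * norm (q k))" if "\<bar>s\<bar> < r" for s
  proof -
    have "summable (\<lambda>k. \<bar>s\<bar> ^ Suc k / fact (Suc k) * norm (q (Suc k)))"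
    proof (rule summable_comparison_test)
      have "\<bar>s\<bar> ^ Suc n / fact (Suc n) * norm (q (Suc n)) \<le> \<bar>s\<bar> * (\<bar>s\<bar> ^ n / fact n * norm ((T ^^ n) d))" for n
      proof -
        have "(fact n :: real) \<le> fact (Suc n)" by (rule fact_mono) simp
        then have "\<bar>s\<bar> ^ Suc n / fact (Suc n) \<le> \<bar>s\<bar> ^ Suc n / fact n" by (intro divide_left_mono) auto
        then have "\<bar>s\<bar> ^ Suc n / fact (Suc n) * norm (q (Suc n)) \<le> \<bar>s\<bar> ^ Suc n / fact n * norm (q (Suc n))"
          by (rule mult_right_mono) simp
        then show ?thesis by (simp add: q_def)
      qed
      then show "\<exists>N. \<forall>n\<ge>N. norm (\<bar>s\<bar> ^ Suc n / fact (Suc n) * norm (q (Suc n)))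
          \<le> \<bar>s\<bar> * (\<bar>s\<bar> ^ n / fact n * norm ((T ^^ n) d))" by (simp del: fact_Suc power_Suc)
      show "summable (\<lambda>n. \<bar>s\<bar> * (\<bar>s\<bar> ^ n / fact n * norm ((T ^^ n) d)))"
        by (intro summable_mult analytic d that)
    qed
    then show ?thesis by (rule summable_Suc_iff[THEN iffD1])
  qed
  define w where "w = (- \<i> / e) *\<^sub>C exp_series q e"
  have "(w, (- \<i> / e) *\<^sub>C (evol e d - d)) \<in> closure {(x, T x) |x. x \<in> D}"
    unfolding closure_sequential
  proof (intro exI conjI allI)
    define p where "p N = (\<Sum>k<N. expc k e *\<^sub>C q k)" for N
    have qD: "q k \<in> D" for k using d D_scale[of d 0] by (auto simp: q_def pow_D split: nat.split)
    have "p N \<in> D \<and> T (p N) = (\<Sum>k<N. expc k e *\<^sub>C T (q k))" for N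
    proof (induction N)
      case 0
      then show ?case using D_scale[OF d, of 0] T_scale[OF d, of 0] by (simp add: p_def)
    next
      case (Suc N)
      then show ?case
        using qD[of N] by (simp add: p_def D_add D_scale T_add T_scale)
    qed
    then have pD: "p N \<in> D" and Tp: "T (p N) = (\<Sum>k<N. expc k e *\<^sub>C T (q k))" for N by auto
    show "((- \<i> / e) *\<^sub>C p (Suc N), T ((- \<i> / e) *\<^sub>C p (Suc N))) \<in> {(x, T x) |x. x \<in> D}" for N
      using pD D_scale by blast
    have "p \<longlonglongrightarrow> exp_series q e"
      using exp_series_sums[OF summ, of e] e by (simp add: p_def[abs_def] sums_def)
    then have 1: "(\<lambda>N. (- \<i> / e) *\<^sub>C p (Suc N)) \<longlonglongrightarrow> w"
      unfolding w_def by (intro bounded_linear.tendsto[OF bounded_linear_scaleC] LIMSEQ_Suc)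
    have "T 0 = 0" using T_scale[OF d, of 0] by simp
    \<comment> \<open>\<open>T\<close> maps \<open>q k\<close> to the k-th iterate of
      \<open>d\<close> for k > 0 but \<open>q 0\<close> to 0, so exactly the zeroth term
      \<open>d\<close> is missing.\<close>
    have "T (p (Suc N)) = (\<Sum>k<Suc N. expc k e *\<^sub>C (T ^^ k) d) - d" for N
      unfolding Tp sum.lessThan_Suc_shift using \<open>T 0 = 0\<close> by (simp add: q_def expc_def)
    moreover have "(\<lambda>N. \<Sum>k<Suc N. expc k e *\<^sub>C (T ^^ k) d) \<longlonglongrightarrow> evol e d"
      using ser_sums[OF d, of e] e d unfolding sums_def by (intro LIMSEQ_Suc) (simp add: evol_ser)
    ultimately have "(\<lambda>N. T (p (Suc N))) \<longlonglongrightarrow> evol e d - d"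
      by (auto intro: tendsto_diff)
    then have "(\<lambda>N. T ((- \<i> / e) *\<^sub>C p (Suc N))) \<longlonglongrightarrow> (- \<i> / e) *\<^sub>C (evol e d - d)"
      unfolding T_scale[OF pD] by (rule bounded_linear.tendsto[OF bounded_linear_scaleC])
    with 1 show "(\<lambda>N. ((- \<i> / e) *\<^sub>C p (Suc N), T ((- \<i> / e) *\<^sub>C p (Suc N))))
        \<longlonglongrightarrow> (w, (- \<i> / e) *\<^sub>C (evol e d - d))"
      by (rule tendsto_Pair)
  qed
  moreover have "norm (w - d) \<le> b" if b: "\<forall>s\<in>{0..e}. norm (evol s d - d) \<le> b" for b
  proof -
    \<comment> \<open>\<open>J s\<close> is the integral of the orbit from 0 to s. The mean value
      inequality then bounds the distance of its average from \<open>d\<close>.\<close>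
    define J where "J s = (- \<i>) *\<^sub>C exp_series q s" for s
    have J: "(J has_vector_derivative evol s d) (at s)" if "s \<in> {0..e}" for s
    proof -
      have "\<bar>s\<bar> < r" using that e by auto
      then have "(exp_series q has_vector_derivative \<i> *\<^sub>C exp_series (\<lambda>k. q (Suc k)) s) (at s)"
        using summ analytic[OF d] by (intro exp_series_derivative[where r = r]) (auto simp: q_def)
      then have "(J has_vector_derivative (- \<i>) *\<^sub>C \<i> *\<^sub>C exp_series (\<lambda>k. q (Suc k)) s) (at s)"
        unfolding J_def[abs_def] by (rule bounded_linear.has_vector_derivative[OF bounded_linear_scaleC])
      then show ?thesis using \<open>\<bar>s\<bar> < r\<close> d by (simp add: q_def evol_ser ser_def)
    qed
    have "norm (J e - J 0 - (e - 0) *\<^sub>R evol 0 d) \<le> norm (e - 0) * b"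
      by (rule vector_differentiable_bound_linearization[where S = "{0..e}"])
        (use J b e r_pos d in \<open>auto simp: has_vector_derivative_at_within closed_segment_eq_real_ivl evol_ser ser_0\<close>)
    moreover have "J 0 = 0" by (simp add: J_def exp_series_0 q_def)
    moreover have "evol 0 d = d" using r_pos d by (simp add: evol_ser ser_0)
    moreover have "J e = e *\<^sub>R w" using e by (simp add: J_def w_def flip: scaleC_of_real)
    ultimately have "norm (e *\<^sub>R (w - d)) \<le> e * b" using e by (simp add: scaleR_diff_right)
    then show ?thesis using e by simp
  qed
  ultimately show ?thesis by blast
qed

text \<open>One inclusion is closedness of the generator. The other says that \<open>D\<close> is a
  core, that is, that \<open>T\<close> is essentially self-adjoint on \<open>D\<close>.\<close>

lemma generator_evol: "self_adjoint_generator evol = closure {(x, T x) |x. x \<in> D}"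
proof
  show "closure {(x, T x) |x. x \<in> D} \<subseteq> self_adjoint_generator evol"
    by (rule closure_minimal[OF _ closed_generator[OF unitary_group_evol]]) (auto intro: T_in_generator)
  show "self_adjoint_generator evol \<subseteq> closure {(x, T x) |x. x \<in> D}"
  proof clarify
    fix x y assume xy: "(x, y) \<in> self_adjoint_generator evol"
    have "\<exists>p\<in>closure {(x, T x) |x. x \<in> D}. dist p (x, y) < \<epsilon>" if \<epsilon>: "\<epsilon> > 0" for \<epsilon>
    proof -
      \<comment> \<open>The first component will contribute an error of at most 4 \<eta> and the
        second at most 3 \<eta>, in total less than \<epsilon>.\<close>
      define \<eta> where "\<eta> = \<epsilon> / 8"
      have \<eta>: "\<eta> > 0" using \<epsilon> by (simp add: \<eta>_def)
      have "((\<lambda>t. evol t x) has_derivative (\<lambda>t. t *\<^sub>R \<i> *\<^sub>C y)) (at 0)"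
        using xy by (simp add: self_adjoint_generator_def has_vector_derivative_def)
      then obtain d1 where d1: "d1 > 0"
        "\<And>t. \<bar>t\<bar> < d1 \<Longrightarrow> norm (evol t x - evol 0 x - t *\<^sub>R \<i> *\<^sub>C y) \<le> \<eta> * \<bar>t\<bar>"
        unfolding has_derivative_at_alt using \<eta> by auto
      have "isCont (\<lambda>t. evol t x) 0"
        using ug_cont[OF unitary_group_evol] by (simp add: continuous_on_eq_continuous_at)
      then obtain d2 where d2: "d2 > 0" "\<And>t. \<bar>t\<bar> < d2 \<Longrightarrow> dist (evol t x) (evol 0 x) < \<eta>"
        unfolding continuous_at_eps_delta using \<eta> by auto
      define e where "e = min (min d1 d2) (min r 1) / 2"
      have e: "0 < e" "e < d1" "e < d2" "e < r" "e < 1"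
        using d1(1) d2(1) r_pos by (auto simp: e_def)
      have "e * \<eta> > 0" using e \<eta> by simp
      \<comment> \<open>The approximating vector is chosen after the time \<open>e\<close> and
        within e \<eta>, because the difference quotient divides its error by
        \<open>e\<close>.\<close>
      then obtain d where d: "d \<in> D" "dist d x < e * \<eta>"
        using dense closure_approachable[of x D] by auto
      have "e * \<eta> \<le> \<eta>" using e \<eta> by simp
      then have dx: "norm (d - x) \<le> \<eta>" "norm (d - x) \<le> e * \<eta>" using d(2) by (auto simp: dist_norm)
      note ug = unitary_group_evol
      have move: "norm (evol s d - d - (evol s x - x)) \<le> 2 * norm (d - x)" for s
      proof -
        have "evol s d - d - (evol s x - x) = evol s (d - x) - (d - x)" by (simp add: ug_diff[OF ug])
        also have "norm \<dots> \<le> norm (evol s (d - x)) + norm (d - x)" by (rule norm_triangle_ineq4)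
        finally show ?thesis by (simp add: unitary_norm[OF ug_unitary[OF ug]])
      qed
      obtain w where w: "(w, (- \<i> / e) *\<^sub>C (evol e d - d)) \<in> closure {(x, T x) |x. x \<in> D}"
        "\<And>b. (\<forall>s\<in>{0..e}. norm (evol s d - d) \<le> b) \<Longrightarrow> norm (w - d) \<le> b"
        using average_in_closure[OF d(1) e(1,4)] by blast
      have "norm (w - d) \<le> 3 * \<eta>"
      proof (intro w(2) ballI)
        fix s assume "s \<in> {0..e}"
        then have "norm (evol s x - x) < \<eta>" using d2(2)[of s] e by (simp add: dist_norm ug_0[OF ug])
        then show "norm (evol s d - d) \<le> 3 * \<eta>"
          using move[of s] dx(1) norm_triangle_sub[of "evol s d - d" "evol s x - x"] by linarith
      qed
      then have "dist w x \<le> 4 * \<eta>"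
        using dx norm_triangle_ineq[of "w - d" "d - x"] by (simp add: dist_norm)
      moreover have "dist ((- \<i> / e) *\<^sub>C (evol e d - d)) y \<le> 3 * \<eta>"
      proof -
        have "(- \<i> / e) *\<^sub>C e *\<^sub>R \<i> *\<^sub>C y = y"
          using e by (simp flip: scaleC_of_real)
        then have "(- \<i> / e) *\<^sub>C (evol e d - d) - y = (- \<i> / e) *\<^sub>C (evol e d - d - e *\<^sub>R \<i> *\<^sub>C y)"
          by (simp add: scaleC_diff_right)
        moreover have "norm (evol e d - d - e *\<^sub>R \<i> *\<^sub>C y) \<le> 3 * (e * \<eta>)"
          using move[of e] dx(2) d1(2)[of e] e
            norm_triangle_ineq[of "evol e d - d - (evol e x - x)" "evol e x - x - e *\<^sub>R \<i> *\<^sub>C y"]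
          by (simp add: ug_0[OF ug] mult.commute)
        ultimately show ?thesis using e by (simp add: dist_norm norm_divide divide_simps mult_ac)
      qed
      ultimately have "dist (w, (- \<i> / e) *\<^sub>C (evol e d - d)) (x, y) \<le> 7 * \<eta>"
        unfolding dist_Pair_Pair by (intro order_trans[OF sqrt_sum_squares_le_sum]) auto
      then show ?thesis using w(1) \<epsilon> by (intro bexI[of _ "(w, (- \<i> / e) *\<^sub>C (evol e d - d))"]) (auto simp: \<eta>_def)
    qed
    then have "(x, y) \<in> closure (closure {(x, T x) |x. x \<in> D})"
      unfolding closure_approachable by blast
    then show "(x, y) \<in> closure {(x, T x) |x. x \<in> D}" by simp
  qed
qed

text \<open>The description in \<open>exp_iH\<close> is settled by uniqueness, which applies because
  the domain of the generator contains the dense set \<open>D\<close>.\<close>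

lemma exp_iH_eq_evol: "exp_iH (closure {(x, T x) |x. x \<in> D}) = evol"
  unfolding exp_iH_def
proof (rule the_equality)
  show "unitary_group evol \<and> self_adjoint_generator evol = closure {(x, T x) |x. x \<in> D}"
    by (simp add: unitary_group_evol generator_evol)
  fix V assume V: "unitary_group V \<and> self_adjoint_generator V = closure {(x, T x) |x. x \<in> D}"
  then have gen: "self_adjoint_generator V = self_adjoint_generator evol" by (simp add: generator_evol)
  have "D \<subseteq> fst ` self_adjoint_generator V"
    unfolding gen using T_in_generator by force
  then have "closure (fst ` self_adjoint_generator V) = UNIV"
    using closure_mono[of D] dense by auto
  then show "V = evol"
    using V gen by (intro unitary_group_unique unitary_group_evol) auto
qed

end

section \<open>Creation and annihilation operators on coefficient families\<close>

type_synonym 'n cfam = "('n \<Rightarrow> nat) \<Rightarrow> complex"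

section \<open>Total particle number and coefficient bounds\<close>

definition deg :: "('n::finite \<Rightarrow> nat) \<Rightarrow> nat" where
  "deg k = (\<Sum>i\<in>UNIV. k i)"

lemma deg_upd: "deg (k(i := m)) + k i = deg k + m"
proof -
  have "deg k = k i + (\<Sum>j\<in>UNIV - {i}. k j)" for k :: "'a \<Rightarrow> nat"
    unfolding deg_def by (rule sum.remove) auto
  from this[of k] this[of "k(i := m)"] show ?thesis by simp
qed

lemma le_deg: "k i \<le> deg k"
  unfolding deg_def by (rule member_le_sum) auto

lemma finite_deg_le: "finite {k :: 'n::finite \<Rightarrow> nat. deg k \<le> N}"
proof -
  have "finite (PiE (UNIV :: 'n set) (\<lambda>_. {..N}))" by (intro finite_PiE) auto
  moreover have "{k :: 'n \<Rightarrow> nat. deg k \<le> N} \<subseteq> PiE UNIV (\<lambda>_. {..N})"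
    using le_deg order_trans by (fastforce simp: PiE_def)
  ultimately show ?thesis by (rule rev_finite_subset)
qed

abbreviation fins :: "('k \<Rightarrow> complex) \<Rightarrow> bool" where
  "fins f \<equiv> finite {k. f k \<noteq> 0}"

text \<open>The l1 norm dominates the Hilbert norm and suits ladder operators, which permute basis
  vectors injectively up to weights: each estimate is a reindexing of a finite sum.\<close>

definition norm1 :: "('k \<Rightarrow> complex) \<Rightarrow> real" where
  "norm1 f = (\<Sum>k | f k \<noteq> 0. cmod (f k))"

lemma norm1_eq: "finite S \<Longrightarrow> {k. f k \<noteq> 0} \<subseteq> S \<Longrightarrow> norm1 f = (\<Sum>k\<in>S. cmod (f k))"
  unfolding norm1_def by (rule sum.mono_neutral_left) auto

lemma norm1_nonneg: "0 \<le> norm1 f"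
  by (simp add: norm1_def sum_nonneg)

lemma norm_Abs_le_norm1:
  assumes "fins f"
  shows "norm (Abs_ell2 f) \<le> norm1 f"
proof -
  have "norm (Abs_ell2 f) = sqrt (\<Sum>\<^sub>\<infinity>k\<in>{k. f k \<noteq> 0}. (cmod (f k))\<^sup>2)"
    unfolding norm_ell2_def coeff_Abs_finite[OF assms] by (intro arg_cong[where f = sqrt] infsum_cong_neutral) auto
  also have "\<dots> = L2_set (\<lambda>k. cmod (f k)) {k. f k \<noteq> 0}"
    using assms by (simp add: L2_set_def)
  also have "\<dots> \<le> norm1 f" unfolding norm1_def by (rule L2_set_le_sum) auto
  finally show ?thesis .
qed

text \<open>Ladder operators are unbounded, but the weights they produce are controlled by the
  particle number, so the two bounds have to be propagated together.\<close>

definition fbound :: "nat \<Rightarrow> real \<Rightarrow> 'n::finite cfam \<Rightarrow> bool" where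
  "fbound N b f \<longleftrightarrow> (\<forall>k. f k \<noteq> 0 \<longrightarrow> deg k \<le> N) \<and> norm1 f \<le> b"

lemma fbound_fins: "fbound N b f \<Longrightarrow> fins f"
  by (rule finite_subset[OF _ finite_deg_le[of N]]) (auto simp: fbound_def)

lemma fbound_exists:
  assumes "fins f"
  obtains N where "fbound N (norm1 f) f"
proof
  show "fbound (Max (deg ` {k. f k \<noteq> 0})) (norm1 f) f"
    using assms by (auto simp: fbound_def intro!: Max_ge)
qed

lemma fbound_norm1:
  assumes "\<forall>k. f k \<noteq> 0 \<longrightarrow> deg k \<le> N"
  shows "norm1 f = (\<Sum>k | deg k \<le> N. cmod (f k))"
  using assms by (intro norm1_eq finite_deg_le) auto

lemma fbound_mono: "fbound N b f \<Longrightarrow> N \<le> N' \<Longrightarrow> b \<le> b' \<Longrightarrow> fbound N' b' f"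
  by (fastforce simp: fbound_def)

lemma fbound_add:
  assumes "fbound N b f" "fbound N c g"
  shows "fbound N (b + c) (\<lambda>k. f k + g k)"
proof -
  have *: "\<forall>k. f k + g k \<noteq> 0 \<longrightarrow> deg k \<le> N"
    using assms unfolding fbound_def by (metis add_0)
  have "norm1 (\<lambda>k. f k + g k) \<le> (\<Sum>k | deg k \<le> N. cmod (f k) + cmod (g k))"
    unfolding fbound_norm1[OF *] by (intro sum_mono norm_triangle_ineq)
  also have "\<dots> = norm1 f + norm1 g"
    using assms by (simp add: sum.distrib fbound_norm1[of f N] fbound_norm1[of g N] fbound_def)
  finally show ?thesis using assms * by (auto simp: fbound_def)
qed

lemma fbound_scale: "fbound N b f \<Longrightarrow> fbound N (cmod c * b) (\<lambda>k. c * f k)"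
proof -
  assume f: "fbound N b f"
  then have "norm1 (\<lambda>k. c * f k) = cmod c * norm1 f"
    by (simp add: fbound_def fbound_norm1[of f N] fbound_norm1[of "\<lambda>k. c * f k" N] norm_mult sum_distrib_left)
  then show ?thesis using f by (auto simp: fbound_def intro: mult_left_mono)
qed

lemma fbound_sum:
  assumes "\<And>i. i \<in> I \<Longrightarrow> fbound N (b i) (f i)"
  shows "fbound N (\<Sum>i\<in>I. b i) (\<lambda>k. \<Sum>i\<in>I. f i k)"
  using assms
proof (induction I rule: infinite_finite_induct)
  case (insert x F)
  then show ?case using fbound_add[of N "b x" "f x"] by simp
qed (auto simp: fbound_def norm1_def)

lemma fbound_diff:
  assumes "fbound N b f" "fbound N c g"
  shows "fbound N (b + c) (\<lambda>k. f k - g k)"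
  using fbound_add[OF assms(1) fbound_scale[OF assms(2), of "-1"]] by simp

text \<open>Although annihilation lowers the degree, the bound is given the same form as for
  creation, so that one lemma covers all quadratic terms.\<close>

lemma fbound_annih:
  assumes "fbound N b f"
  shows "fbound (Suc N) (sqrt (Suc N) * b) (annih i f)"
proof -
  define S where "S = {k. annih i f k \<noteq> 0}"
  define up where "up k = k(i := k i + 1)" for k :: "'a \<Rightarrow> nat"
  have S: "f (up k) \<noteq> 0" if "k \<in> S" for k using that by (auto simp: S_def annih_def up_def)
  have deg_up: "deg (up k) = Suc (deg k)" for k using deg_upd[of k i "k i + 1"] by (simp add: up_def)
  have N: "deg (up k) \<le> N" if "k \<in> S" for k using S[OF that] assms by (simp add: fbound_def)
  have inj: "inj_on up S" by (auto simp: inj_on_def up_def fun_eq_iff split: if_splits)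
  have "norm1 (annih i f) = (\<Sum>k\<in>S. sqrt (real (k i + 1)) * cmod (f (up k)))"
    by (simp add: norm1_def S_def annih_def norm_mult up_def)
  also have "\<dots> \<le> (\<Sum>k\<in>S. sqrt (Suc N) * cmod (f (up k)))"
  proof (intro sum_mono mult_right_mono)
    fix k assume "k \<in> S"
    have "k i \<le> N" using N[OF \<open>k \<in> S\<close>] le_deg[of k i] by (simp add: deg_up)
    then show "sqrt (real (k i + 1)) \<le> sqrt (Suc N)" by simp
  qed auto
  also have "\<dots> = sqrt (Suc N) * (\<Sum>k\<in>up ` S. cmod (f k))"
    by (simp add: sum.reindex[OF inj] sum_distrib_left)
  also have "\<dots> \<le> sqrt (Suc N) * b"
  proof (rule mult_left_mono)
    have "(\<Sum>k\<in>up ` S. cmod (f k)) \<le> norm1 f"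
      unfolding norm1_def using fbound_fins[OF assms] S by (intro sum_mono2) auto
    then show "(\<Sum>k\<in>up ` S. cmod (f k)) \<le> b" using assms by (simp add: fbound_def)
  qed simp
  finally have "norm1 (annih i f) \<le> sqrt (Suc N) * b" .
  moreover have "deg k \<le> Suc N" if "annih i f k \<noteq> 0" for k
    using N[of k] that by (simp add: S_def deg_up)
  ultimately show ?thesis by (simp add: fbound_def)
qed

lemma fbound_creat:
  assumes "fbound N b f"
  shows "fbound (Suc N) (sqrt (Suc N) * b) (creat i f)"
proof -
  define S where "S = {k. creat i f k \<noteq> 0}"
  define dn where "dn k = k(i := k i - 1)" for k :: "'a \<Rightarrow> nat"
  have S: "f (dn k) \<noteq> 0" "k i \<noteq> 0" if "k \<in> S" for k
    using that by (auto simp: S_def creat_def dn_def split: if_splits)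
  have deg_dn: "Suc (deg (dn k)) = deg k" if "k \<in> S" for k
    using deg_upd[of k i "k i - 1"] S[OF that] by (simp add: dn_def)
  have N: "deg (dn k) \<le> N" if "k \<in> S" for k using S[OF that] assms by (simp add: fbound_def)
  have inj: "inj_on dn S"
  proof (rule inj_onI)
    fix k l assume kl: "k \<in> S" "l \<in> S" "dn k = dn l"
    have "k j = l j" for j
      using fun_cong[OF kl(3), of j] S(2)[OF kl(1)] S(2)[OF kl(2)] by (auto simp: dn_def split: if_splits)
    then show "k = l" by auto
  qed
  have "norm1 (creat i f) = (\<Sum>k\<in>S. sqrt (real (k i)) * cmod (f (dn k)))"
    unfolding norm1_def S_def[symmetric] by (rule sum.cong) (auto simp: S(2) creat_def norm_mult dn_def)
  also have "\<dots> \<le> (\<Sum>k\<in>S. sqrt (Suc N) * cmod (f (dn k)))"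
  proof (intro sum_mono mult_right_mono)
    fix k assume "k \<in> S"
    have "k i \<le> Suc N" using N[OF \<open>k \<in> S\<close>] le_deg[of k i] deg_dn[OF \<open>k \<in> S\<close>] by simp
    then show "sqrt (real (k i)) \<le> sqrt (Suc N)" by simp
  qed auto
  also have "\<dots> = sqrt (Suc N) * (\<Sum>k\<in>dn ` S. cmod (f k))"
    by (simp add: sum.reindex[OF inj] sum_distrib_left)
  also have "\<dots> \<le> sqrt (Suc N) * b"
  proof (rule mult_left_mono)
    have "(\<Sum>k\<in>dn ` S. cmod (f k)) \<le> norm1 f"
      unfolding norm1_def using fbound_fins[OF assms] S by (intro sum_mono2) auto
    then show "(\<Sum>k\<in>dn ` S. cmod (f k)) \<le> b" using assms by (simp add: fbound_def)
  qed simp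
  finally have "norm1 (creat i f) \<le> sqrt (Suc N) * b" .
  moreover have "deg k \<le> Suc N" if "creat i f k \<noteq> 0" for k
    using N[of k] deg_dn[of k] that by (simp add: S_def)
  ultimately show ?thesis by (simp add: fbound_def)
qed

section \<open>Linearity and commutation relations of the ladder operators\<close>

lemma annih_add: "annih i (\<lambda>k. f k + g k) = (\<lambda>k. annih i f k + annih i g k)"
  and creat_add: "creat i (\<lambda>k. f k + g k) = (\<lambda>k. creat i f k + creat i g k)"
  and annih_diff: "annih i (\<lambda>k. f k - g k) = (\<lambda>k. annih i f k - annih i g k)"
  and creat_diff: "creat i (\<lambda>k. f k - g k) = (\<lambda>k. creat i f k - creat i g k)"
  and annih_scale: "annih i (\<lambda>k. c * f k) = (\<lambda>k. c * annih i f k)"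
  and creat_scale: "creat i (\<lambda>k. c * f k) = (\<lambda>k. c * creat i f k)"
  by (simp_all add: annih_def creat_def fun_eq_iff algebra_simps)

lemma annih_sum: "annih i (\<lambda>k. \<Sum>j\<in>J. F j k) = (\<lambda>k. \<Sum>j\<in>J. annih i (F j) k)"
  and creat_sum: "creat i (\<lambda>k. \<Sum>j\<in>J. F j k) = (\<lambda>k. \<Sum>j\<in>J. creat i (F j) k)"
  by (simp_all add: annih_def creat_def fun_eq_iff sum_distrib_left)

lemma annih_annih: "annih i (annih j f) = annih j (annih i f)"
  by (cases "i = j") (auto simp: annih_def fun_eq_iff fun_upd_twist)

lemma creat_creat: "creat i (creat j f) = creat j (creat i f)"
  by (cases "i = j") (auto simp: creat_def fun_eq_iff fun_upd_twist)

text \<open>The canonical commutation relation. Ladder operators are defined coefficientwise, so it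
  is an identity for arbitrary families.\<close>

lemma annih_creat: "annih i (creat j f) = (\<lambda>k. creat j (annih i f) k + (if i = j then f k else 0))"
proof (cases "i = j")
  case True
  show ?thesis
  proof
    fix k
    show "annih i (creat j f) k = creat j (annih i f) k + (if i = j then f k else 0)"
    proof (cases "k j")
      case 0
      then show ?thesis using True by (simp add: annih_def creat_def fun_upd_idem)
    next
      case (Suc m)
      have sq: "complex_of_real (sqrt x) * complex_of_real (sqrt x) = of_real x" if "x \<ge> 0" for x
        using that by (simp flip: of_real_mult)
      show ?thesis
        using True Suc by (simp add: annih_def creat_def fun_upd_idem algebra_simps sq)
    qed
  qed
qed (auto simp: annih_def creat_def fun_eq_iff fun_upd_twist)

text \<open>The inner product on raw families. If the left one has finite support, the right one may
  be anything, in particular an evolved vector.\<close>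

definition fip :: "('k \<Rightarrow> complex) \<Rightarrow> ('k \<Rightarrow> complex) \<Rightarrow> complex" where
  "fip f g = (\<Sum>\<^sub>\<infinity>k. cnj (f k) * g k)"

lemma cinner_fip: "cinner x y = fip (coeff x) (coeff y)"
  by (simp add: cinner_def fip_def)

lemma cnj_fip: "cnj (fip f g) = fip g f"
  unfolding fip_def infsum_cnj[symmetric] by (rule infsum_cong) simp

lemma fip_summable: "fins f \<Longrightarrow> (\<lambda>k. cnj (f k) * g k) summable_on UNIV"
  by (rule summable_on_cong_neutral[where T = "{k. f k \<noteq> 0}", THEN iffD2]) auto

lemma fip_scale_right: "fip f (\<lambda>k. c * g k) = c * fip f g"
  unfolding fip_def mult.left_commute[of _ c] by (rule infsum_cmult_right')

lemma fip_scale_left: "fip (\<lambda>k. c * f k) g = cnj c * fip f g"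
  using fip_scale_right[of g c f] cnj_fip by (metis complex_cnj_mult)

lemma fip_add_right: "fins f \<Longrightarrow> fip f (\<lambda>k. g k + h k) = fip f g + fip f h"
  unfolding fip_def distrib_left by (intro infsum_add fip_summable)

lemma fip_add_left: "fins f \<Longrightarrow> fins g \<Longrightarrow> fip (\<lambda>k. f k + g k) h = fip f h + fip g h"
  unfolding fip_def complex_cnj_add distrib_right by (intro infsum_add fip_summable)

lemma fip_diff_right: "fins f \<Longrightarrow> fip f (\<lambda>k. g k - h k) = fip f g - fip f h"
  using fip_add_right[of f g "\<lambda>k. (-1) * h k"] fip_scale_right[of f "-1" h] by simp

lemma fip_diff_left: "fins f \<Longrightarrow> fins g \<Longrightarrow> fip (\<lambda>k. f k - g k) h = fip f h - fip g h"
  using fip_add_left[of f "\<lambda>k. (-1) * g k" h] fip_scale_left[of "-1" g h] by simp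

lemma fip_sum_right: "fins f \<Longrightarrow> fip f (\<lambda>k. \<Sum>j\<in>J. g j k) = (\<Sum>j\<in>J. fip f (g j))"
  by (induction J rule: infinite_finite_induct) (simp_all add: fip_add_right, simp_all add: fip_def)

lemma fins_add: "fins f \<Longrightarrow> fins g \<Longrightarrow> fins (\<lambda>k. f k + g k)"
  by (rule finite_subset[of _ "{k. f k \<noteq> 0} \<union> {k. g k \<noteq> 0}"]) auto

lemma fins_scale: "fins f \<Longrightarrow> fins (\<lambda>k. c * f k)"
  by (rule finite_subset[of _ "{k. f k \<noteq> 0}"]) auto

lemma fins_diff: "fins f \<Longrightarrow> fins g \<Longrightarrow> fins (\<lambda>k. f k - g k)"
  by (rule finite_subset[of _ "{k. f k \<noteq> 0} \<union> {k. g k \<noteq> 0}"]) auto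

lemma fins_sum: "(\<And>j. j \<in> J \<Longrightarrow> fins (f j)) \<Longrightarrow> fins (\<lambda>k. \<Sum>j\<in>J. f j k)"
  by (induction J rule: infinite_finite_induct) (auto intro: fins_add)

lemma fip_sum_left:
  "(\<And>j. j \<in> J \<Longrightarrow> fins (f j)) \<Longrightarrow> fip (\<lambda>k. \<Sum>j\<in>J. f j k) g = (\<Sum>j\<in>J. fip (f j) g)"
  by (induction J rule: infinite_finite_induct) (simp_all add: fip_add_left fins_sum, simp_all add: fip_def)

lemma fins_annih: "fins f \<Longrightarrow> fins (annih i f)" and fins_creat: "fins f \<Longrightarrow> fins (creat i f)"
  for f :: "'n::finite cfam"
  using fbound_exists fbound_fins fbound_annih fbound_creat by metis+

text \<open>Raising mode i reindexes one sum into the other term by term. The occupation numbers not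
  reached have \<open>k i = 0\<close>, where \<open>creat\<close> vanishes.\<close>

lemma fip_annih: "fip f (annih i g) = fip (creat i f) g"
proof -
  define up where "up k = k(i := k i + 1)" for k :: "'a \<Rightarrow> nat"
  have inj: "inj up" by (auto simp: inj_def up_def fun_eq_iff split: if_splits)
  have up: "k \<in> range up" if "k i \<noteq> 0" for k
    using that by (intro image_eqI[of _ _ "k(i := k i - 1)"]) (auto simp: up_def)
  have "fip (creat i f) g = (\<Sum>\<^sub>\<infinity>k\<in>range up. cnj (creat i f k) * g k)"
    unfolding fip_def by (rule infsum_cong_neutral) (use up in \<open>auto simp: creat_def\<close>)
  also have "\<dots> = (\<Sum>\<^sub>\<infinity>k. cnj (creat i f (up k)) * g (up k))"
    by (subst infsum_reindex[OF inj]) (simp add: o_def)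
  also have "\<dots> = fip f (annih i g)"
    unfolding fip_def by (rule infsum_cong) (simp add: creat_def annih_def up_def fun_upd_idem)
  finally show ?thesis ..
qed

lemma fip_creat: "fip f (creat i g) = fip (annih i f) g"
  by (metis cnj_fip fip_annih)

section \<open>Quadratic Hamiltonians\<close>

lemma creat_annih: "creat j (annih i f) = (\<lambda>k. annih i (creat j f) k - (if i = j then f k else 0))"
  by (simp add: annih_creat)

lemma sum_UNIV_Plus:
  "(\<Sum>s\<in>UNIV. g (s :: 'a::finite + 'b::finite)) = (\<Sum>i\<in>UNIV. g (Inl i)) + (\<Sum>i\<in>UNIV. g (Inr i))"
  using sum.Plus[of "UNIV :: 'a set" "UNIV :: 'b set" g] by (simp add: o_def)

lemma sum_row_delta:
  fixes g :: "'a::finite \<Rightarrow> 'b::finite \<Rightarrow> complex"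
  shows "(\<Sum>i\<in>UNIV. \<Sum>j\<in>UNIV. if m = i then g i j else 0) = (\<Sum>j\<in>UNIV. g m j)"
proof -
  have "(\<Sum>j\<in>UNIV. if m = i then g i j else 0) = (if m = i then \<Sum>j\<in>UNIV. g i j else 0)" for i
    by simp
  then show ?thesis by simp
qed

section \<open>Commutators of ladder operators with each kind of term in the Hamiltonian\<close>

context
  fixes f :: "'n::finite cfam" and M :: "complex^'n^'n" and v :: "complex^'n"
begin

text \<open>Passing either of the two creation operators leaves a Kronecker delta, whence both
  \<open>M\<close> and its transpose in the extra term.\<close>

lemma annih_op_quad_creat_creat:
  "annih m (op_quad creat M creat f) k =
    op_quad creat M creat (annih m f) k + (\<Sum>j\<in>UNIV. (M $ m $ j + M $ j $ m) * creat j f k)"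
proof -
  have "annih m (op_quad creat M creat f) k = (\<Sum>i\<in>UNIV. \<Sum>j\<in>UNIV. M $ i $ j * creat i (creat j (annih m f)) k
      + (if m = j then M $ i $ j * creat i f k else 0) + (if m = i then M $ i $ j * creat j f k else 0))"
    unfolding op_quad_def[abs_def] annih_sum annih_scale annih_creat creat_add
    by (intro sum.cong refl) (auto simp: algebra_simps creat_def)
  also have "\<dots> = op_quad creat M creat (annih m f) k
      + (\<Sum>i\<in>UNIV. M $ i $ m * creat i f k) + (\<Sum>j\<in>UNIV. M $ m $ j * creat j f k)"
    unfolding sum.distrib op_quad_def
    by (simp add: sum_row_delta)
  finally show ?thesis by (simp add: distrib_right sum.distrib)
qed

lemma annih_op_quad_annih_annih: "annih m (op_quad annih M annih f) k = op_quad annih M annih (annih m f) k"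
  unfolding op_quad_def[abs_def] annih_sum annih_scale
  by (simp add: annih_annih[of m])

lemma annih_op_quad_creat_annih:
  "annih m (op_quad creat M annih f) k =
    op_quad creat M annih (annih m f) k + (\<Sum>j\<in>UNIV. M $ m $ j * annih j f k)"
proof -
  have "annih m (op_quad creat M annih f) k = (\<Sum>i\<in>UNIV. \<Sum>j\<in>UNIV. M $ i $ j * creat i (annih j (annih m f)) k
      + (if m = i then M $ i $ j * annih j f k else 0))"
    unfolding op_quad_def[abs_def] annih_sum annih_scale annih_creat annih_annih[of m]
    by (intro sum.cong refl) (auto simp: algebra_simps)
  also have "\<dots> = op_quad creat M annih (annih m f) k + (\<Sum>j\<in>UNIV. M $ m $ j * annih j f k)"
    unfolding sum.distrib op_quad_def
    by (simp add: sum_row_delta)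
  finally show ?thesis .
qed

lemma annih_op_lin_creat: "annih m (op_lin creat v f) k = op_lin creat v (annih m f) k + v $ m * f k"
proof -
  have "annih m (op_lin creat v f) k = (\<Sum>i\<in>UNIV. v $ i * creat i (annih m f) k + (if m = i then v $ i * f k else 0))"
    unfolding op_lin_def[abs_def] annih_sum annih_scale annih_creat
    by (intro sum.cong refl) (auto simp: algebra_simps)
  then show ?thesis by (simp add: sum.distrib op_lin_def)
qed

lemma annih_op_lin_annih: "annih m (op_lin annih v f) k = op_lin annih v (annih m f) k"
  unfolding op_lin_def[abs_def] annih_sum annih_scale by (simp add: annih_annih[of m])

lemma creat_op_quad_creat_creat: "creat m (op_quad creat M creat f) k = op_quad creat M creat (creat m f) k"
  unfolding op_quad_def[abs_def] creat_sum creat_scale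
  by (simp add: creat_creat[of m])

lemma creat_op_quad_annih_annih:
  "creat m (op_quad annih M annih f) k =
    op_quad annih M annih (creat m f) k - (\<Sum>j\<in>UNIV. (M $ m $ j + M $ j $ m) * annih j f k)"
proof -
  have "creat m (op_quad annih M annih f) k = (\<Sum>i\<in>UNIV. \<Sum>j\<in>UNIV. M $ i $ j * annih i (annih j (creat m f)) k
      - ((if m = j then M $ i $ j * annih i f k else 0) + (if m = i then M $ i $ j * annih j f k else 0)))"
    unfolding op_quad_def[abs_def] creat_sum creat_scale creat_annih annih_diff
    by (intro sum.cong refl) (auto simp: algebra_simps annih_def)
  also have "\<dots> = op_quad annih M annih (creat m f) k
      - ((\<Sum>i\<in>UNIV. M $ i $ m * annih i f k) + (\<Sum>j\<in>UNIV. M $ m $ j * annih j f k))"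
    unfolding sum_subtractf sum.distrib op_quad_def
    by (simp add: sum_row_delta)
  finally show ?thesis by (simp add: distrib_right sum.distrib)
qed

lemma creat_op_quad_creat_annih:
  "creat m (op_quad creat M annih f) k =
    op_quad creat M annih (creat m f) k - (\<Sum>i\<in>UNIV. M $ i $ m * creat i f k)"
proof -
  have "creat m (op_quad creat M annih f) k = (\<Sum>i\<in>UNIV. \<Sum>j\<in>UNIV. M $ i $ j * creat i (annih j (creat m f)) k
      - (if m = j then M $ i $ j * creat i f k else 0))"
    unfolding op_quad_def[abs_def] creat_sum creat_scale creat_creat[of m]
    unfolding creat_annih creat_diff
    by (intro sum.cong refl) (auto simp: algebra_simps creat_def)
  also have "\<dots> = op_quad creat M annih (creat m f) k - (\<Sum>i\<in>UNIV. M $ i $ m * creat i f k)"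
    unfolding sum_subtractf op_quad_def by simp
  finally show ?thesis .
qed

lemma creat_op_lin_annih: "creat m (op_lin annih v f) k = op_lin annih v (creat m f) k - v $ m * f k"
proof -
  have "creat m (op_lin annih v f) k = (\<Sum>i\<in>UNIV. v $ i * annih i (creat m f) k - (if m = i then v $ i * f k else 0))"
    unfolding op_lin_def[abs_def] creat_sum creat_scale creat_annih
    by (intro sum.cong refl) (auto simp: algebra_simps)
  then show ?thesis by (simp add: sum_subtractf op_lin_def)
qed

lemma creat_op_lin_creat: "creat m (op_lin creat v f) k = op_lin creat v (creat m f) k"
  unfolding op_lin_def[abs_def] creat_sum creat_scale by (simp add: creat_creat[of m])

end

text \<open>The second operator sees degree at most N + 1, so the two square roots multiply to at
  most N + 2.\<close>

lemma fbound_op_quad: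
  assumes f: "fbound N b f"
    and X: "\<And>N b f i. fbound N b f \<Longrightarrow> fbound (Suc N) (sqrt (Suc N) * b) (X i f)"
    and Y: "\<And>N b f i. fbound N b f \<Longrightarrow> fbound (Suc N) (sqrt (Suc N) * b) (Y i f)"
  shows "fbound (N + 2) ((\<Sum>i\<in>UNIV. \<Sum>j\<in>UNIV. cmod (M $ i $ j)) * ((N + 2) * b)) (op_quad X M Y f)"
proof -
  have b: "0 \<le> b" using f norm1_nonneg[of f] by (auto simp: fbound_def)
  have "sqrt (Suc (Suc N)) * sqrt (Suc N) \<le> sqrt (Suc (Suc N)) * sqrt (Suc (Suc N))"
    by (intro mult_left_mono) auto
  then have "sqrt (Suc (Suc N)) * (sqrt (Suc N) * b) \<le> (N + 2) * b"
    using b by (simp flip: mult.assoc add: mult_right_mono)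
  then have "fbound (N + 2) ((real N + 2) * b) (X i (Y j f))" for i j
    using fbound_mono[OF X[OF Y[OF f]]] by (simp add: add.commute)
  then show ?thesis
    unfolding op_quad_def[abs_def] sum_distrib_right by (intro fbound_sum fbound_scale)
qed

text \<open>The bound is deliberately weakened to the shape of the quadratic one, so that all terms
  of the Hamiltonian can be added.\<close>

lemma fbound_op_lin:
  assumes f: "fbound N b f"
    and X: "\<And>N b f i. fbound N b f \<Longrightarrow> fbound (Suc N) (sqrt (Suc N) * b) (X i f)"
  shows "fbound (N + 2) ((\<Sum>i\<in>UNIV. cmod (v $ i)) * ((N + 2) * b)) (op_lin X v f)"
proof -
  have b: "0 \<le> b" using f norm1_nonneg[of f] by (auto simp: fbound_def)
  have "sqrt (Suc N) \<le> sqrt ((N + 2)\<^sup>2)"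
    by (simp add: power2_eq_square)
  then have "sqrt (Suc N) * b \<le> (N + 2) * b"
    using b by (intro mult_right_mono) auto
  then have "fbound (N + 2) ((real N + 2) * b) (X i f)" for i
    using fbound_mono[OF X[OF f]] by (simp add: add.commute)
  then show ?thesis
    unfolding op_lin_def[abs_def] sum_distrib_right by (intro fbound_sum fbound_scale)
qed

text \<open>The shift \<open>z\<close> enters as a solution of its linear system;
  \<open>h_eq\<close> and \<open>cnj_h_eq\<close> are the two block rows of that system.\<close>

locale quadratic_hamiltonian =
  fixes A B :: "complex^'n::finite^'n" and h z :: "complex^'n"
  assumes A_transpose: "A = transpose A"
    and B_adjoint: "B = cnj_mat (transpose B)"
    and z_eq: "G_mat A B *v stack z (cnj_vec z) = stack h (cnj_vec h)"
begin

lemma A_sym: "A $ i $ j = A $ j $ i"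
  using A_transpose by (metis transpose_def vec_lambda_beta)

lemma B_herm: "cnj (B $ i $ j) = B $ j $ i"
proof -
  have "B $ j $ i = cnj_mat (transpose B) $ j $ i" using B_adjoint by simp
  then show ?thesis by (simp add: transpose_def map_matrix_def)
qed

lemma G_entries:
  "G_mat A B $ Inl i $ Inl j = - \<i> * B $ i $ j" "G_mat A B $ Inl i $ Inr j = A $ i $ j"
  "G_mat A B $ Inr i $ Inl j = cnj (A $ i $ j)" "G_mat A B $ Inr i $ Inr j = \<i> * cnj (B $ i $ j)"
  by (simp_all add: G_mat_def block_mat_def smult_mat_def map_matrix_def)

lemma h_eq: "h $ i = (\<Sum>j\<in>UNIV. - \<i> * B $ i $ j * z $ j) + (\<Sum>j\<in>UNIV. A $ i $ j * cnj (z $ j))"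
proof -
  have "(G_mat A B *v stack z (cnj_vec z)) $ Inl i = h $ i" unfolding z_eq by (simp add: stack_def)
  then show ?thesis
    by (simp add: matrix_vector_mult_def sum_UNIV_Plus G_entries stack_def cnj_vec_def)
qed

lemma cnj_h_eq: "cnj (h $ i) = (\<Sum>j\<in>UNIV. cnj (A $ i $ j) * z $ j) + (\<Sum>j\<in>UNIV. \<i> * cnj (B $ i $ j) * cnj (z $ j))"
  unfolding h_eq by simp

abbreviation H :: "'n cfam \<Rightarrow> 'n cfam" where "H \<equiv> H_expr A B h"

lemma H_add: "H (\<lambda>k. f k + g k) = (\<lambda>k. H f k + H g k)"
  by (rule ext) (simp add: H_expr_def op_quad_def op_lin_def annih_add creat_add distrib_left sum.distrib right_diff_distrib)

lemma H_scale: "H (\<lambda>k. c * f k) = (\<lambda>k. c * H f k)"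
  by (rule ext) (simp add: H_expr_def op_quad_def op_lin_def annih_scale creat_scale distrib_left
      right_diff_distrib sum_distrib_left mult_ac)

lemma H_sum: "H (\<lambda>k. \<Sum>j\<in>J. f j k) = (\<lambda>k. \<Sum>j\<in>J. H (f j) k)"
  using H_scale[of 0 "\<lambda>_. 0"] by (induction J rule: infinite_finite_induct) (simp_all add: H_add)

text \<open>The commutator with the pure creation part yields the sum of \<open>A\<close> and its
  transpose, which by symmetry of \<open>A\<close> cancels the factor 1/2.\<close>

lemma annih_H: "annih m (H f) k = H (annih m f) k + (\<Sum>j\<in>UNIV. B $ m $ j * annih j f k)
    + \<i> * (\<Sum>j\<in>UNIV. A $ m $ j * creat j f k) + \<i> * h $ m * f k"
proof -
  have 1: "annih m (H f) k = \<i> / 2 * (annih m (op_quad creat A creat f) k - annih m (op_quad annih (cnj_mat A) annih f) k)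
      + annih m (op_quad creat B annih f) k + \<i> * annih m (op_lin creat h f) k
      - \<i> * annih m (op_lin annih (cnj_vec h) f) k"
    by (simp add: annih_def H_expr_def algebra_simps)
  have 2: "(\<Sum>j\<in>UNIV. (A $ m $ j + A $ j $ m) * creat j f k) = 2 * (\<Sum>j\<in>UNIV. A $ m $ j * creat j f k)"
    by (simp add: A_sym[of _ m] sum_distrib_left mult.assoc)
  show ?thesis
    unfolding 1 annih_op_quad_creat_creat annih_op_quad_annih_annih annih_op_quad_creat_annih
      annih_op_lin_creat annih_op_lin_annih 2 H_expr_def
    by (simp add: algebra_simps)
qed

lemma creat_H: "creat m (H f) k = H (creat m f) k + \<i> * (\<Sum>j\<in>UNIV. cnj (A $ m $ j) * annih j f k)
    - (\<Sum>j\<in>UNIV. cnj (B $ m $ j) * creat j f k) + \<i> * cnj (h $ m) * f k"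
proof -
  have 1: "creat m (H f) k = \<i> / 2 * (creat m (op_quad creat A creat f) k - creat m (op_quad annih (cnj_mat A) annih f) k)
      + creat m (op_quad creat B annih f) k + \<i> * creat m (op_lin creat h f) k
      - \<i> * creat m (op_lin annih (cnj_vec h) f) k"
    by (simp add: creat_def H_expr_def algebra_simps)
  have 2: "(\<Sum>j\<in>UNIV. (cnj_mat A $ m $ j + cnj_mat A $ j $ m) * annih j f k) = 2 * (\<Sum>j\<in>UNIV. cnj (A $ m $ j) * annih j f k)"
    by (simp add: A_sym[of _ m] sum_distrib_left map_matrix_def mult.assoc)
  have 3: "cnj_vec h $ m = cnj (h $ m)" by (simp add: cnj_vec_def)
  show ?thesis
    unfolding 1 creat_op_quad_creat_creat creat_op_quad_annih_annih creat_op_quad_creat_annih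
      creat_op_lin_creat creat_op_lin_annih 2 3 H_expr_def
    by (simp add: algebra_simps B_herm)
qed

text \<open>The shifted field operators \<open>(a + z, a\<^sup>\<dagger> + \<bar>z)\<close>: their commutator with \<open>iH\<close> has no constant term.\<close>

definition fld :: "'n + 'n \<Rightarrow> 'n cfam \<Rightarrow> 'n cfam" where
  "fld r f = (case r of Inl i \<Rightarrow> (\<lambda>k. annih i f k + z $ i * f k) | Inr i \<Rightarrow> (\<lambda>k. creat i f k + cnj (z $ i) * f k))"

text \<open>The adjoint of a + z is the creation operator plus the conjugate of z, so taking
  adjoints exchanges the two halves of the index type.\<close>

definition fld_adj :: "'n + 'n \<Rightarrow> 'n cfam \<Rightarrow> 'n cfam" where
  "fld_adj r = fld (case r of Inl i \<Rightarrow> Inr i | Inr i \<Rightarrow> Inl i)"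

definition iH :: "'n cfam \<Rightarrow> 'n cfam" where
  "iH f = (\<lambda>k. \<i> * H f k)"

lemma fins_fld: "fins f \<Longrightarrow> fins (fld r f)"
  by (cases r) (simp_all add: fld_def fins_add fins_annih fins_creat fins_scale)

lemma fip_fld: "fins f \<Longrightarrow> fip f (fld r g) = fip (fld_adj r f) g"
  by (cases r) (simp_all add: fld_def fld_adj_def fip_add_right fip_add_left fip_scale_left fip_scale_right
      fip_annih fip_creat fins_annih fins_creat fins_scale)

lemma iH_add: "iH (\<lambda>k. f k + g k) = (\<lambda>k. iH f k + iH g k)"
  and iH_sum: "iH (\<lambda>k. \<Sum>j\<in>J. F j k) = (\<lambda>k. \<Sum>j\<in>J. iH (F j) k)"
  and iH_scale: "iH (\<lambda>k. c * f k) = (\<lambda>k. c * iH f k)"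
  by (simp_all add: iH_def H_add H_sum H_scale distrib_left sum_distrib_left mult.left_commute)

text \<open>The scalar terms in \<open>h\<close> left by \<open>annih_H\<close> and
  \<open>creat_H\<close> are exactly what the shifts contribute to the right-hand side, by the
  equations for \<open>z\<close>.\<close>

lemma iH_fld: "iH (fld r f) = (\<lambda>k. fld r (iH f) k + (\<Sum>s\<in>UNIV. G_mat A B $ r $ s * fld s f k))"
proof
  fix k
  show "iH (fld r f) k = fld r (iH f) k + (\<Sum>s\<in>UNIV. G_mat A B $ r $ s * fld s f k)"
  proof (cases r)
    case (Inl m)
    have "iH (fld r f) k - fld r (iH f) k = \<i> * (H (annih m f) k - annih m (H f) k)"
      unfolding fld_def iH_def Inl sum.case H_add H_scale annih_scale by (simp add: algebra_simps)
    also have "\<dots> = - \<i> * (\<Sum>j\<in>UNIV. B $ m $ j * annih j f k) + (\<Sum>j\<in>UNIV. A $ m $ j * creat j f k) + h $ m * f k"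
      by (simp add: annih_H algebra_simps)
    also have "\<dots> = (\<Sum>s\<in>UNIV. G_mat A B $ r $ s * fld s f k)"
      by (simp add: Inl h_eq sum_UNIV_Plus G_entries fld_def algebra_simps sum.distrib sum_subtractf sum_negf sum_distrib_left sum_distrib_right)
    finally show ?thesis by (simp add: algebra_simps)
  next
    case (Inr m)
    have "iH (fld r f) k - fld r (iH f) k = \<i> * (H (creat m f) k - creat m (H f) k)"
      unfolding fld_def iH_def Inr sum.case H_add H_scale creat_scale by (simp add: algebra_simps)
    also have "\<dots> = (\<Sum>j\<in>UNIV. cnj (A $ m $ j) * annih j f k) + \<i> * (\<Sum>j\<in>UNIV. cnj (B $ m $ j) * creat j f k) + cnj (h $ m) * f k"
      by (simp add: creat_H algebra_simps)
    also have "\<dots> = (\<Sum>s\<in>UNIV. G_mat A B $ r $ s * fld s f k)"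
      by (simp add: Inr cnj_h_eq sum_UNIV_Plus G_entries fld_def algebra_simps sum.distrib sum_subtractf sum_negf sum_distrib_left sum_distrib_right)
    finally show ?thesis by (simp add: algebra_simps)
  qed
qed

text \<open>Every ladder operator is moved to the finitely supported side. The creation and
  annihilation parts exchange roles, and the \<open>B\<close> part reproduces itself because
  \<open>B\<close> is Hermitian.\<close>

lemma H_symmetric:
  assumes f: "fins f"
  shows "fip (H f) g = fip f (H g)"
proof -
  note fs = fins_annih fins_creat fins_scale fins_sum fins_add fins_diff f
  have R: "fip f (H g) = \<i> / 2 * ((\<Sum>i\<in>UNIV. \<Sum>j\<in>UNIV. A $ i $ j * fip (annih j (annih i f)) g)
       - (\<Sum>i\<in>UNIV. \<Sum>j\<in>UNIV. cnj (A $ i $ j) * fip (creat j (creat i f)) g))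
     + (\<Sum>i\<in>UNIV. \<Sum>j\<in>UNIV. B $ i $ j * fip (creat j (annih i f)) g)
     + \<i> * (\<Sum>i\<in>UNIV. h $ i * fip (annih i f) g) - \<i> * (\<Sum>i\<in>UNIV. cnj (h $ i) * fip (creat i f) g)"
    unfolding H_expr_def[abs_def] op_quad_def op_lin_def
    by (simp only: fip_diff_right fip_add_right fip_scale_right fip_sum_right fip_annih fip_creat fs
        map_matrix_def cnj_vec_def vec_lambda_beta)
  have L: "fip (H f) g = cnj (\<i> / 2) * ((\<Sum>i\<in>UNIV. \<Sum>j\<in>UNIV. cnj (A $ i $ j) * fip (creat i (creat j f)) g)
       - (\<Sum>i\<in>UNIV. \<Sum>j\<in>UNIV. cnj (cnj (A $ i $ j)) * fip (annih i (annih j f)) g))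
     + (\<Sum>i\<in>UNIV. \<Sum>j\<in>UNIV. cnj (B $ i $ j) * fip (creat i (annih j f)) g)
     + cnj \<i> * (\<Sum>i\<in>UNIV. cnj (h $ i) * fip (creat i f) g) - cnj \<i> * (\<Sum>i\<in>UNIV. cnj (cnj (h $ i)) * fip (annih i f) g)"
    unfolding H_expr_def[abs_def] op_quad_def op_lin_def
    by (simp only: fip_diff_left fip_add_left fip_scale_left fip_sum_left fs
        map_matrix_def cnj_vec_def vec_lambda_beta)
  have sw: "(\<Sum>i\<in>UNIV. \<Sum>j\<in>UNIV. cnj (B $ i $ j) * fip (creat i (annih j f)) g)
      = (\<Sum>i\<in>UNIV. \<Sum>j\<in>UNIV. B $ i $ j * fip (creat j (annih i f)) g)"
    unfolding B_herm by (rule sum.swap)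
  show ?thesis
    unfolding L R sw by (simp add: annih_annih creat_creat[of _ _ f] algebra_simps)
qed

section \<open>Finite-particle vectors are uniformly analytic\<close>

definition hbound :: real where
  "hbound = (\<Sum>i\<in>UNIV. \<Sum>j\<in>UNIV. cmod (A $ i $ j)) + (\<Sum>i\<in>UNIV. \<Sum>j\<in>UNIV. cmod (B $ i $ j))
     + 2 * (\<Sum>i\<in>UNIV. cmod (h $ i))"

lemma hbound_nonneg: "0 \<le> hbound"
  by (simp add: hbound_def sum_nonneg)

lemma fbound_H:
  assumes f: "fbound N b f"
  shows "fbound (N + 2) (hbound * ((N + 2) * b)) (H f)"
proof -
  have cA: "(\<Sum>i\<in>UNIV. \<Sum>j\<in>UNIV. cmod (cnj_mat A $ i $ j)) = (\<Sum>i\<in>UNIV. \<Sum>j\<in>UNIV. cmod (A $ i $ j))"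
    "(\<Sum>i\<in>UNIV. cmod (cnj_vec h $ i)) = (\<Sum>i\<in>UNIV. cmod (h $ i))"
    by (simp_all add: map_matrix_def cnj_vec_def)
  note q = fbound_op_quad[OF f fbound_creat fbound_creat, where M = A]
    fbound_op_quad[OF f fbound_annih fbound_annih, where M = "cnj_mat A"]
    fbound_op_quad[OF f fbound_creat fbound_annih, where M = B]
    fbound_op_lin[OF f fbound_creat, where v = h] fbound_op_lin[OF f fbound_annih, where v = "cnj_vec h"]
  note fb = fbound_diff[OF fbound_add[OF fbound_add[OF fbound_scale[OF fbound_diff[OF q(1,2)], where c = "\<i> / 2"] q(3)]
    fbound_scale[OF q(4), where c = \<i>]] fbound_scale[OF q(5), where c = \<i>]]
  show ?thesis
    unfolding H_expr_def[abs_def]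
    by (rule fbound_mono[OF fb]) (simp_all add: cA hbound_def algebra_simps norm_divide)
qed

lemma fins_H: "fins f \<Longrightarrow> fins (H f)"
  using fbound_exists fbound_fins fbound_H by metis

definition Dfin :: "'n fock set" where
  "Dfin = {x. fins (coeff x)}"

definition Hop :: "'n fock \<Rightarrow> 'n fock" where
  "Hop x = Abs_ell2 (H (coeff x))"

text \<open>Chosen so that |t| times \<open>hbound\<close> is at most 1/4 for all |t| <
  \<open>rad\<close>; it depends on the Hamiltonian only, not on the vector.\<close>

definition rad :: real where
  "rad = 1 / (4 * (hbound + 1))"

lemma coeff_Hop: "x \<in> Dfin \<Longrightarrow> coeff (Hop x) = H (coeff x)"
  by (simp add: Hop_def Dfin_def coeff_Abs_finite fins_H)

lemma Hop_Dfin: "x \<in> Dfin \<Longrightarrow> Hop x \<in> Dfin"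
  using coeff_Hop[of x] by (simp add: Dfin_def fins_H)

text \<open>Each application raises the degree bound by 2, so application j costs a factor linear in
  j. The product therefore grows only like a factorial times a geometric sequence.\<close>

lemma norm_Hop_pow:
  assumes "x \<in> Dfin" "fbound N b (coeff x)"
  shows "norm ((Hop ^^ k) x) \<le> (\<Prod>j<k. hbound * (real N + 2 * real j + 2)) * b"
proof -
  have *: "(Hop ^^ k) x \<in> Dfin \<and> fbound (N + 2 * k) ((\<Prod>j<k. hbound * (real N + 2 * real j + 2)) * b) (coeff ((Hop ^^ k) x))"
  proof (induction k)
    case 0
    then show ?case using assms by simp
  next
    case (Suc k)
    then have "fbound (N + 2 * k + 2) (hbound * ((real N + 2 * real k + 2) * ((\<Prod>j<k. hbound * (real N + 2 * real j + 2)) * b)))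
        (coeff (Hop ((Hop ^^ k) x)))"
      using fbound_H[of "N + 2 * k" "(\<Prod>j<k. hbound * (real N + 2 * real j + 2)) * b" "coeff ((Hop ^^ k) x)"]
      by (simp add: coeff_Hop)
    with Suc show ?case by (simp add: Hop_Dfin mult_ac)
  qed
  then have "norm ((Hop ^^ k) x) \<le> norm1 (coeff ((Hop ^^ k) x))"
    using norm_Abs_le_norm1[of "coeff ((Hop ^^ k) x)"] by (simp add: Dfin_def coeff_inverse)
  then show ?thesis using * by (auto simp: fbound_def)
qed

lemma rad_pos: "rad > 0" using hbound_nonneg by (simp add: rad_def)

lemma uniformly_analytic_Hop: "uniformly_analytic Dfin Hop rad"
proof
  show "closure Dfin = UNIV" unfolding Dfin_def by (rule closure_finite_support)
  fix x y :: "'n fock" assume x: "x \<in> Dfin"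
  show "c *\<^sub>C x \<in> Dfin" for c
    using x fins_scale[of "coeff x"] by (simp add: Dfin_def scaleC.rep_eq)
  show "Hop (c *\<^sub>C x) = c *\<^sub>C Hop x" for c
    by (rule ell2_eqI) (simp add: coeff_Hop \<open>c *\<^sub>C x \<in> Dfin\<close> x scaleC.rep_eq H_scale)
  assume y: "y \<in> Dfin"
  show "x + y \<in> Dfin"
    using x y fins_add[of "coeff x" "coeff y"] by (simp add: Dfin_def plus_ell2.rep_eq)
  then show "Hop (x + y) = Hop x + Hop y"
    using x y by (intro ell2_eqI) (simp add: coeff_Hop plus_ell2.rep_eq H_add)
  show "cinner (Hop x) y = cinner x (Hop y)"
    using x y by (simp add: cinner_fip coeff_Hop H_symmetric Dfin_def)
next
  fix x :: "'n fock" and t assume x: "x \<in> Dfin" and t: "\<bar>t\<bar> < rad"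
  obtain N where N: "fbound N (norm1 (coeff x)) (coeff x)"
    using x fbound_exists unfolding Dfin_def by blast
  define u where "u k = \<bar>t\<bar> ^ k / fact k * ((\<Prod>j<k. hbound * (real N + 2 * real j + 2)) * norm1 (coeff x))" for k
  have u_nonneg: "u k \<ge> 0" for k
    unfolding u_def by (intro mult_nonneg_nonneg prod_nonneg) (auto simp: norm1_nonneg hbound_nonneg)
  have th: "\<bar>t\<bar> * hbound \<le> 1 / 4"
  proof -
    have "\<bar>t\<bar> * hbound \<le> rad * (hbound + 1)" using t hbound_nonneg by (intro mult_mono) auto
    moreover have "rad * (hbound + 1) = 1 / 4" using hbound_nonneg by (simp add: rad_def divide_simps)
    ultimately show ?thesis by simp
  qed
  have "summable u"
  \<comment> \<open>For k at least N, the quotient (N + 2k + 2)/(k + 1) is at most 3, which with the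
    factor 1/4 gives ratio 3/4. The starting vector affects only where the ratio bound
    begins.\<close>
  proof (rule summable_ratio_test[of "3 / 4" N])
    fix k assume "k \<ge> N"
    have "u (Suc k) = (\<bar>t\<bar> * hbound) * ((real N + 2 * real k + 2) / (real k + 1)) * u k"
      by (simp add: u_def field_simps)
    also have "\<dots> \<le> (1 / 4) * 3 * u k"
      using th \<open>k \<ge> N\<close> hbound_nonneg
      by (intro mult_right_mono mult_mono u_nonneg) (auto simp: divide_simps)
    finally show "norm (u (Suc k)) \<le> 3 / 4 * norm (u k)"
      using u_nonneg by simp
  qed simp
  moreover have "norm (\<bar>t\<bar> ^ k / fact k * norm ((Hop ^^ k) x)) \<le> u k" for k
    unfolding u_def using norm_Hop_pow[OF x N, of k] by (auto intro!: mult_left_mono divide_right_mono)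
  ultimately show "summable (\<lambda>k. \<bar>t\<bar> ^ k / fact k * norm ((Hop ^^ k) x))"
    by (intro summable_comparison_test[OF _ \<open>summable u\<close>]) auto
qed (use rad_pos Hop_Dfin in auto)

sublocale uniformly_analytic Dfin Hop rad
  by (rule uniformly_analytic_Hop)

lemma exp_iH_H_hat: "exp_iH (H_hat A B h) = evol"
proof -
  have "H_finite A B h = {(x, Hop x) |x. x \<in> Dfin}"
    by (auto simp: H_finite_def Dfin_def intro!: ell2_eqI) (simp_all add: coeff_Hop Dfin_def)
  then show ?thesis by (simp add: H_hat_def exp_iH_eq_evol)
qed

end

section \<open>Calculus of matrix-valued functions\<close>

lemma bounded_bilinear_matrix_mult: "bounded_bilinear ((**) :: complex^'n::finite^'m::finite \<Rightarrow> complex^'k::finite^'n \<Rightarrow> complex^'k^'m)"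
  unfolding bilinear_conv_bounded_bilinear[symmetric] bilinear_def
  by (auto intro!: linearI simp: vec_eq_iff matrix_matrix_mult_def algebra_simps sum.distrib scaleR_sum_right)

lemma bounded_bilinear_matrix_vector_mult: "bounded_bilinear ((*v) :: complex^'n::finite^'m::finite \<Rightarrow> complex^'n \<Rightarrow> complex^'m)"
  unfolding bilinear_conv_bounded_bilinear[symmetric] bilinear_def
  by (auto intro!: linearI simp: vec_eq_iff matrix_vector_mult_def algebra_simps sum.distrib scaleR_sum_right)

lemma bounded_bilinear_bform: "bounded_bilinear (bform :: complex^'n::finite \<Rightarrow> complex^'n \<Rightarrow> complex)"
  unfolding bilinear_conv_bounded_bilinear[symmetric] bilinear_def
  by (auto intro!: linearI simp: bform_def algebra_simps sum.distrib scaleR_sum_right)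

lemmas has_vector_derivative_matrix_mult = bounded_bilinear.has_vector_derivative[OF bounded_bilinear_matrix_mult]

lemma has_vector_derivative_vecI:
  fixes f :: "real \<Rightarrow> 'a::euclidean_space^'n::finite"
  assumes "\<And>i. ((\<lambda>t. f t $ i) has_vector_derivative f' $ i) F"
  shows "(f has_vector_derivative f') F"
proof -
  have bl: "bounded_linear (axis i :: 'a \<Rightarrow> 'a^'n)" for i
    by (auto intro!: linearI simp: linear_conv_bounded_linear[symmetric] axis_def vec_eq_iff)
  have sum_axis: "(\<Sum>i\<in>UNIV. axis i (v $ i)) = v" for v :: "'a^'n"
    by (simp add: vec_eq_iff axis_def)
  have "((\<lambda>t. \<Sum>i\<in>UNIV. axis i (f t $ i)) has_vector_derivative (\<Sum>i\<in>UNIV. axis i (f' $ i))) F"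
    by (intro has_vector_derivative_sum bounded_linear.has_vector_derivative[OF bl] assms)
  then show ?thesis by (simp only: sum_axis)
qed

lemma has_vector_derivative_nth:
  fixes f :: "real \<Rightarrow> 'a::real_normed_vector^'n::finite"
  shows "(f has_vector_derivative f') F \<Longrightarrow> ((\<lambda>t. f t $ i) has_vector_derivative f' $ i) F"
  by (rule bounded_linear.has_vector_derivative[OF bounded_linear_vec_nth])

section \<open>The matrix exponential, entrywise\<close>

abbreviation mat_pow :: "complex^'m^'m \<Rightarrow> nat \<Rightarrow> complex^'m::finite^'m" where
  "mat_pow M k \<equiv> ((**) M ^^ k) (mat 1)"

lemma mat_pow_entry_Suc: "mat_pow M (Suc k) $ i $ j = (\<Sum>m\<in>UNIV. M $ i $ m * mat_pow M k $ m $ j)"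
  by (simp add: matrix_matrix_mult_def)

lemma mat_pow_commute: "M ** mat_pow M k = mat_pow M k ** M"
  by (induction k) (simp_all add: matrix_mul_assoc)

lemma mat_pow_scale: "mat_pow (t *\<^sub>R M) k $ i $ j = of_real t ^ k * mat_pow M k $ i $ j"
proof (induction k arbitrary: i)
  case (Suc k)
  have "mat_pow (t *\<^sub>R M) (Suc k) $ i $ j = (\<Sum>m\<in>UNIV. t *\<^sub>R M $ i $ m * (of_real t ^ k * mat_pow M k $ m $ j))"
    unfolding mat_pow_entry_Suc Suc by simp
  also have "\<dots> = of_real t ^ Suc k * mat_pow M (Suc k) $ i $ j"
    unfolding mat_pow_entry_Suc sum_distrib_left by (intro sum.cong) (simp_all add: scaleR_conv_of_real)
  finally show ?case .
qed simp

lemma mat_pow_bound: "cmod (mat_pow M k $ i $ j) \<le> (1 + (\<Sum>i\<in>UNIV. \<Sum>j\<in>UNIV. cmod (M $ i $ j))) ^ k"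
proof (induction k arbitrary: i)
  case 0
  then show ?case by (simp add: mat_def)
next
  case (Suc k)
  define K where "K = 1 + (\<Sum>i\<in>UNIV. \<Sum>j\<in>UNIV. cmod (M $ i $ j))"
  have "K \<ge> 0" unfolding K_def by (intro add_nonneg_nonneg sum_nonneg) auto
  have "cmod (mat_pow M (Suc k) $ i $ j) \<le> (\<Sum>m\<in>UNIV. cmod (M $ i $ m) * K ^ k)"
    unfolding mat_pow_entry_Suc using Suc
    by (intro sum_norm_le) (auto simp: norm_mult K_def intro: mult_left_mono)
  also have "\<dots> = (\<Sum>m\<in>UNIV. cmod (M $ i $ m)) * K ^ k" by (simp add: sum_distrib_right)
  also have "(\<Sum>m\<in>UNIV. cmod (M $ i $ m)) \<le> (\<Sum>i\<in>UNIV. \<Sum>m\<in>UNIV. cmod (M $ i $ m))"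
    by (rule member_le_sum[of i UNIV "\<lambda>i. \<Sum>m\<in>UNIV. cmod (M $ i $ m)"]) (auto intro: sum_nonneg)
  then have "(\<Sum>m\<in>UNIV. cmod (M $ i $ m)) * K ^ k \<le> K * K ^ k"
    using \<open>K \<ge> 0\<close> by (intro mult_right_mono) (auto simp: K_def)
  finally show ?case by (simp add: K_def)
qed

lemma summable_mat_pow: "summable (\<lambda>k. norm (mat_pow M k $ i $ j / fact k * w ^ k))" for w :: complex
proof (rule summable_comparison_test)
  let ?K = "1 + (\<Sum>i\<in>UNIV. \<Sum>j\<in>UNIV. cmod (M $ i $ j))"
  show "summable (\<lambda>k. (?K * cmod w) ^ k /\<^sub>R fact k)" by (rule summable_exp_generic)
  have "norm (mat_pow M k $ i $ j / fact k * w ^ k) \<le> (?K * cmod w) ^ k /\<^sub>R fact k" for k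
  proof -
    have "norm (mat_pow M k $ i $ j / fact k * w ^ k) = cmod (mat_pow M k $ i $ j) * (cmod w ^ k / fact k)"
      by (simp add: norm_mult norm_divide norm_power)
    also have "\<dots> \<le> ?K ^ k * (cmod w ^ k / fact k)"
      by (intro mult_right_mono mat_pow_bound) simp
    also have "\<dots> = (?K * cmod w) ^ k /\<^sub>R fact k"
      by (simp only: power_mult_distrib real_scaleR_def divide_inverse mult_ac)
    finally show ?thesis .
  qed
  then show "\<exists>N. \<forall>k\<ge>N. norm (norm (mat_pow M k $ i $ j / fact k * w ^ k)) \<le> (?K * cmod w) ^ k /\<^sub>R fact k"
    by (intro exI[of _ 0]) (simp only: real_norm_def abs_norm_cancel, simp)
qed

text \<open>Each entry is a scalar power series in t, which makes scalar results on power series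
  applicable.\<close>

lemma mat_exp_entry: "(\<lambda>k. mat_pow M k $ i $ j / fact k * of_real t ^ k) sums (mat_exp (t *\<^sub>R M) $ i $ j)"
proof -
  define E where "E = (\<chi> i j. \<Sum>k. mat_pow M k $ i $ j / fact k * of_real t ^ k)"
  have E: "(\<lambda>k. mat_pow M k $ i $ j / fact k * of_real t ^ k) sums (E $ i $ j)" for i j
    unfolding E_def vec_lambda_beta by (rule summable_sums, rule summable_norm_cancel, rule summable_mat_pow)
  have entry: "((1 / fact k) *\<^sub>R mat_pow (t *\<^sub>R M) k) $ i $ j = mat_pow M k $ i $ j / fact k * of_real t ^ k" for k i j
    unfolding vector_scaleR_component mat_pow_scale
    by (simp add: scaleR_conv_of_real[of _ "_ :: complex"] divide_inverse mult_ac)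
  have "(\<lambda>k. (1 / fact k) *\<^sub>R mat_pow (t *\<^sub>R M) k) sums E"
    unfolding sums_def
  proof (intro vec_tendstoI)
    show "(\<lambda>n. (\<Sum>k<n. (1 / fact k) *\<^sub>R mat_pow (t *\<^sub>R M) k) $ i $ j) \<longlonglongrightarrow> E $ i $ j" for i j
      using E[of i j] unfolding sums_def sum_component entry .
  qed
  then have "mat_exp (t *\<^sub>R M) = E" unfolding mat_exp_def by (simp add: sums_iff)
  then show ?thesis using E by simp
qed

lemma mat_exp_0: "mat_exp (0 *\<^sub>R M) = mat 1"
proof -
  have "mat_exp (0 *\<^sub>R M) $ i $ j = mat 1 $ i $ j" for i j
    using mat_exp_entry[of M i j 0] powser_sums_zero[of "\<lambda>k. mat_pow M k $ i $ j / fact k"] sums_unique2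
    by fastforce
  then show ?thesis by (simp add: vec_eq_iff)
qed

text \<open>Multiplication by \<open>M\<close> on either side gives the series whose coefficients
  are shifted by one, and so does termwise differentiation.\<close>

lemma mat_exp_derivative:
  "((\<lambda>t. mat_exp (t *\<^sub>R M)) has_vector_derivative M ** mat_exp (t *\<^sub>R M)) (at t)"
  "M ** mat_exp (t *\<^sub>R M) = mat_exp (t *\<^sub>R M) ** M"
proof -
  have 1: "(\<lambda>k. mat_pow M (Suc k) $ i $ j / fact k * of_real t ^ k) sums ((M ** mat_exp (t *\<^sub>R M)) $ i $ j)" for i j
  proof -
    have "(\<lambda>k. \<Sum>m\<in>UNIV. M $ i $ m * (mat_pow M k $ m $ j / fact k * of_real t ^ k))
        sums (\<Sum>m\<in>UNIV. M $ i $ m * mat_exp (t *\<^sub>R M) $ m $ j)"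
      by (intro sums_sum sums_mult mat_exp_entry)
    moreover have "mat_pow M (Suc k) $ i $ j / fact k * w = (\<Sum>m\<in>UNIV. M $ i $ m * (mat_pow M k $ m $ j / fact k * w))" for k w
      unfolding mat_pow_entry_Suc sum_divide_distrib sum_distrib_right by (simp add: mult.assoc)
    ultimately show ?thesis unfolding matrix_matrix_mult_def vec_lambda_beta by simp
  qed
  have 2: "(\<lambda>k. mat_pow M (Suc k) $ i $ j / fact k * of_real t ^ k) sums ((mat_exp (t *\<^sub>R M) ** M) $ i $ j)" for i j
  proof -
    have "(\<lambda>k. \<Sum>m\<in>UNIV. (mat_pow M k $ i $ m / fact k * of_real t ^ k) * M $ m $ j)
        sums (\<Sum>m\<in>UNIV. mat_exp (t *\<^sub>R M) $ i $ m * M $ m $ j)"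
      by (intro sums_sum sums_mult2 mat_exp_entry)
    moreover have "mat_pow M (Suc k) $ i $ j / fact k * w = (\<Sum>m\<in>UNIV. (mat_pow M k $ i $ m / fact k * w) * M $ m $ j)" for k w
    proof -
      have "mat_pow M (Suc k) $ i $ j = (\<Sum>m\<in>UNIV. mat_pow M k $ i $ m * M $ m $ j)"
        using mat_pow_commute[of M k] by (simp add: matrix_matrix_mult_def)
      then show ?thesis
        unfolding sum_divide_distrib sum_distrib_right by (simp only: sum_divide_distrib sum_distrib_right) (simp add: mult_ac)
    qed
    ultimately show ?thesis unfolding matrix_matrix_mult_def vec_lambda_beta by simp
  qed
  show "M ** mat_exp (t *\<^sub>R M) = mat_exp (t *\<^sub>R M) ** M"
    using sums_unique2[OF 1 2] by (simp add: vec_eq_iff)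
  show "((\<lambda>t. mat_exp (t *\<^sub>R M)) has_vector_derivative M ** mat_exp (t *\<^sub>R M)) (at t)"
  proof (intro has_vector_derivative_vecI)
    fix i j
    let ?c = "\<lambda>k. mat_pow M k $ i $ j / fact k"
    have "((\<lambda>w. \<Sum>k. ?c k * w ^ k) has_field_derivative (\<Sum>k. diffs ?c k * of_real t ^ k)) (at (of_real t))"
      by (rule termdiffs_strong_converges_everywhere) (rule summable_norm_cancel[OF summable_mat_pow])
    then have "((\<lambda>t. \<Sum>k. ?c k * of_real t ^ k) has_vector_derivative (\<Sum>k. diffs ?c k * of_real t ^ k)) (at t)"
      by (rule has_vector_derivative_real_field)
    moreover have "diffs ?c k = mat_pow M (Suc k) $ i $ j / fact k" for k
      unfolding diffs_def fact_Suc by (simp del: of_nat_Suc funpow.simps)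
    ultimately show "((\<lambda>t. mat_exp (t *\<^sub>R M) $ i $ j) has_vector_derivative (M ** mat_exp (t *\<^sub>R M)) $ i $ j) (at t)"
      using 1[of i j] mat_exp_entry[of M i j] by (simp add: sums_iff)
  qed
qed

lemma mat_exp_derivative':
  "((\<lambda>t. mat_exp (t *\<^sub>R M)) has_vector_derivative mat_exp (t *\<^sub>R M) ** M) (at t)"
  using mat_exp_derivative[of M t] by simp

lemma mat_exp_add: "mat_exp (s *\<^sub>R M) ** mat_exp (t *\<^sub>R M) = mat_exp ((s + t) *\<^sub>R M)"
proof -
  let ?E = "\<lambda>t. mat_exp (t *\<^sub>R M)"
  have "((\<lambda>u. ?E u ** ?E (s + t - u)) has_vector_derivative 0) (at u)" for u
  proof -
    have "(?E \<circ> (\<lambda>u. s + t - u) has_vector_derivative (- 1) *\<^sub>R (M ** ?E (s + t - u))) (at u)"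
      by (rule vector_diff_chain_at) (auto intro!: derivative_eq_intros mat_exp_derivative)
    then have "((\<lambda>u. ?E u ** (?E \<circ> (\<lambda>u. s + t - u)) u) has_vector_derivative
        ?E u ** ((- 1) *\<^sub>R (M ** ?E (s + t - u))) + (?E u ** M) ** (?E \<circ> (\<lambda>u. s + t - u)) u) (at u)"
      using has_vector_derivative_matrix_mult mat_exp_derivative' by blast
    then show ?thesis
      by (simp add: matrix_mul_assoc bounded_bilinear.minus_right[OF bounded_bilinear_matrix_mult])
  qed
  from has_vector_derivative_zero_constant[OF convex_UNIV this]
  obtain c where "\<And>u. ?E u ** ?E (s + t - u) = c" by auto
  from this[of s] this[of 0] show ?thesis by (simp add: mat_exp_0[of M, simplified])
qed

section \<open>Analytic continuation along the real line\<close>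

text \<open>Analyticity on the line with the same radius at every centre. It passes to sums and
  products, and zeros can be continued in steps of fixed length.\<close>

definition real_power_series :: "real \<Rightarrow> (real \<Rightarrow> complex) \<Rightarrow> bool" where
  "real_power_series r u \<longleftrightarrow> (\<forall>t0. \<exists>c. \<forall>s. \<bar>s\<bar> < r \<longrightarrow> (\<lambda>k. c k * of_real s ^ k) sums u (t0 + s))"

lemma real_power_series_abs_summable:
  assumes "\<And>s. \<bar>s\<bar> < r \<Longrightarrow> summable (\<lambda>k. c k * complex_of_real s ^ k)" "\<bar>s\<bar> < r"
  shows "summable (\<lambda>k. norm (c k * complex_of_real s ^ k))"
proof -
  obtain s' where "\<bar>s\<bar> < s'" "s' < r" using assms(2) dense by blast
  then show ?thesis
    by (intro powser_insidea[OF assms(1)[of s']]) auto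
qed

lemma real_power_series_add:
  assumes "real_power_series r u" "real_power_series r v"
  shows "real_power_series r (\<lambda>t. u t + v t)"
  unfolding real_power_series_def
proof
  fix t0
  obtain c d where "\<And>s. \<bar>s\<bar> < r \<Longrightarrow> (\<lambda>k. c k * of_real s ^ k) sums u (t0 + s)"
    "\<And>s. \<bar>s\<bar> < r \<Longrightarrow> (\<lambda>k. d k * of_real s ^ k) sums v (t0 + s)"
    using assms unfolding real_power_series_def by metis
  then show "\<exists>c. \<forall>s. \<bar>s\<bar> < r \<longrightarrow> (\<lambda>k. c k * of_real s ^ k) sums (u (t0 + s) + v (t0 + s))"
    by (intro exI[of _ "\<lambda>k. c k + d k"] allI impI) (simp add: distrib_right sums_add)
qed

lemma real_power_series_mult:
  assumes "real_power_series r u" "real_power_series r v"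
  shows "real_power_series r (\<lambda>t. u t * v t)"
  unfolding real_power_series_def
proof
  fix t0
  obtain c d where cd: "\<And>s. \<bar>s\<bar> < r \<Longrightarrow> (\<lambda>k. c k * of_real s ^ k) sums u (t0 + s)"
    "\<And>s. \<bar>s\<bar> < r \<Longrightarrow> (\<lambda>k. d k * of_real s ^ k) sums v (t0 + s)"
    using assms unfolding real_power_series_def by metis
  have "(\<lambda>k. (\<Sum>i\<le>k. c i * d (k - i)) * of_real s ^ k) sums (u (t0 + s) * v (t0 + s))" if s: "\<bar>s\<bar> < r" for s
  proof -
    have "(\<lambda>k. \<Sum>i\<le>k. (c i * of_real s ^ i) * (d (k - i) * of_real s ^ (k - i)))
        sums ((\<Sum>k. c k * of_real s ^ k) * (\<Sum>k. d k * of_real s ^ k))"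
      by (intro Cauchy_product_sums real_power_series_abs_summable[OF _ s])
        (use cd in \<open>auto simp: sums_iff\<close>)
    moreover have "(\<Sum>i\<le>k. (c i * of_real s ^ i) * (d (k - i) * of_real s ^ (k - i)))
        = (\<Sum>i\<le>k. c i * d (k - i)) * complex_of_real s ^ k" for k
      unfolding sum_distrib_right
    proof (rule sum.cong)
      fix i assume "i \<in> {..k}"
      then have "complex_of_real s ^ k = of_real s ^ i * of_real s ^ (k - i)" by (simp flip: power_add)
      then show "(c i * of_real s ^ i) * (d (k - i) * of_real s ^ (k - i)) = c i * d (k - i) * complex_of_real s ^ k"
        by simp
    qed simp
    ultimately show ?thesis using cd[OF s] by (simp add: sums_iff)
  qed
  then show "\<exists>c. \<forall>s. \<bar>s\<bar> < r \<longrightarrow> (\<lambda>k. c k * of_real s ^ k) sums (u (t0 + s) * v (t0 + s))"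
    by (intro exI allI impI)
qed

lemma real_power_series_const: "real_power_series r (\<lambda>t. a)"
  unfolding real_power_series_def
proof
  have "(\<lambda>k. (if k = 0 then a else 0) * of_real s ^ k) sums a" for s
    using sums_single[of 0 "\<lambda>k. a * of_real s ^ k"] by (simp add: if_distrib[of "\<lambda>x. x * _"] cong: if_cong)
  then show "\<exists>c. \<forall>s. \<bar>s\<bar> < r \<longrightarrow> (\<lambda>k. c k * of_real s ^ k) sums a"
    by (intro exI allI impI)
qed

lemma real_power_series_sum:
  "(\<And>i. i \<in> I \<Longrightarrow> real_power_series r (u i)) \<Longrightarrow> real_power_series r (\<lambda>t. \<Sum>i\<in>I. u i t)"
  by (induction I rule: infinite_finite_induct) (auto intro: real_power_series_const real_power_series_add)

lemma real_power_series_diff: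
  "real_power_series r u \<Longrightarrow> real_power_series r v \<Longrightarrow> real_power_series r (\<lambda>t. u t - v t)"
  using real_power_series_add[of r u "\<lambda>t. (-1) * v t"] real_power_series_mult[OF real_power_series_const, of r v "-1"]
  by simp

text \<open>Once the lower coefficients vanish, divide by s^m and let s tend to 0 through real
  values.\<close>

lemma power_series_coeffs_zero:
  assumes \<delta>: "\<delta> > 0" and zero: "\<And>s. \<bar>s\<bar> < \<delta> \<Longrightarrow> (\<lambda>k. c k * complex_of_real s ^ k) sums 0"
  shows "c m = 0"
proof (induction m rule: less_induct)
  case (less m)
  have shift: "(\<lambda>k. c (k + m) * complex_of_real s ^ k) sums 0" if "\<bar>s\<bar> < \<delta>" "s \<noteq> 0" for s
  proof -
    have "(\<lambda>k. c (k + m) * complex_of_real s ^ (k + m)) sums 0"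
      using sums_split_initial_segment[OF zero[OF that(1)], of m] less by simp
    from sums_mult[OF this, of "inverse (of_real s ^ m)"] show ?thesis
      using that(2) by (simp add: power_add field_simps)
  qed
  have summ: "summable (\<lambda>k. c (k + m) * w ^ k)" if w: "norm w < \<delta>" for w
  proof -
    obtain s where s: "norm w < s" "s < \<delta>" using dense[OF w] by auto
    have "s > 0" using norm_ge_zero[of w] s(1) by linarith
    have "summable (\<lambda>k. c (k + m) * complex_of_real s ^ k)"
      by (rule sums_summable[OF shift]) (use s \<open>s > 0\<close> in auto)
    then show ?thesis
      by (rule powser_inside) (use s \<open>s > 0\<close> in auto)
  qed
  define g where "g w = (\<Sum>k. c (k + m) * w ^ k)" for w
  have "(g \<longlongrightarrow> c (0 + m)) (at 0)"
    by (rule powser_limit_0[OF \<delta>]) (auto simp: g_def intro: summable_sums summ)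
  moreover have "filterlim (\<lambda>s. complex_of_real s) (at 0) (at (0 :: real))"
    by (auto simp: filterlim_at eventually_at intro!: tendsto_eq_intros exI[of _ 1])
  ultimately have "((\<lambda>s. g (of_real s)) \<longlongrightarrow> c m) (at (0 :: real))"
    using filterlim_compose by fastforce
  moreover have "eventually (\<lambda>s. g (of_real s) = 0) (at (0 :: real))"
    using \<delta> shift by (auto simp: eventually_at g_def sums_iff intro!: exI[of _ \<delta>])
  then have "((\<lambda>s. g (of_real s)) \<longlongrightarrow> 0) (at (0 :: real))"
    by (rule tendsto_eventually)
  ultimately show "c m = 0" using tendsto_unique[OF at_neq_bot] by blast
qed

lemma real_power_series_zero:
  assumes u: "real_power_series r u" and r: "r > 0" and zero: "\<And>t. \<bar>t\<bar> < r \<Longrightarrow> u t = 0"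
  shows "u t = 0"
proof -
  have step: "u (t0 + s) = 0" if near: "\<And>s. \<bar>s\<bar> < \<delta> \<Longrightarrow> u (t0 + s) = 0" and "\<delta> > 0" "\<bar>s\<bar> < r" for t0 s \<delta>
  proof -
    obtain c where c: "\<And>s. \<bar>s\<bar> < r \<Longrightarrow> (\<lambda>k. c k * of_real s ^ k) sums u (t0 + s)"
      using u unfolding real_power_series_def by blast
    have "c k = 0" for k
    proof (rule power_series_coeffs_zero)
      show "min \<delta> r > 0" using \<open>\<delta> > 0\<close> r by simp
      fix s assume "\<bar>s\<bar> < min \<delta> r"
      then show "(\<lambda>k. c k * of_real s ^ k) sums 0" using c[of s] near[of s] by simp
    qed
    then show ?thesis using c[OF \<open>\<bar>s\<bar> < r\<close>] by (simp add: sums_iff)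
  qed
  \<comment> \<open>Each step extends the interval of known zeros by r/2 at both ends.\<close>
  have "\<bar>t\<bar> < real n * (r / 2) + r \<Longrightarrow> u t = 0" for n t
  proof (induction n arbitrary: t)
    case 0
    then show ?case using zero by simp
  next
    case (Suc n)
    \<comment> \<open>The new centres \<plusminus>X lie r/2 inside the interval already known, so
      the function vanishes near them, and the expansion of radius \<open>r\<close> reaches up to X
      + r.\<close>
    define X where "X = real n * (r / 2) + r / 2"
    have X: "X \<ge> 0" "real (Suc n) * (r / 2) + r = X + r" "real n * (r / 2) + r = X + r / 2"
      using r by (auto simp: X_def field_simps)
    define t0 where "t0 = sgn t * X"
    have "\<bar>t0\<bar> \<le> X" using X(1) by (simp add: t0_def abs_mult abs_sgn_eq)
    then have "u (t0 + s) = 0" if "\<bar>s\<bar> < r / 2" for s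
      using that X(3) by (intro Suc.IH) linarith
    moreover have "\<bar>t - t0\<bar> < r \<or> \<bar>t\<bar> < real n * (r / 2) + r"
      using Suc.prems r X(1) unfolding X(2,3) t0_def by (cases t "0 :: real" rule: linorder_cases) auto
    ultimately show ?case
      using step[of "r / 2" t0 "t - t0"] r Suc.IH by auto
  qed
  moreover obtain n where "\<bar>t\<bar> / (r / 2) < real n" using reals_Archimedean2 by blast
  then have "\<bar>t\<bar> < real n * (r / 2) + r" using r by (simp add: divide_simps)
  ultimately show ?thesis by blast
qed

lemma real_power_series_mat_exp: "real_power_series r (\<lambda>t. mat_exp (t *\<^sub>R M) $ i $ j)"
  unfolding real_power_series_def
proof
  fix t0
  have "(\<lambda>k. (\<Sum>m\<in>UNIV. mat_exp (t0 *\<^sub>R M) $ i $ m * (mat_pow M k $ m $ j / fact k)) * of_real s ^ k)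
      sums (mat_exp ((t0 + s) *\<^sub>R M) $ i $ j)" for s
  proof -
    have "(\<lambda>k. \<Sum>m\<in>UNIV. mat_exp (t0 *\<^sub>R M) $ i $ m * (mat_pow M k $ m $ j / fact k * of_real s ^ k))
        sums (\<Sum>m\<in>UNIV. mat_exp (t0 *\<^sub>R M) $ i $ m * mat_exp (s *\<^sub>R M) $ m $ j)"
      by (intro sums_sum sums_mult mat_exp_entry)
    then show ?thesis
      unfolding mat_exp_add[symmetric] by (simp add: matrix_matrix_mult_def sum_distrib_right mult.assoc)
  qed
  then show "\<exists>c. \<forall>s. \<bar>s\<bar> < r \<longrightarrow> (\<lambda>k. c k * of_real s ^ k) sums (mat_exp ((t0 + s) *\<^sub>R M) $ i $ j)"
    by (intro exI allI impI)
qed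

section \<open>Heisenberg evolution of the field operators\<close>

text \<open>Pascal's rule in the form of the Leibniz induction: each summand passes its new factor
  to one of two places.\<close>

lemma sum_choose_Suc:
  fixes a :: "nat \<Rightarrow> nat \<Rightarrow> complex"
  shows "(\<Sum>j\<le>k. of_nat (k choose j) * (a j (Suc (k - j)) + a (Suc j) (k - j)))
    = (\<Sum>j\<le>Suc k. of_nat (Suc k choose j) * a j (Suc k - j))"
proof -
  have "(\<Sum>j\<le>Suc k. of_nat (Suc k choose j) * a j (Suc k - j))
      = a 0 (Suc k) + (\<Sum>j\<le>k. of_nat (k choose j) * a (Suc j) (k - j)) + (\<Sum>j\<le>k. of_nat (k choose Suc j) * a (Suc j) (k - j))"
    unfolding sum.atMost_Suc_shift by (simp add: distrib_right sum.distrib)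
  also have "a 0 (Suc k) + (\<Sum>j\<le>k. of_nat (k choose j) * a (Suc j) (k - j)) + (\<Sum>j\<le>k. of_nat (k choose Suc j) * a (Suc j) (k - j))
      = (\<Sum>j\<le>Suc k. of_nat (k choose j) * a j (Suc k - j)) + (\<Sum>j\<le>k. of_nat (k choose j) * a (Suc j) (k - j))"
    unfolding sum.atMost_Suc_shift by simp
  also have "(\<Sum>j\<le>Suc k. of_nat (k choose j) * a j (Suc k - j)) = (\<Sum>j\<le>k. of_nat (k choose j) * a j (Suc (k - j)))"
    by (simp add: Suc_diff_le)
  finally show ?thesis by (simp add: distrib_left sum.distrib)
qed

context quadratic_hamiltonian
begin

abbreviation G :: "complex^('n + 'n)^('n + 'n)" where "G \<equiv> G_mat A B"

lemma iH_pow: "(iH ^^ k) f = (\<lambda>\<kappa>. \<i> ^ k * (H ^^ k) f \<kappa>)"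
proof (induction k)
  case (Suc k)
  then show ?case by (simp add: iH_scale) (simp add: iH_def mult_ac)
qed simp

text \<open>Each factor \<open>iH\<close> either acts on \<open>f\<close> or is spent on a
  commutator, which multiplies the field operators by \<open>G\<close>; the binomial coefficient
  counts the choices.\<close>

lemma iH_pow_fld:
  "(iH ^^ k) (fld q f) = (\<lambda>\<kappa>. \<Sum>j\<le>k. of_nat (k choose j) * (\<Sum>r\<in>UNIV. mat_pow G j $ q $ r * fld r ((iH ^^ (k - j)) f) \<kappa>))"
proof (induction k arbitrary: q f)
  case 0
  have "(\<Sum>r\<in>UNIV. mat 1 $ q $ r * fld r f \<kappa>) = (\<Sum>r\<in>UNIV. if q = r then fld r f \<kappa> else 0)" for \<kappa>
    by (rule sum.cong) (auto simp: mat_def)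
  then show ?case by simp
next
  case (Suc k)
  have add: "(iH ^^ k) (\<lambda>\<kappa>. u \<kappa> + v \<kappa>) = (\<lambda>\<kappa>. (iH ^^ k) u \<kappa> + (iH ^^ k) v \<kappa>)" for u v
    by (induction k) (simp_all add: iH_add)
  have scale: "(iH ^^ k) (\<lambda>\<kappa>. c * u \<kappa>) = (\<lambda>\<kappa>. c * (iH ^^ k) u \<kappa>)" for c u
    by (induction k) (simp_all add: iH_scale)
  have sum: "(iH ^^ k) (\<lambda>\<kappa>. \<Sum>s\<in>S. u s \<kappa>) = (\<lambda>\<kappa>. \<Sum>s\<in>S. (iH ^^ k) (u s) \<kappa>)" for S and u :: "'n + 'n \<Rightarrow> _"
    by (induction k) (simp_all add: iH_sum)
  define a where "a j l \<kappa> = (\<Sum>r\<in>UNIV. mat_pow G j $ q $ r * fld r ((iH ^^ l) f) \<kappa>)" for j l \<kappa>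
  have sh: "(iH ^^ l) (iH f) = (iH ^^ Suc l) f" for l by (simp add: funpow_swap1)
  have G: "(\<Sum>s\<in>UNIV. G $ q $ s * (\<Sum>r\<in>UNIV. mat_pow G j $ s $ r * w r)) = (\<Sum>r\<in>UNIV. mat_pow G (Suc j) $ q $ r * w r)" for j w
    unfolding mat_pow_entry_Suc sum_distrib_left sum_distrib_right
    by (subst sum.swap) (simp add: mult.assoc)
  show ?case
  proof
    fix \<kappa>
    have "(iH ^^ Suc k) (fld q f) \<kappa> = (iH ^^ k) (iH (fld q f)) \<kappa>" by (simp add: funpow_swap1)
    also have "\<dots> = (iH ^^ k) (fld q (iH f)) \<kappa> + (\<Sum>s\<in>UNIV. G $ q $ s * (iH ^^ k) (fld s f) \<kappa>)"
      unfolding iH_fld add sum scale ..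
    also have "(iH ^^ k) (fld q (iH f)) \<kappa> = (\<Sum>j\<le>k. of_nat (k choose j) * a j (Suc (k - j)) \<kappa>)"
      unfolding Suc.IH sh a_def ..
    also have "(\<Sum>s\<in>UNIV. G $ q $ s * (iH ^^ k) (fld s f) \<kappa>) = (\<Sum>j\<le>k. of_nat (k choose j) * a (Suc j) (k - j) \<kappa>)"
      unfolding Suc.IH a_def G[symmetric] sum_distrib_left
      by (subst sum.swap) (simp add: mult.left_commute)
    also have "(\<Sum>j\<le>k. of_nat (k choose j) * a j (Suc (k - j)) \<kappa>) + (\<Sum>j\<le>k. of_nat (k choose j) * a (Suc j) (k - j) \<kappa>)
        = (\<Sum>j\<le>Suc k. of_nat (Suc k choose j) * a j (Suc k - j) \<kappa>)"
      unfolding sum_choose_Suc[of k "\<lambda>j l. a j l \<kappa>", symmetric] by (simp add: distrib_left sum.distrib)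
    finally show "(iH ^^ Suc k) (fld q f) \<kappa> = (\<Sum>j\<le>Suc k. of_nat (Suc k choose j) *
        (\<Sum>r\<in>UNIV. mat_pow G j $ q $ r * fld r ((iH ^^ (Suc k - j)) f) \<kappa>))"
      unfolding a_def .
  qed
qed

lemma Abs_Dfin: "fins f \<Longrightarrow> Abs_ell2 f \<in> Dfin"
  by (simp add: Dfin_def coeff_Abs_finite)

lemma evol_sums:
  assumes f: "fins f" and t: "\<bar>t\<bar> < rad"
  shows "(\<lambda>k. fip (coeff w) ((iH ^^ k) f) / fact k * of_real t ^ k) sums cinner w (evol t (Abs_ell2 f))"
proof -
  have c: "coeff ((Hop ^^ k) (Abs_ell2 f)) = (H ^^ k) f" for k
    by (induction k) (simp_all add: coeff_Abs_finite f coeff_Hop pow_D Abs_Dfin)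
  have "(\<lambda>k. cinner w (expc k t *\<^sub>C (Hop ^^ k) (Abs_ell2 f))) sums cinner w (ser t (Abs_ell2 f))"
    by (intro bounded_linear.sums[OF bounded_linear_cinner_right] ser_sums Abs_Dfin f t)
  moreover have "cinner w (expc k t *\<^sub>C (Hop ^^ k) (Abs_ell2 f)) = fip (coeff w) ((iH ^^ k) f) / fact k * of_real t ^ k" for k
    unfolding iH_pow fip_scale_right c[symmetric] cinner_fip[symmetric]
    by (simp add: expc_def power_mult_distrib)
  ultimately show ?thesis using f t by (simp add: evol_ser Abs_Dfin)
qed

text \<open>To recentre at \<open>t0\<close>, the evolution by \<open>t0\<close> is moved to the
  other argument \<open>w\<close>, which may be any vector. The vector being expanded remains
  finite-particle, so the radius is unchanged.\<close>

lemma real_power_series_evol: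
  assumes f: "fins f"
  shows "real_power_series rad (\<lambda>t. cinner w (evol t (Abs_ell2 f)))"
  unfolding real_power_series_def
proof
  fix t0
  have "(\<lambda>k. fip (coeff (evol (- t0) w)) ((iH ^^ k) f) / fact k * of_real s ^ k) sums cinner w (evol (t0 + s) (Abs_ell2 f))"
    if "\<bar>s\<bar> < rad" for s
    using evol_sums[OF f that, of "evol (- t0) w"]
    by (simp add: ug_add[OF unitary_group_evol] ug_adjoint[OF unitary_group_evol])
  then show "\<exists>c. \<forall>s. \<bar>s\<bar> < rad \<longrightarrow> (\<lambda>k. c k * of_real s ^ k) sums cinner w (evol (t0 + s) (Abs_ell2 f))"
    by (intro exI allI impI)
qed

lemma fins_fld_adj: "fins e \<Longrightarrow> fins (fld_adj r e)"
  by (simp add: fld_adj_def fins_fld)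

text \<open>The Cauchy product of the series of the matrix exponential with that of the matrix
  element has the same coefficients as \<open>iH_pow_fld\<close> gives for the right-hand
  side.\<close>

lemma heisenberg_small:
  assumes e: "fins e" and f: "fins f" and t: "\<bar>t\<bar> < rad"
  shows "(\<Sum>r\<in>UNIV. mat_exp (t *\<^sub>R G) $ q $ r * cinner (Abs_ell2 (fld_adj r e)) (evol t (Abs_ell2 f)))
    = cinner (Abs_ell2 e) (evol t (Abs_ell2 (fld q f)))"
proof (rule sums_unique2)
  define \<alpha> where "\<alpha> r j = mat_pow G j $ q $ r / fact j * of_real t ^ j" for r j
  define \<beta> where "\<beta> r l = fip (fld_adj r e) ((iH ^^ l) f) / fact l * of_real t ^ l" for r l
  have \<beta>_sums: "(\<lambda>l. fip (fld_adj r e) ((iH ^^ l) f) / fact l * of_real s ^ l) sums cinner (Abs_ell2 (fld_adj r e)) (evol s (Abs_ell2 f))"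
    if "\<bar>s\<bar> < rad" for r s
    using evol_sums[OF f that, of "Abs_ell2 (fld_adj r e)"] e by (simp add: coeff_Abs_finite fins_fld_adj)
  have "(\<lambda>k. \<Sum>j\<le>k. \<alpha> r j * \<beta> r (k - j)) sums
      (mat_exp (t *\<^sub>R G) $ q $ r * cinner (Abs_ell2 (fld_adj r e)) (evol t (Abs_ell2 f)))" for r
  proof -
    have "(\<lambda>k. \<Sum>j\<le>k. \<alpha> r j * \<beta> r (k - j)) sums ((\<Sum>k. \<alpha> r k) * (\<Sum>k. \<beta> r k))"
    proof (rule Cauchy_product_sums)
      show "summable (\<lambda>k. norm (\<alpha> r k))" unfolding \<alpha>_def by (rule summable_mat_pow)
      show "summable (\<lambda>k. norm (\<beta> r k))"
        unfolding \<beta>_def using sums_summable[OF \<beta>_sums] t by (rule real_power_series_abs_summable)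
    qed
    moreover have "(\<Sum>k. \<alpha> r k) = mat_exp (t *\<^sub>R G) $ q $ r"
      using mat_exp_entry[of G q r t] by (simp add: \<alpha>_def sums_iff)
    moreover have "(\<Sum>k. \<beta> r k) = cinner (Abs_ell2 (fld_adj r e)) (evol t (Abs_ell2 f))"
      using \<beta>_sums[OF t] by (simp add: \<beta>_def sums_iff)
    ultimately show ?thesis by simp
  qed
  then show "(\<lambda>k. \<Sum>r\<in>UNIV. \<Sum>j\<le>k. \<alpha> r j * \<beta> r (k - j)) sums
      (\<Sum>r\<in>UNIV. mat_exp (t *\<^sub>R G) $ q $ r * cinner (Abs_ell2 (fld_adj r e)) (evol t (Abs_ell2 f)))"
    by (intro sums_sum)
  have "fip e ((iH ^^ k) (fld q f)) / fact k * of_real t ^ k = (\<Sum>r\<in>UNIV. \<Sum>j\<le>k. \<alpha> r j * \<beta> r (k - j))" for k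
  proof -
    have "fip e ((iH ^^ k) (fld q f)) = (\<Sum>j\<le>k. of_nat (k choose j) * (\<Sum>r\<in>UNIV. mat_pow G j $ q $ r * fip (fld_adj r e) ((iH ^^ (k - j)) f)))"
      unfolding iH_pow_fld fip_sum_right[OF e] fip_scale_right fip_fld[OF e] ..
    then have "fip e ((iH ^^ k) (fld q f)) / fact k * of_real t ^ k
        = (\<Sum>j\<le>k. \<Sum>r\<in>UNIV. of_nat (k choose j) * (mat_pow G j $ q $ r * fip (fld_adj r e) ((iH ^^ (k - j)) f)) / fact k * of_real t ^ k)"
      by (simp add: sum_distrib_left sum_distrib_right sum_divide_distrib)
    also have "\<dots> = (\<Sum>j\<le>k. \<Sum>r\<in>UNIV. \<alpha> r j * \<beta> r (k - j))"
    proof (intro sum.cong refl)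
      fix j r assume "j \<in> {..k}"
      then have j: "j \<le> k" by simp
      have "complex_of_real t ^ k = of_real t ^ j * of_real t ^ (k - j)" using j by (simp flip: power_add)
      moreover have "(of_nat (k choose j) :: complex) = fact k / (fact j * fact (k - j))" using j by (rule binomial_fact)
      ultimately show "of_nat (k choose j) * (mat_pow G j $ q $ r * fip (fld_adj r e) ((iH ^^ (k - j)) f)) / fact k * of_real t ^ k
          = \<alpha> r j * \<beta> r (k - j)"
        by (simp add: \<alpha>_def \<beta>_def)
    qed
    also have "\<dots> = (\<Sum>r\<in>UNIV. \<Sum>j\<le>k. \<alpha> r j * \<beta> r (k - j))" by (rule sum.swap)
    finally show ?thesis .
  qed
  then show "(\<lambda>k. \<Sum>r\<in>UNIV. \<Sum>j\<le>k. \<alpha> r j * \<beta> r (k - j)) sums cinner (Abs_ell2 e) (evol t (Abs_ell2 (fld q f)))"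
    using evol_sums[OF fins_fld[OF f] t, of "Abs_ell2 e" q] e by (simp add: coeff_Abs_finite)
qed

lemma heisenberg:
  assumes e: "fins e" and f: "fins f"
  shows "(\<Sum>r\<in>UNIV. mat_exp (t *\<^sub>R G) $ q $ r * cinner (Abs_ell2 (fld_adj r e)) (evol t (Abs_ell2 f)))
    = cinner (Abs_ell2 e) (evol t (Abs_ell2 (fld q f)))"
proof -
  define u where "u t = (\<Sum>r\<in>UNIV. mat_exp (t *\<^sub>R G) $ q $ r * cinner (Abs_ell2 (fld_adj r e)) (evol t (Abs_ell2 f)))
    - cinner (Abs_ell2 e) (evol t (Abs_ell2 (fld q f)))" for t
  have "real_power_series rad u"
    unfolding u_def[abs_def]
    by (intro real_power_series_diff real_power_series_sum real_power_series_mult real_power_series_mat_exp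
        real_power_series_evol f fins_fld)
  then have "u t = 0"
    using rad_pos by (rule real_power_series_zero) (simp add: u_def heisenberg_small e f)
  then show ?thesis by (simp add: u_def)
qed

section \<open>The differential equation for the vacuum amplitude\<close>

text \<open>The vacuum as a raw family, the type on which the ladder operators act.\<close>

definition v0 :: "'n cfam" where "v0 k = (if k = (\<lambda>_. 0) then 1 else 0)"

lemma fins_v0: "fins v0"
  by (simp add: v0_def)

lemma vac_eq: "vac = Abs_ell2 v0"
  by (rule ell2_eqI) (simp add: vac.rep_eq coeff_Abs_finite fins_v0 v0_def)

lemma annih_v0: "annih i v0 = (\<lambda>_. 0)"
  by (auto simp: annih_def v0_def fun_eq_iff)

definition amp :: "real \<Rightarrow> complex" where
  "amp t = cinner vac (evol t vac)"

text \<open>The matrix element of the j-th annihilation operator between vacuum and evolved vacuum,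
  with its adjoint placed on the finite-particle side; \<open>mom2\<close> does the same with two
  annihilation operators.\<close>

definition mom1 :: "real \<Rightarrow> 'n \<Rightarrow> complex" where
  "mom1 t j = cinner (Abs_ell2 (creat j v0)) (evol t vac)"

definition mom2 :: "real \<Rightarrow> 'n \<Rightarrow> 'n \<Rightarrow> complex" where
  "mom2 t j k = cinner (Abs_ell2 (creat j (creat k v0))) (evol t vac)"

lemma amp_0: "amp 0 = 1"
proof -
  have "amp 0 = (\<Sum>k\<in>{\<lambda>_. 0}. cnj (v0 k) * v0 k)"
    unfolding amp_def ug_0[OF unitary_group_evol] vac_eq cinner_fip coeff_Abs_finite[OF fins_v0] fip_def
    by (subst infsum_cong_neutral[of "{\<lambda>_. 0}" UNIV]) (auto simp: v0_def)
  then show ?thesis by (simp add: v0_def)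
qed

lemma cinner_Abs: "fins u \<Longrightarrow> cinner (Abs_ell2 u) y = fip u (coeff y)"
  by (simp add: cinner_fip coeff_Abs_finite)

lemma evol_fld_v0: "evol t (Abs_ell2 (fld (Inl i) v0)) = z $ i *\<^sub>C evol t vac"
proof -
  have "Abs_ell2 (fld (Inl i) v0) = z $ i *\<^sub>C vac"
    by (rule ell2_eqI) (simp add: fld_def annih_v0 vac_eq scaleC.rep_eq coeff_Abs_finite fins_v0 fins_scale)
  then show ?thesis by (simp add: unitaryD(2)[OF ug_unitary[OF unitary_group_evol]])
qed

lemma mat_exp_Phi: "mat_exp (t *\<^sub>R G) $ Inl i $ Inl j = Phi A B t $ i $ j"
  "mat_exp (t *\<^sub>R G) $ Inl i $ Inr j = Psi A B t $ i $ j"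
  by (simp_all add: Phi_def Psi_def)

text \<open>The upper row of the Heisenberg relation between vacua. On the right, annihilation of
  the vacuum leaves only the shift \<open>z $ i\<close>.\<close>

lemma moment_eq1:
  "(\<Sum>j\<in>UNIV. Phi A B t $ i $ j * (mom1 t j + z $ j * amp t)) + (\<Sum>j\<in>UNIV. Psi A B t $ i $ j * (cnj (z $ j) * amp t))
    = z $ i * amp t"
proof -
  have 1: "cinner (Abs_ell2 (fld_adj (Inl j) v0)) (evol t vac) = mom1 t j + z $ j * amp t" for j
    using fins_v0 by (simp add: cinner_Abs fins_fld_adj mom1_def amp_def fins_creat)
      (simp add: vac_eq cinner_Abs fld_adj_def fld_def fip_add_left fip_scale_left fins_creat fins_scale)
  have 2: "cinner (Abs_ell2 (fld_adj (Inr j) v0)) (evol t vac) = cnj (z $ j) * amp t" for j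
    using fins_v0 by (simp add: cinner_Abs fins_fld_adj amp_def)
      (simp add: vac_eq cinner_Abs fld_adj_def fld_def annih_v0 fip_scale_left)
  show ?thesis
    using heisenberg[OF fins_v0 fins_v0, of t "Inl i"]
    by (simp add: sum_UNIV_Plus mat_exp_Phi 1 2 evol_fld_v0 amp_def flip: vac_eq)
qed

text \<open>The same row tested against a one-particle vector; the Kronecker delta is the commutator
  from annihilating that particle.\<close>

lemma moment_eq2:
  "(\<Sum>j\<in>UNIV. Phi A B t $ i $ j * (mom2 t j k + z $ j * mom1 t k))
     + (\<Sum>j\<in>UNIV. Psi A B t $ i $ j * ((if j = k then amp t else 0) + cnj (z $ j) * mom1 t k))
    = z $ i * mom1 t k"
proof -
  have fk: "fins (creat k v0)" using fins_v0 by (rule fins_creat)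
  have 1: "cinner (Abs_ell2 (fld_adj (Inl j) (creat k v0))) (evol t vac) = mom2 t j k + z $ j * mom1 t k" for j
    using fk by (simp add: cinner_Abs fins_fld_adj mom1_def mom2_def fins_creat)
      (simp add: fld_adj_def fld_def fip_add_left fip_scale_left fins_creat fins_scale)
  have fl: "fins (\<lambda>\<kappa>. if j = k then v0 \<kappa> else 0)" for j using fins_v0 by simp
  have "fld_adj (Inr j) (creat k v0) = (\<lambda>\<kappa>. (if j = k then v0 \<kappa> else 0) + z $ j * creat k v0 \<kappa>)" for j
    by (rule ext) (simp add: fld_adj_def fld_def annih_creat annih_v0 creat_def)
  then have 2: "cinner (Abs_ell2 (fld_adj (Inr j) (creat k v0))) (evol t vac) = (if j = k then amp t else 0) + cnj (z $ j) * mom1 t k" for j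
    using fk fl fins_v0 by (simp add: cinner_Abs fins_add fins_scale mom1_def amp_def vac_eq fip_add_left fip_scale_left)
      (simp add: fip_def)
  show ?thesis
    using heisenberg[OF fk fins_v0, of t "Inl i"]
    by (simp add: sum_UNIV_Plus mat_exp_Phi 1 2 evol_fld_v0 mom1_def flip: vac_eq)
qed

text \<open>Symmetry moves the Hamiltonian onto the unevolved vacuum, where every term ending in an
  annihilation operator vanishes. Only the creation terms in \<open>A\<close> and \<open>h\<close>
  remain.\<close>

lemma amp_derivative:
  "(amp has_vector_derivative
     (1/2 * (\<Sum>i\<in>UNIV. \<Sum>j\<in>UNIV. cnj (A $ i $ j) * mom2 t i j) + (\<Sum>i\<in>UNIV. cnj (h $ i) * mom1 t i))) (at t)"
proof -
  have D: "vac \<in> Dfin" by (simp add: vac_eq Abs_Dfin fins_v0)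
  have "(amp has_vector_derivative cinner vac (\<i> *\<^sub>C evol t (Hop vac))) (at t)"
    unfolding amp_def[abs_def]
    by (intro bounded_linear.has_vector_derivative[OF bounded_linear_cinner_right]
        generator_derivative[OF unitary_group_evol] T_in_generator D)
  moreover have "cinner vac (\<i> *\<^sub>C evol t (Hop vac)) = \<i> * cinner (Hop vac) (evol t vac)"
    using generator_symmetric[OF unitary_group_evol T_in_generator[OF D]
        generator_invariant[OF unitary_group_evol T_in_generator[OF D]]] by simp
  moreover have "\<i> * cinner (Hop vac) (evol t vac)
      = 1/2 * (\<Sum>i\<in>UNIV. \<Sum>j\<in>UNIV. cnj (A $ i $ j) * mom2 t i j) + (\<Sum>i\<in>UNIV. cnj (h $ i) * mom1 t i)"
  proof -
    note fs = fins_creat fins_scale fins_sum fins_add fins_v0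
    have z: "creat i (\<lambda>_. 0) = (\<lambda>_. 0)" "annih i (\<lambda>_. 0) = (\<lambda>_. 0)" for i :: 'n
      by (auto simp: creat_def annih_def)
    have Hv: "H v0 = (\<lambda>k. (\<i> / 2) * (\<Sum>i\<in>UNIV. \<Sum>j\<in>UNIV. A $ i $ j * creat i (creat j v0) k) + \<i> * (\<Sum>i\<in>UNIV. h $ i * creat i v0 k))"
      by (rule ext) (simp add: H_expr_def op_quad_def op_lin_def annih_v0 z)
    have "cinner (Hop vac) (evol t vac) = fip (H v0) (coeff (evol t vac))"
      by (simp add: Hop_def vac_eq coeff_Abs_finite fins_v0 cinner_Abs fins_H)
    also have "\<dots> = cnj (\<i> / 2) * (\<Sum>i\<in>UNIV. \<Sum>j\<in>UNIV. cnj (A $ i $ j) * mom2 t i j) + cnj \<i> * (\<Sum>i\<in>UNIV. cnj (h $ i) * mom1 t i)"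
      unfolding Hv mom1_def mom2_def
      by (simp only: fip_add_left fip_scale_left fip_sum_left fs cinner_Abs)
    finally have *: "cinner (Hop vac) (evol t vac) = \<dots>" .
    have "\<i> * (cnj (\<i> / 2) * x + cnj \<i> * y) = 1/2 * x + y" for x y by (simp add: algebra_simps)
    then show ?thesis unfolding * .
  qed
  ultimately show ?thesis by simp
qed

end

section \<open>Derivatives of inverses and determinants\<close>

lemma matrix_inv_inverse:
  fixes M :: "complex^'n::finite^'n"
  assumes "det M \<noteq> 0"
  shows "M ** matrix_inv M = mat 1" "matrix_inv M ** M = mat 1"
proof -
  have "\<exists>M'. M ** M' = mat 1 \<and> M' ** M = mat 1"
    using assms invertible_det_nz[of M] by (simp add: invertible_def)
  from someI_ex[OF this] show "M ** matrix_inv M = mat 1" "matrix_inv M ** M = mat 1"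
    by (auto simp: matrix_inv_def)
qed

lemma det_has_derivative:
  fixes M :: "real \<Rightarrow> complex^'n::finite^'n"
  assumes "(M has_vector_derivative M') (at t)"
  shows "((\<lambda>s. det (M s)) has_vector_derivative
    (\<Sum>p | p permutes (UNIV :: 'n set). of_int (sign p) *
      (\<Sum>i\<in>UNIV. M' $ i $ p i * (\<Prod>j\<in>UNIV - {i}. M t $ j $ p j)))) (at t)"
proof -
  have "((\<lambda>s. \<Prod>i\<in>UNIV. M s $ i $ p i) has_vector_derivative
      (\<Sum>i\<in>UNIV. M' $ i $ p i * (\<Prod>j\<in>UNIV - {i}. M t $ j $ p j))) (at t)" for p
  proof -
    have "((\<lambda>s. M s $ i $ p i) has_derivative (\<lambda>y. y *\<^sub>R M' $ i $ p i)) (at t)" for i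
      using has_vector_derivative_nth[OF has_vector_derivative_nth[OF assms]]
      by (simp add: has_vector_derivative_def)
    then have "((\<lambda>s. \<Prod>i\<in>UNIV. M s $ i $ p i) has_derivative
        (\<lambda>y. \<Sum>i\<in>UNIV. y *\<^sub>R M' $ i $ p i * (\<Prod>j\<in>UNIV - {i}. M t $ j $ p j))) (at t)"
      by (intro has_derivative_prod)
    then show ?thesis by (simp add: has_vector_derivative_def scaleR_sum_right)
  qed
  then show ?thesis
    unfolding det_def by (intro has_vector_derivative_sum has_vector_derivative_mult_right)
qed

lemma det_derivative_at_identity:
  fixes X :: "real \<Rightarrow> complex^'n::finite^'n"
  assumes "(X has_vector_derivative X') (at t)" and "X t = mat 1"
  shows "((\<lambda>s. det (X s)) has_vector_derivative trace X') (at t)"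
proof -
  have term_eq: "of_int (sign p) * (\<Sum>i\<in>UNIV. X' $ i $ p i * (\<Prod>j\<in>UNIV - {i}. X t $ j $ p j))
      = (if p = id then trace X' else 0)" if p: "p permutes (UNIV :: 'n set)" for p
  proof (cases "p = id")
    case True
    then show ?thesis by (simp add: assms(2) mat_def trace_def sign_id)
  next
    case False
    \<comment> \<open>A permutation other than the identity moves at least two points, so an
      off-diagonal entry of the identity matrix survives the removal of one factor.\<close>
    have zero: "(\<Prod>j\<in>UNIV - {i}. X t $ j $ p j) = 0" for i
    proof -
      have "\<exists>j. j \<noteq> i \<and> p j \<noteq> j"
      proof (rule ccontr)
        assume "\<not> ?thesis"
        then have others: "\<And>j. j \<noteq> i \<Longrightarrow> p j = j" by blast
        have "p i = i" using others permutes_inj[OF p] by (metis injD)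
        then show False using others False by (metis eq_id_iff)
      qed
      then obtain j where "j \<noteq> i" "p j \<noteq> j" by blast
      then show ?thesis
        by (intro prod_zero finite bexI[of _ j]) (auto simp: assms(2) mat_def)
    qed
    show ?thesis using False unfolding zero by simp
  qed
  have "(\<Sum>p | p permutes (UNIV :: 'n set). of_int (sign p) *
      (\<Sum>i\<in>UNIV. X' $ i $ p i * (\<Prod>j\<in>UNIV - {i}. X t $ j $ p j)))
      = (\<Sum>p | p permutes (UNIV :: 'n set). if p = id then trace X' else 0)"
    by (intro sum.cong) (auto simp: term_eq)
  also have "\<dots> = trace X'"
    by (simp add: finite_permutations permutes_id)
  finally show ?thesis using det_has_derivative[OF assms(1)] by simp
qed

text \<open>Factoring out the constant matrix \<open>M t\<close> reduces the claim to a curve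
  passing through the identity.\<close>

lemma Jacobi_det_derivative:
  fixes M :: "real \<Rightarrow> complex^'n::finite^'n"
  assumes M: "(M has_vector_derivative M') (at t)" and inv: "det (M t) \<noteq> 0"
  shows "((\<lambda>s. det (M s)) has_vector_derivative det (M t) * trace (matrix_inv (M t) ** M')) (at t)"
proof -
  have "((\<lambda>s. matrix_inv (M t) ** M s) has_vector_derivative matrix_inv (M t) ** M') (at t)"
    by (rule bounded_linear.has_vector_derivative[OF bounded_bilinear.bounded_linear_right[OF bounded_bilinear_matrix_mult] M])
  then have "((\<lambda>s. det (matrix_inv (M t) ** M s)) has_vector_derivative trace (matrix_inv (M t) ** M')) (at t)"
    by (rule det_derivative_at_identity) (rule matrix_inv_inverse(2)[OF inv])
  then have "((\<lambda>s. det (M t) * det (matrix_inv (M t) ** M s)) has_vector_derivative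
      det (M t) * trace (matrix_inv (M t) ** M')) (at t)"
    by (rule has_vector_derivative_mult_right)
  moreover have "det (M t) * det (matrix_inv (M t) ** M s) = det (M s)" for s
    by (simp add: matrix_mul_assoc matrix_inv_inverse(1)[OF inv] flip: det_mul)
  ultimately show ?thesis by simp
qed

text \<open>Differentiability comes from Cramer's rule, which writes each entry as a quotient of
  determinants. The value then follows by differentiating inverse times matrix = 1.\<close>

lemma matrix_inv_derivative:
  fixes M :: "real \<Rightarrow> complex^'n::finite^'n"
  assumes M: "\<And>t. (M has_vector_derivative M' t) (at t)" and inv: "\<And>t. det (M t) \<noteq> 0"
  shows "((\<lambda>t. matrix_inv (M t)) has_vector_derivative - (matrix_inv (M t) ** M' t ** matrix_inv (M t))) (at t)"
proof -
  define d where "d i j = vector_derivative (\<lambda>t. matrix_inv (M t) $ i $ j) (at t)" for i j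
  have d: "((\<lambda>t. matrix_inv (M t) $ i $ j) has_vector_derivative d i j) (at t)" for i j
  proof -
    \<comment> \<open>\<open>M s\<close> with column i replaced by the j-th unit vector.\<close>
    define C where "C s = (\<chi> i' j'. if j' = i then axis j 1 $ i' else M s $ i' $ j')" for s
    have quotient: "(\<lambda>s. matrix_inv (M s) $ i $ j) = (\<lambda>s. det (C s) / det (M s))"
    proof
      fix s
      have "M s *v (matrix_inv (M s) *v axis j 1) = axis j 1"
        by (simp add: matrix_vector_mul_assoc matrix_inv_inverse(1)[OF inv])
      then have "matrix_inv (M s) *v axis j 1
          = (\<chi> k. det (\<chi> i' j'. if j' = k then axis j 1 $ i' else M s $ i' $ j') / det (M s))"
        by (rule cramer[OF inv, THEN iffD1])
      then have "(matrix_inv (M s) *v axis j 1) $ i = det (C s) / det (M s)"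
        by (simp add: C_def)
      moreover have "(matrix_inv (M s) *v axis j 1) $ i = matrix_inv (M s) $ i $ j"
        by (simp add: matrix_vector_mult_def axis_def if_distrib cong: if_cong)
      ultimately show "matrix_inv (M s) $ i $ j = det (C s) / det (M s)" by simp
    qed
    have "(C has_vector_derivative (\<chi> i' j'. if j' = i then 0 else M' t $ i' $ j')) (at t)"
      by (intro has_vector_derivative_vecI)
        (use has_vector_derivative_nth[OF has_vector_derivative_nth[OF M]] in \<open>auto simp: C_def\<close>)
    from det_has_derivative[OF this] det_has_derivative[OF M]
    have "(\<lambda>s. det (C s) / det (M s)) differentiable at t"
      by (intro differentiable_divide inv) (auto intro: differentiableI_vector)
    then show ?thesis
      unfolding d_def quotient by (rule vector_derivative_works[THEN iffD1])
  qed
  define N' where "N' = (\<chi> i j. d i j)"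
  have N': "((\<lambda>t. matrix_inv (M t)) has_vector_derivative N') (at t)"
    by (intro has_vector_derivative_vecI) (simp add: N'_def d)
  have "((\<lambda>t. matrix_inv (M t) ** M t) has_vector_derivative matrix_inv (M t) ** M' t + N' ** M t) (at t)"
    by (rule has_vector_derivative_matrix_mult[OF N' M])
  then have "((\<lambda>t. mat 1) has_vector_derivative matrix_inv (M t) ** M' t + N' ** M t) (at t)"
    by (simp add: matrix_inv_inverse(2)[OF inv])
  then have "matrix_inv (M t) ** M' t + N' ** M t = 0"
    using vector_derivative_unique_at has_vector_derivative_const by blast
  then have "N' ** M t = - (matrix_inv (M t) ** M' t)" by (simp add: add_eq_0_iff2)
  then have "N' ** M t ** matrix_inv (M t) = - (matrix_inv (M t) ** M' t ** matrix_inv (M t))"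
    by (simp add: bounded_bilinear.minus_left[OF bounded_bilinear_matrix_mult])
  then have "N' = - (matrix_inv (M t) ** M' t ** matrix_inv (M t))"
    by (simp add: matrix_inv_inverse(1)[OF inv] flip: matrix_mul_assoc)
  then show ?thesis using N' by simp
qed

section \<open>The symplectic blocks\<close>

lemmas mat_simps =
  bounded_bilinear.add_left[OF bounded_bilinear_matrix_mult]
  bounded_bilinear.add_right[OF bounded_bilinear_matrix_mult]
  bounded_bilinear.diff_left[OF bounded_bilinear_matrix_mult]
  bounded_bilinear.diff_right[OF bounded_bilinear_matrix_mult]
  bounded_bilinear.minus_left[OF bounded_bilinear_matrix_mult]
  bounded_bilinear.minus_right[OF bounded_bilinear_matrix_mult]

lemmas matvec_simps =
  bounded_bilinear.add_left[OF bounded_bilinear_matrix_vector_mult]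
  bounded_bilinear.add_right[OF bounded_bilinear_matrix_vector_mult]
  bounded_bilinear.diff_left[OF bounded_bilinear_matrix_vector_mult]
  bounded_bilinear.diff_right[OF bounded_bilinear_matrix_vector_mult]
  bounded_bilinear.minus_left[OF bounded_bilinear_matrix_vector_mult]
  bounded_bilinear.minus_right[OF bounded_bilinear_matrix_vector_mult]

lemmas bform_simps =
  bounded_bilinear.add_left[OF bounded_bilinear_bform]
  bounded_bilinear.add_right[OF bounded_bilinear_bform]
  bounded_bilinear.diff_left[OF bounded_bilinear_bform]
  bounded_bilinear.diff_right[OF bounded_bilinear_bform]
  bounded_bilinear.minus_left[OF bounded_bilinear_bform]
  bounded_bilinear.minus_right[OF bounded_bilinear_bform]

lemma transpose_add: "transpose (M + M') = transpose M + transpose (M' :: complex^'n^'m)"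
  by (simp add: transpose_def vec_eq_iff)

lemma bform_commute: "bform u v = bform v u"
  by (simp add: bform_def mult.commute)

lemma bform_transpose: "bform u (M *v v) = bform (transpose M *v u) v"
proof -
  have "bform u (M *v v) = (\<Sum>i\<in>UNIV. \<Sum>j\<in>UNIV. u $ i * (M $ i $ j * v $ j))"
    by (simp add: bform_def matrix_vector_mult_def sum_distrib_left)
  also have "\<dots> = (\<Sum>j\<in>UNIV. \<Sum>i\<in>UNIV. u $ i * (M $ i $ j * v $ j))" by (rule sum.swap)
  also have "\<dots> = bform (transpose M *v u) v"
    by (simp add: bform_def matrix_vector_mult_def transpose_def sum_distrib_right sum_distrib_left mult_ac)
  finally show ?thesis .
qed

lemma bounded_linear_transpose: "bounded_linear (transpose :: complex^'n::finite^'m::finite \<Rightarrow> _)"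
  by (auto intro!: linearI simp: linear_conv_bounded_linear[symmetric] transpose_def vec_eq_iff)

lemma bounded_linear_cnj_mat: "bounded_linear (cnj_mat :: complex^'n::finite^'m::finite \<Rightarrow> _)"
  by (auto intro!: linearI simp: linear_conv_bounded_linear[symmetric] map_matrix_def vec_eq_iff)

lemma cnj_mat_mult: "cnj_mat (M ** M') = cnj_mat M ** cnj_mat M'"
  by (simp add: map_matrix_def matrix_matrix_mult_def vec_eq_iff)

lemma cnj_mat_cnj_mat: "cnj_mat (cnj_mat M) = M"
  by (simp add: map_matrix_def vec_eq_iff)

lemma cnj_mat_1: "cnj_mat (mat 1) = mat 1"
  by (auto simp: map_matrix_def mat_def vec_eq_iff)

lemma cnj_mat_add: "cnj_mat (M + M') = cnj_mat M + cnj_mat M'"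
  by (simp add: map_matrix_def vec_eq_iff)

context quadratic_hamiltonian
begin

abbreviation "\<Phi> \<equiv> Phi A B"
abbreviation "\<Psi> \<equiv> Psi A B"
abbreviation "Ac \<equiv> cnj_mat A"

text \<open>\<open>C\<close> and \<open>D\<close> are the diagonal blocks of \<open>G\<close>; in
  this notation all derivatives below are products of blocks.\<close>

definition C :: "complex^'n^'n" where "C = smult_mat (- \<i>) B"
definition D :: "complex^'n^'n" where "D = smult_mat \<i> (cnj_mat B)"

lemma transpose_D: "transpose D = - C"
  and transpose_C: "transpose C = - D"
  and cnj_C: "cnj_mat C = D"
  and cnj_D: "cnj_mat D = C"
  and transpose_A: "transpose A = A"
  and transpose_Ac: "transpose Ac = Ac"
  by (simp_all add: C_def D_def transpose_def smult_mat_def map_matrix_def vec_eq_iff B_herm A_sym)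

text \<open>With \<open>G\<close> multiplied on the right, the upper block row of the exponential
  satisfies a closed system in \<Phi> and \<Psi> alone.\<close>

lemma Phi_derivative: "(\<Phi> has_vector_derivative \<Phi> t ** C + \<Psi> t ** Ac) (at t)"
proof (intro has_vector_derivative_vecI)
  fix i j
  show "((\<lambda>t. \<Phi> t $ i $ j) has_vector_derivative (\<Phi> t ** C + \<Psi> t ** Ac) $ i $ j) (at t)"
    using has_vector_derivative_nth[OF has_vector_derivative_nth[OF mat_exp_derivative'[of G t]], of "Inl i" "Inl j"]
    by (simp add: mat_exp_Phi matrix_matrix_mult_def sum_UNIV_Plus G_entries C_def smult_mat_def map_matrix_def)
qed

lemma Psi_derivative: "(\<Psi> has_vector_derivative \<Phi> t ** A + \<Psi> t ** D) (at t)"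
proof (intro has_vector_derivative_vecI)
  fix i j
  show "((\<lambda>t. \<Psi> t $ i $ j) has_vector_derivative (\<Phi> t ** A + \<Psi> t ** D) $ i $ j) (at t)"
    using has_vector_derivative_nth[OF has_vector_derivative_nth[OF mat_exp_derivative'[of G t]], of "Inl i" "Inr j"]
    by (simp add: mat_exp_Phi matrix_matrix_mult_def sum_UNIV_Plus G_entries D_def smult_mat_def map_matrix_def)
qed

lemma Phi_0: "\<Phi> 0 = mat 1" and Psi_0: "\<Psi> 0 = 0"
  using mat_exp_0[of G] by (simp_all add: Phi_def Psi_def mat_def vec_eq_iff)

lemma cnj_Phi_derivative: "((\<lambda>t. cnj_mat (\<Phi> t)) has_vector_derivative cnj_mat (\<Phi> t) ** D + cnj_mat (\<Psi> t) ** A) (at t)"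
  using bounded_linear.has_vector_derivative[OF bounded_linear_cnj_mat Phi_derivative[of t]]
  by (simp add: cnj_mat_mult cnj_mat_add cnj_mat_cnj_mat cnj_C)

lemma cnj_Psi_derivative: "((\<lambda>t. cnj_mat (\<Psi> t)) has_vector_derivative cnj_mat (\<Phi> t) ** Ac + cnj_mat (\<Psi> t) ** C) (at t)"
  using bounded_linear.has_vector_derivative[OF bounded_linear_cnj_mat Psi_derivative[of t]]
  by (simp add: cnj_mat_mult cnj_mat_add cnj_mat_cnj_mat cnj_D)

lemma constant_of_derivative_zero:
  fixes f :: "real \<Rightarrow> 'a::real_normed_vector"
  assumes "\<And>t. (f has_vector_derivative 0) (at t)"
  shows "f t = f 0"
proof -
  obtain c where "\<And>t. f t = c"
    using has_vector_derivative_zero_constant[of UNIV f] assms by auto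
  then show ?thesis by simp
qed

text \<open>A conserved quantity: the derivative cancels because transposition exchanges the
  diagonal blocks up to sign and fixes the off-diagonal ones. \<open>symplectic2\<close> arises in
  the same way.\<close>

lemma symplectic1: "\<Phi> t ** transpose (\<Psi> t) = \<Psi> t ** transpose (\<Phi> t)"
proof -
  have "((\<lambda>t. \<Phi> t ** transpose (\<Psi> t) - \<Psi> t ** transpose (\<Phi> t)) has_vector_derivative 0) (at t)" for t
  proof -
    have "((\<lambda>t. \<Phi> t ** transpose (\<Psi> t) - \<Psi> t ** transpose (\<Phi> t)) has_vector_derivative
        (\<Phi> t ** transpose (\<Phi> t ** A + \<Psi> t ** D) + (\<Phi> t ** C + \<Psi> t ** Ac) ** transpose (\<Psi> t))
        - (\<Psi> t ** transpose (\<Phi> t ** C + \<Psi> t ** Ac) + (\<Phi> t ** A + \<Psi> t ** D) ** transpose (\<Phi> t))) (at t)"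
      by (intro has_vector_derivative_diff has_vector_derivative_matrix_mult Phi_derivative Psi_derivative
          bounded_linear.has_vector_derivative[OF bounded_linear_transpose])
    then show ?thesis
      by (simp add: mat_simps transpose_add matrix_transpose_mul transpose_D transpose_C transpose_A transpose_Ac matrix_mul_assoc)
  qed
  from constant_of_derivative_zero[OF this, of t] show ?thesis by (simp add: Psi_0 bounded_bilinear.zero_left[OF bounded_bilinear_matrix_mult] transpose_def matrix_matrix_mult_def vec_eq_iff)
qed

lemma symplectic2: "\<Phi> t ** transpose (cnj_mat (\<Phi> t)) - \<Psi> t ** transpose (cnj_mat (\<Psi> t)) = mat 1"
proof -
  have "((\<lambda>t. \<Phi> t ** transpose (cnj_mat (\<Phi> t)) - \<Psi> t ** transpose (cnj_mat (\<Psi> t))) has_vector_derivative 0) (at t)" for t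
  proof -
    have "((\<lambda>t. \<Phi> t ** transpose (cnj_mat (\<Phi> t)) - \<Psi> t ** transpose (cnj_mat (\<Psi> t))) has_vector_derivative
        (\<Phi> t ** transpose (cnj_mat (\<Phi> t) ** D + cnj_mat (\<Psi> t) ** A) + (\<Phi> t ** C + \<Psi> t ** Ac) ** transpose (cnj_mat (\<Phi> t)))
        - (\<Psi> t ** transpose (cnj_mat (\<Phi> t) ** Ac + cnj_mat (\<Psi> t) ** C) + (\<Phi> t ** A + \<Psi> t ** D) ** transpose (cnj_mat (\<Psi> t)))) (at t)"
      by (intro has_vector_derivative_diff has_vector_derivative_matrix_mult Phi_derivative Psi_derivative
          cnj_Phi_derivative cnj_Psi_derivative bounded_linear.has_vector_derivative[OF bounded_linear_transpose])
    then show ?thesis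
      by (simp add: mat_simps transpose_add matrix_transpose_mul transpose_D transpose_C transpose_A transpose_Ac matrix_mul_assoc)
  qed
  from constant_of_derivative_zero[OF this, of t] show ?thesis
    by (simp add: Psi_0 Phi_0 cnj_mat_1 bounded_bilinear.zero_left[OF bounded_bilinear_matrix_mult])
qed

text \<open>Pairing \<open>symplectic2\<close> with x and its conjugate shows that the squared norm
  of \<Phi>^T x equals that of x plus that of \<Psi>^T x. So the transpose of \<Phi> has trivial
  kernel.\<close>

lemma det_Phi: "det (\<Phi> t) \<noteq> 0"
proof -
  have "x = 0" if x: "transpose (\<Phi> t) *v x = 0" for x
  proof -
    have cnj: "bform y (cnj_vec y) = (\<Sum>i\<in>UNIV. of_real ((cmod (y $ i))\<^sup>2))" for y :: "complex^'n"
      by (simp add: bform_def cnj_vec_def complex_norm_square del: of_real_power)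
    have tc: "transpose (cnj_mat M) *v cnj_vec x = cnj_vec (transpose M *v x)" for M :: "complex^'n^'n"
      by (simp add: transpose_def map_matrix_def cnj_vec_def matrix_vector_mult_def vec_eq_iff)
    have "bform x (cnj_vec x) = bform x ((\<Phi> t ** transpose (cnj_mat (\<Phi> t)) - \<Psi> t ** transpose (cnj_mat (\<Psi> t))) *v cnj_vec x)"
      by (simp add: symplectic2)
    also have "\<dots> = bform (transpose (\<Phi> t) *v x) (cnj_vec (transpose (\<Phi> t) *v x)) - bform (transpose (\<Psi> t) *v x) (cnj_vec (transpose (\<Psi> t) *v x))"
      by (simp add: matvec_simps bform_simps tc bform_transpose[of x] flip: matrix_vector_mul_assoc del: transpose_matrix_vector)
    also have "\<dots> = - bform (transpose (\<Psi> t) *v x) (cnj_vec (transpose (\<Psi> t) *v x))"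
      unfolding x by (simp add: bform_def)
    finally have "complex_of_real ((\<Sum>i\<in>UNIV. (cmod (x $ i))\<^sup>2) + (\<Sum>i\<in>UNIV. (cmod ((transpose (\<Psi> t) *v x) $ i))\<^sup>2)) = 0"
      by (simp add: cnj del: transpose_matrix_vector)
    then have "(\<Sum>i\<in>UNIV. (cmod (x $ i))\<^sup>2) + (\<Sum>i\<in>UNIV. (cmod ((transpose (\<Psi> t) *v x) $ i))\<^sup>2) = 0"
      by (simp only: of_real_eq_0_iff)
    then have "(\<Sum>i\<in>UNIV. (cmod (x $ i))\<^sup>2) = 0"
      using sum_nonneg[of UNIV "\<lambda>i. (cmod (x $ i))\<^sup>2"] sum_nonneg[of UNIV "\<lambda>i. (cmod ((transpose (\<Psi> t) *v x) $ i))\<^sup>2"]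
      by (simp add: add_nonneg_eq_0_iff)
    then show "x = 0" by (simp add: sum_nonneg_eq_0_iff vec_eq_iff)
  qed
  then have "invertible (transpose (\<Phi> t))"
    by (simp add: invertible_left_inverse matrix_left_invertible_ker)
  then show ?thesis by (simp add: invertible_det_nz)
qed

abbreviation "N t \<equiv> matrix_inv (\<Phi> t)"
abbreviation "R \<equiv> R_mat A B"

lemmas N_inverse = matrix_inv_inverse[OF det_Phi]

lemma transpose_R: "transpose (R t) = R t"
proof -
  have "R t = N t ** (\<Psi> t ** transpose (\<Phi> t)) ** transpose (N t)"
    by (simp add: R_mat_def transpose_mat N_inverse flip: matrix_mul_assoc matrix_transpose_mul)
  also have "\<dots> = N t ** \<Phi> t ** transpose (\<Psi> t) ** transpose (N t)"
    by (simp add: matrix_mul_assoc symplectic1[symmetric, unfolded])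
  finally show ?thesis by (simp add: N_inverse R_mat_def matrix_transpose_mul)
qed

text \<open>The conjugate of \<open>symplectic2\<close>, with the transpose of \<Psi> replaced by
  \<open>R\<close> times the transpose of \<Phi>. It brings the derivative of \<open>rho_bar\<close>
  to a congruence of \<open>Ac\<close>.\<close>

lemma transpose_N: "cnj_mat (\<Phi> t) - cnj_mat (\<Psi> t) ** R t = transpose (N t)"
proof -
  have "cnj_mat (transpose M) = transpose (cnj_mat M)" "cnj_mat (M - M') = cnj_mat M - cnj_mat M'" for M M' :: "complex^'n^'n"
    by (simp_all add: map_matrix_def transpose_def vec_eq_iff)
  then have c: "cnj_mat (\<Phi> t) ** transpose (\<Phi> t) - cnj_mat (\<Psi> t) ** transpose (\<Psi> t) = mat 1"
    using arg_cong[OF symplectic2[of t], of cnj_mat] by (simp add: cnj_mat_mult cnj_mat_cnj_mat cnj_mat_1)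
  have "R t ** transpose (\<Phi> t) = transpose (\<Psi> t)"
    by (simp add: R_mat_def matrix_mul_assoc N_inverse flip: matrix_mul_assoc symplectic1)
      (simp add: matrix_mul_assoc N_inverse)
  with c have "(cnj_mat (\<Phi> t) - cnj_mat (\<Psi> t) ** R t) ** transpose (\<Phi> t) = mat 1"
    by (simp add: mat_simps flip: matrix_mul_assoc)
  then have "(cnj_mat (\<Phi> t) - cnj_mat (\<Psi> t) ** R t) ** (transpose (\<Phi> t) ** transpose (N t)) = transpose (N t)"
    by (simp add: matrix_mul_assoc)
  then show ?thesis by (simp add: N_inverse transpose_mat flip: matrix_transpose_mul)
qed

lemma N_derivative: "((\<lambda>t. N t) has_vector_derivative - ((C + R t ** Ac) ** N t)) (at t)"
  using matrix_inv_derivative[OF Phi_derivative det_Phi, of t]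
  by (simp add: mat_simps matrix_mul_assoc N_inverse R_mat_def)

text \<open>A matrix Riccati equation.\<close>

lemma R_derivative: "(R has_vector_derivative A + R t ** D - (C + R t ** Ac) ** R t) (at t)"
proof -
  have "((\<lambda>t. N t ** \<Psi> t) has_vector_derivative N t ** (\<Phi> t ** A + \<Psi> t ** D) + (- ((C + R t ** Ac) ** N t)) ** \<Psi> t) (at t)"
    by (rule has_vector_derivative_matrix_mult[OF N_derivative Psi_derivative])
  then show ?thesis
    by (simp add: R_mat_def[abs_def] mat_simps matrix_mul_assoc N_inverse algebra_simps)
qed

lemma rho_derivative: "(rho_bar A B has_vector_derivative transpose (N t) ** Ac ** N t) (at t)"
proof -
  have "((\<lambda>t. cnj_mat (\<Psi> t) ** N t) has_vector_derivative
      cnj_mat (\<Psi> t) ** (- ((C + R t ** Ac) ** N t)) + (cnj_mat (\<Phi> t) ** Ac + cnj_mat (\<Psi> t) ** C) ** N t) (at t)"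
    by (rule has_vector_derivative_matrix_mult[OF cnj_Psi_derivative N_derivative])
  moreover have "cnj_mat (\<Psi> t) ** (- ((C + R t ** Ac) ** N t)) + (cnj_mat (\<Phi> t) ** Ac + cnj_mat (\<Psi> t) ** C) ** N t
      = transpose (N t) ** Ac ** N t"
    unfolding transpose_N[symmetric] by (simp add: mat_simps matrix_mul_assoc algebra_simps)
  ultimately show ?thesis by (simp add: rho_bar_def[abs_def])
qed

end

section \<open>The vacuum amplitude\<close>

context quadratic_hamiltonian
begin

abbreviation "zc \<equiv> cnj_vec z"

definition uvec :: "real \<Rightarrow> complex^'n" where "uvec t = N t *v z"
definition wvec :: "real \<Rightarrow> complex^'n" where "wvec t = R t *v zc"
text \<open>The first moments divided by the amplitude, as \<open>mom1_eq\<close> shows without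
  dividing.\<close>

definition vvec :: "real \<Rightarrow> complex^'n" where "vvec t = uvec t - z - wvec t"

lemma Phi_solve:
  assumes "\<Phi> t *v x = y"
  shows "x = N t *v y"
  using N_inverse(2)[of t] by (simp add: assms[symmetric] matrix_vector_mul_assoc)

lemma mom1_eq: "mom1 t j = vvec t $ j * amp t"
proof -
  have "\<Phi> t *v (\<chi> j. mom1 t j + z $ j * amp t) = amp t *s (z - \<Psi> t *v zc)"
    using moment_eq1[of t] by (simp add: vec_eq_iff matrix_vector_mult_def cnj_vec_def algebra_simps sum_distrib_left)
  then have "(\<chi> j. mom1 t j + z $ j * amp t) = amp t *s (uvec t - wvec t)"
    by (drule_tac Phi_solve) (simp add: uvec_def wvec_def R_mat_def matvec_simps vector_scalar_commute
        flip: matrix_vector_mul_assoc)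
  then have "mom1 t j + z $ j * amp t = amp t * (uvec t $ j - wvec t $ j)"
    by (simp add: vec_eq_iff right_diff_distrib)
  then show ?thesis by (simp add: vvec_def algebra_simps)
qed

text \<open>Gaussian structure: the second moment is the product of first moments with a correction
  \<open>- R\<close> that does not involve \<open>z\<close>. This correction produces the trace term
  in \<open>amp_ode\<close>.\<close>

lemma mom2_eq: "mom2 t j k = (vvec t $ j * vvec t $ k - R t $ j $ k) * amp t"
proof -
  have "\<Phi> t *v (\<chi> j. mom2 t j k + z $ j * mom1 t k) = mom1 t k *s (z - \<Psi> t *v zc) - amp t *s (\<Psi> t *v axis k 1)"
  proof -
    have "(\<Sum>j\<in>UNIV. \<Psi> t $ i $ j * ((if j = k then amp t else 0) + cnj (z $ j) * mom1 t k))
        = \<Psi> t $ i $ k * amp t + mom1 t k * (\<Sum>j\<in>UNIV. \<Psi> t $ i $ j * cnj (z $ j))" for i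
      by (simp add: distrib_left sum.distrib sum_distrib_left mult_ac if_distrib[of "(*) _"] cong: if_cong)
    moreover have "(\<Psi> t *v axis k 1) $ i = \<Psi> t $ i $ k" for i
      by (simp add: matrix_vector_mult_def axis_def if_distrib[of "(*) _"] cong: if_cong)
    ultimately show ?thesis
      using moment_eq2[of t _ k] by (simp add: vec_eq_iff) (simp add: matrix_vector_mult_def cnj_vec_def algebra_simps)
  qed
  then have "(\<chi> j. mom2 t j k + z $ j * mom1 t k) = mom1 t k *s (uvec t - wvec t) - amp t *s (R t *v axis k 1)"
    by (drule_tac Phi_solve) (simp add: uvec_def wvec_def R_mat_def matvec_simps vector_scalar_commute
        flip: matrix_vector_mul_assoc)
  moreover have "(R t *v axis k 1) $ j = R t $ j $ k"
    by (simp add: matrix_vector_mult_def axis_def if_distrib[of "(*) _"] cong: if_cong)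
  ultimately have "mom2 t j k + z $ j * mom1 t k = mom1 t k * (uvec t $ j - wvec t $ j) - amp t * R t $ j $ k"
    by (simp add: vec_eq_iff right_diff_distrib)
  then show ?thesis by (simp add: vvec_def mom1_eq algebra_simps)
qed

lemma cnj_h: "cnj_vec h = Ac *v z + D *v zc"
  by (simp add: vec_eq_iff cnj_vec_def cnj_h_eq matrix_vector_mult_def map_matrix_def D_def smult_mat_def)

lemma amp_ode:
  "(amp has_vector_derivative
     (1/2 * bform (vvec t) (Ac *v vvec t) - 1/2 * trace (Ac ** R t) + bform (cnj_vec h) (vvec t)) * amp t) (at t)"
proof -
  have quad: "(\<Sum>i\<in>UNIV. \<Sum>j\<in>UNIV. cnj (A $ i $ j) * mom2 t i j)
      = bform (vvec t) (Ac *v vvec t) * amp t - trace (Ac ** R t) * amp t"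
  proof -
    have Rs: "R t $ j $ i = R t $ i $ j" for i j
      using arg_cong[OF transpose_R[of t], of "\<lambda>M. M $ i $ j"] by (simp add: transpose_def)
    have tr: "trace (Ac ** R t) = (\<Sum>i\<in>UNIV. \<Sum>j\<in>UNIV. cnj (A $ i $ j) * R t $ i $ j)"
      by (simp add: trace_def matrix_matrix_mult_def map_matrix_def Rs)
    have bf: "bform (vvec t) (Ac *v vvec t) = (\<Sum>i\<in>UNIV. \<Sum>j\<in>UNIV. cnj (A $ i $ j) * (vvec t $ i * vvec t $ j))"
      by (simp add: bform_def matrix_vector_mult_def map_matrix_def sum_distrib_left mult_ac)
    show ?thesis
      unfolding tr bf mom2_eq by (simp add: sum_distrib_left sum_distrib_right sum_subtractf algebra_simps)
  qed
  have lin: "(\<Sum>i\<in>UNIV. cnj (h $ i) * mom1 t i) = bform (cnj_vec h) (vvec t) * amp t"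
    by (simp add: mom1_eq bform_def cnj_vec_def sum_distrib_right mult.assoc)
  show ?thesis
    by (rule has_vector_derivative_eq_rhs[OF amp_derivative]) (simp only: quad lin, simp add: algebra_simps)
qed

definition expo :: "real \<Rightarrow> complex" where
  "expo t = - (\<i> * t / 2) * trace B
     + 1/2 * bform z ((rho_bar A B t - t *\<^sub>R Ac) *v z)
     - 1/2 * bform zc ((R t - t *\<^sub>R A) *v zc)
     + bform zc ((N t - mat 1 - smult_mat (\<i> * t) B) *v z)"

lemma smult_C: "smult_mat (\<i> * of_real t) B = - (t *\<^sub>R C)"
  by (simp add: smult_mat_def C_def vec_eq_iff scaleR_conv_of_real[of _ "_ :: complex"])

lemma trace_C: "trace C = - \<i> * trace B"
  by (simp add: trace_def C_def smult_mat_def sum_negf sum_distrib_left)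

text \<open>The terms linear in t cancel the isolated \<open>A\<close>, \<open>Ac\<close> and
  \<open>C\<close> in the derivatives of \<open>R\<close>, \<open>rho_bar\<close> and
  \<open>N\<close>. What remains is quadratic in \<open>z\<close>, its conjugate,
  \<open>uvec\<close> and \<open>wvec\<close>, and reassembles into the non-trace terms of
  \<open>amp_ode\<close> once \<open>h\<close> is expressed by \<open>z\<close>.\<close>

lemma expo_derivative:
  "(expo has_vector_derivative
     - (\<i> / 2) * trace B + 1/2 * bform (vvec t) (Ac *v vvec t) + bform (cnj_vec h) (vvec t)) (at t)"
proof -
  let ?d = "- (\<i> / 2) * trace B
     + 1/2 * bform z ((transpose (N t) ** Ac ** N t - Ac) *v z)
     - 1/2 * bform zc ((A + R t ** D - (C + R t ** Ac) ** R t - A) *v zc)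
     + bform zc ((- ((C + R t ** Ac) ** N t) + C) *v z)"
  note bv = bounded_linear.has_vector_derivative[OF
      bounded_linear_compose[OF bounded_bilinear.bounded_linear_right[OF bounded_bilinear_bform]
        bounded_bilinear.bounded_linear_left[OF bounded_bilinear_matrix_vector_mult]]]
  have lin: "((\<lambda>t. t *\<^sub>R M) has_vector_derivative M) (at t)" for M :: "complex^'n^'n"
    by (auto intro!: derivative_eq_intros)
  have "((\<lambda>t. complex_of_real t * (- (\<i> / 2) * trace B)
     + 1/2 * bform z ((rho_bar A B t - t *\<^sub>R Ac) *v z)
     - 1/2 * bform zc ((R t - t *\<^sub>R A) *v zc)
     + bform zc ((N t - mat 1 + t *\<^sub>R C) *v z)) has_vector_derivative
     1 * (- (\<i> / 2) * trace B)
     + 1/2 * bform z ((transpose (N t) ** Ac ** N t - Ac) *v z)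
     - 1/2 * bform zc ((A + R t ** D - (C + R t ** Ac) ** R t - A) *v zc)
     + bform zc ((- ((C + R t ** Ac) ** N t) - 0 + C) *v z)) (at t)"
    by (intro has_vector_derivative_add has_vector_derivative_diff has_vector_derivative_mult_right
        has_vector_derivative_mult_left bv lin rho_derivative R_derivative N_derivative has_vector_derivative_const)
      (auto intro!: has_vector_derivative_of_real derivative_eq_intros)
  then have "(expo has_vector_derivative ?d) (at t)"
    by (simp add: expo_def[abs_def] smult_C mult_ac)
  moreover have "?d = - (\<i> / 2) * trace B + 1/2 * bform (vvec t) (Ac *v vvec t) + bform (cnj_vec h) (vvec t)"
  proof -
    have R: "bform zc (R t *v y) = bform (wvec t) y" for y
      by (simp add: bform_transpose[of zc "R t"] transpose_R wvec_def del: transpose_matrix_vector)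
    have NT: "bform z (transpose (N t) *v y) = bform (uvec t) y" for y
      by (simp add: bform_transpose[of z "transpose (N t)"] uvec_def del: transpose_matrix_vector)
    have Ac: "bform x (Ac *v y) = bform y (Ac *v x)" for x y
      by (metis bform_commute bform_transpose transpose_Ac)
    have Dc: "bform (D *v x) y = - bform x (C *v y)" for x y
      using bform_transpose[of y D x] by (simp add: transpose_D matvec_simps bform_simps bform_commute del: transpose_matrix_vector)
    have Acl: "bform (Ac *v x) y = bform y (Ac *v x)" for x y by (rule bform_commute)
    have Dw: "bform (wvec t) (D *v zc) = - bform zc (C *v wvec t)"
      by (metis Dc bform_commute)
    show ?thesis
      unfolding cnj_h vvec_def
      by (simp add: matvec_simps bform_simps mat_simps R NT Dc Dw Acl flip: matrix_vector_mul_assoc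
          uvec_def wvec_def del: transpose_matrix_vector)
        (simp add: algebra_simps add_divide_distrib diff_divide_distrib Ac[of "uvec t" z] Ac[of "wvec t" z] Ac[of "wvec t" "uvec t"])
  qed
  ultimately show ?thesis by (simp only:)
qed

lemma expo_0: "expo 0 = 0"
proof -
  have N0: "N 0 = mat 1"
    using N_inverse(1)[of 0] by (simp add: Phi_0)
  have "cnj_mat 0 = (0 :: complex^'n^'n)" by (simp add: map_matrix_def vec_eq_iff)
  then show ?thesis
    by (simp add: expo_def rho_bar_def R_mat_def N0 Psi_0 smult_mat_def bform_def matrix_vector_mult_def vec_eq_iff)
qed

lemma amp_square: "(amp t * exp (- expo t))\<^sup>2 = 1 / det (\<Phi> t)"
proof -
  \<comment> \<open>Logarithmic derivatives, with V, W, S as below: V - S + 2W from the squared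
    amplitude, \<i> tr B - V - 2W from the exponential, and S - \<i> tr B from the determinant. They
    add up to 0.\<close>
  define q where "q t = (amp t * amp t) * exp (- 2 * expo t) * det (\<Phi> t)" for t
  have "(q has_vector_derivative 0) (at t)" for t
  proof -
    define V where "V = bform (vvec t) (Ac *v vvec t)"
    define W where "W = bform (cnj_vec h) (vvec t)"
    define S where "S = trace (Ac ** R t)"
    have amp': "(amp has_vector_derivative (1/2 * V - 1/2 * S + W) * amp t) (at t)"
      unfolding V_def W_def S_def by (rule amp_ode)
    have expo': "(expo has_vector_derivative - (\<i> / 2) * trace B + 1/2 * V + W) (at t)"
      unfolding V_def W_def by (rule expo_derivative)
    have ex: "((\<lambda>t. exp (- 2 * expo t)) has_vector_derivative (- 2 * (- (\<i> / 2) * trace B + 1/2 * V + W)) * exp (- 2 * expo t)) (at t)"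
    proof -
      have "((\<lambda>t. - 2 * expo t) has_vector_derivative - 2 * (- (\<i> / 2) * trace B + 1/2 * V + W)) (at t)"
        by (rule has_vector_derivative_mult_right[OF expo'])
      from field_vector_diff_chain_at[OF this DERIV_exp] show ?thesis by (simp add: o_def)
    qed
    have "trace (N t ** (\<Phi> t ** C + \<Psi> t ** Ac)) = - \<i> * trace B + S"
    proof -
      have "N t ** (\<Phi> t ** C + \<Psi> t ** Ac) = C + R t ** Ac"
        by (simp add: mat_simps matrix_mul_assoc N_inverse R_mat_def)
      moreover have "trace (R t ** Ac) = S" unfolding S_def by (rule trace_mul_sym)
      ultimately show ?thesis by (simp add: trace_add trace_C)
    qed
    then have det': "((\<lambda>t. det (\<Phi> t)) has_vector_derivative det (\<Phi> t) * (- \<i> * trace B + S)) (at t)"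
      using Jacobi_det_derivative[OF Phi_derivative det_Phi, of t] by simp
    note d = has_vector_derivative_mult[OF has_vector_derivative_mult[OF has_vector_derivative_mult[OF amp' amp'] ex] det']
    show ?thesis
      unfolding q_def[abs_def]
      by (rule has_vector_derivative_eq_rhs[OF d]) (simp add: algebra_simps)
  qed
  then have "q t = q 0" by (rule constant_of_derivative_zero)
  also have "q 0 = 1" by (simp add: q_def amp_0 expo_0 Phi_0)
  finally have "(amp t)\<^sup>2 * (exp (- expo t))\<^sup>2 * det (\<Phi> t) = 1"
    by (simp add: q_def power2_eq_square flip: exp_add)
  then show ?thesis using det_Phi[of t] by (simp add: power_mult_distrib eq_divide_eq)
qed

text \<open>The quotient of two continuous branches takes only the values 1 and -1, hence is
  constant on the connected line, and it is 1 at time 0.\<close>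

lemma inv_sqrt_det_Phi_eq: "inv_sqrt_det_Phi A B = (\<lambda>t. amp t * exp (- expo t))"
  unfolding inv_sqrt_det_Phi_def
proof (rule the_equality)
  have cont: "continuous_on UNIV amp" "continuous_on UNIV expo"
    using amp_ode expo_derivative has_vector_derivative_continuous
    by (blast intro: continuous_at_imp_continuous_on)+
  show *: "continuous_on UNIV (\<lambda>t. amp t * exp (- expo t)) \<and> amp 0 * exp (- expo 0) = 1 \<and>
      (\<forall>t. (amp t * exp (- expo t))\<^sup>2 = 1 / det (\<Phi> t))"
    using cont by (auto simp: amp_0 expo_0 amp_square intro!: continuous_intros)
  fix b assume b: "continuous_on UNIV b \<and> b 0 = 1 \<and> (\<forall>t. (b t)\<^sup>2 = 1 / det (\<Phi> t))"
  define g where "g t = amp t * exp (- expo t)" for t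
  have g: "continuous_on UNIV g" "g 0 = 1" "\<And>t. (g t)\<^sup>2 = 1 / det (\<Phi> t)"
    using * by (simp_all add: g_def)
  have g0: "g t \<noteq> 0" for t using g(3)[of t] det_Phi[of t] by auto
  have "(b t / g t)\<^sup>2 = 1" for t
    using b g(3)[of t] det_Phi[of t] by (simp add: power_divide)
  then have range: "b t / g t \<in> {1, - 1}" for t unfolding power2_eq_1_iff by blast
  have "(\<lambda>t. b t / g t) constant_on UNIV"
  proof (rule continuous_finite_range_constant)
    show "continuous_on UNIV (\<lambda>t. b t / g t)" using b g(1) g0 by (intro continuous_on_divide) auto
    have "range (\<lambda>t. b t / g t) \<subseteq> {1, - 1}" by (rule image_subsetI) (rule range)
    then show "finite (range (\<lambda>t. b t / g t))" by (rule finite_subset) simp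
  qed simp
  then have "b t / g t = b 0 / g 0" for t unfolding constant_on_def by fastforce
  then show "b = (\<lambda>t. amp t * exp (- expo t))"
    using b g(2) g0 by (auto simp: fun_eq_iff g_def)
qed

lemma vacuum_amplitude: "cinner vac (exp_iH (H_hat A B h) t vac) = inv_sqrt_det_Phi A B t * exp (expo t)"
  by (simp add: exp_iH_H_hat inv_sqrt_det_Phi_eq exp_minus flip: amp_def)

end

theorem mainTheorem6:
  fixes A B :: "complex^'n::finite^'n" and h z :: "complex^'n" and t :: real
  assumes "A = transpose A"
    and "B = cnj_mat (transpose B)"
    and "det (G_mat A B) \<noteq> 0"
    and "stack z (cnj_vec z) = matrix_inv (G_mat A B) *v stack h (cnj_vec h)"
  shows "cinner vac (exp_iH (H_hat A B h) t vac) =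
    inv_sqrt_det_Phi A B t *
    exp (- (\<i> * t / 2) * trace B
         + 1/2 * bform z ((rho_bar A B t - t *\<^sub>R cnj_mat A) *v z)
         - 1/2 * bform (cnj_vec z) ((R_mat A B t - t *\<^sub>R A) *v cnj_vec z)
         + bform (cnj_vec z) ((matrix_inv (Phi A B t) - mat 1 - smult_mat (\<i> * t) B) *v z))"
proof -
  interpret quadratic_hamiltonian A B h z
  proof
    \<comment> \<open>Multiplying the defining equation of \<open>z\<close> by the invertible matrix
      \<open>G\<close> removes the inverse.\<close>
    show "G_mat A B *v stack z (cnj_vec z) = stack h (cnj_vec h)"
      unfolding assms(4) matrix_vector_mul_assoc matrix_inv_inverse(1)[OF assms(3)] by simp
  qed (use assms in auto)
  show ?thesis using vacuum_amplitude[of t] unfolding expo_def .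
qed

end
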